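(* Let $G\le\mathrm{Aut}(T)$ be a finitely generated branch group, and let $H$ be a group of homeomorphisms of strongly bounded type of a totally disconnected compact space $X$. Let $\rho:G\to H$ be an injective homomorphism, and let $Y\subset X$ be the essential support of the $G$-action on $X$ induced by $\rho$. Then there exists a continuous $G$-equivariant map $q:Y\to\partial T$.
   Context: $T$ is an infinite locally finite rooted tree, $\partial T$ its boundary; $\mathrm{Rist}_G(n)$ is the subgroup generated by the groups $\mathrm{Rist}_G(v)$ (elements acting trivially outside the subtree below $v$), $v$ at level $n$. $G$ is branch if it is transitive on each level and $\mathrm{Rist}_G(n)$ has finite index for all $n\ge1$. For $K$ acting on $X$, $\mathrm{supp}_X(K)$ is the closure of the set of non-fixed points; the essential support is $Y=\bigcap_{n\ge1}\mathrm{supp}_X(\mathrm{Rist}_G(n)')$, $K'$ denoting the derived subgroup. A Bratteli diagram consists of finite non-empty sets $(V_n)_{n\ge0}$, $(E_n)_{n\ge1}$ and surjections $\mathrm{o}:E_n\to V_{n-1}$, $\mathrm{t}:E_n\to V_n$; its path space $X_B$ is the set of infinite paths $e_1e_2\cdots$ with $e_i\in E_i$, $\mathrm{t}(e_i)=\mathrm{o}(e_{i+1})$, with the product topology. For a finite path $\gamma=e_1\cdots e_n$ set $\mathrm{t}(\gamma)=\mathrm{t}(e_n)$, let $C_\gamma$ be the cylinder of infinite paths starting with $\gamma$, and for $v\in V_n$ let $\mathcal{L}(v)$ be the set of finite paths ending at $v$. For $\gamma,\eta\in\mathcal{L}(v)$ the prefix replacement $F_{\gamma,\eta}:C_\gamma\to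 C_\eta$ is $\gamma e_{n+1}e_{n+2}\cdots\mapsto\eta e_{n+1}e_{n+2}\cdots$. For a homeomorphism $g$ of $X_B$, $x$ is a singularity of $g$ if the germ of $g$ at $x$ is not the germ of any prefix replacement; $A_v(g)$ is the number of $\gamma\in\mathcal{L}(v)$ such that $g|_{C_\gamma}$ is not a prefix replacement; $g$ is of bounded type if it has finitely many singularities and $\sup_vA_v(g)<\infty$. A group $H$ of homeomorphisms of $X_B$ is of strongly bounded type if it consists of homeomorphisms of bounded type and for every $x$ the isotropy group $H_x/H^0_x$ is locally finite ($H_x$ the stabilizer, $H^0_x$ the elements acting trivially near $x$). A group of homeomorphisms of a totally disconnected compact space $X$ is of strongly bounded type if some homeomorphism $X\cong X_B$ conjugates it to a group of strongly bounded type. *)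

theory Defs
  imports "HOL-Analysis.Analysis" "HOL-Algebra.Generated_Groups" "HOL-Algebra.Coset"
begin

definition fun_group :: "('x \<Rightarrow> 'x) set \<Rightarrow> ('x \<Rightarrow> 'x) monoid" where
  "fun_group A = \<lparr>carrier = A, monoid.mult = (\<circ>), one = id\<rparr>"

definition locally_finite_group :: "('g, 'b) monoid_scheme \<Rightarrow> bool" where
  "locally_finite_group K \<longleftrightarrow>
     (\<forall>S. finite S \<and> S \<subseteq> carrier K \<longrightarrow> finite (generate K S))"

definition rooted_tree :: "'a list set \<Rightarrow> bool" where
  "rooted_tree T \<longleftrightarrow> [] \<in> T \<and> (\<forall>v w. v @ w \<in> T \<longrightarrow> v \<in> T)"

definition infinite_locally_finite_rooted_tree :: "'a list set \<Rightarrow> bool" where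
  "infinite_locally_finite_rooted_tree T \<longleftrightarrow>
     rooted_tree T \<and> infinite T \<and> (\<forall>v\<in>T. finite {a. v @ [a] \<in> T})"

definition tree_aut :: "'a list set \<Rightarrow> ('a list \<Rightarrow> 'a list) \<Rightarrow> bool" where
  "tree_aut T g \<longleftrightarrow> bij_betw g T T \<and> g [] = [] \<and>
     (\<forall>v\<in>T. \<forall>w\<in>T. (\<exists>a. w = v @ [a]) \<longleftrightarrow> (\<exists>a. g w = g v @ [a])) \<and>
     (\<forall>v. v \<notin> T \<longrightarrow> g v = v)"

definition aut_group :: "'a list set \<Rightarrow> ('a list \<Rightarrow> 'a list) monoid" where
  "aut_group T = fun_group {g. tree_aut T g}"

definition boundary :: "'a list set \<Rightarrow> (nat \<Rightarrow> 'a) set" where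
  "boundary T = {\<xi>. \<forall>n. map \<xi> [0..<n] \<in> T}"

definition boundary_top :: "'a list set \<Rightarrow> (nat \<Rightarrow> 'a) topology" where
  "boundary_top T = subtopology (product_topology (\<lambda>_. discrete_topology UNIV) UNIV) (boundary T)"

definition bd_act :: "('a list \<Rightarrow> 'a list) \<Rightarrow> (nat \<Rightarrow> 'a) \<Rightarrow> (nat \<Rightarrow> 'a)" where
  "bd_act g \<xi> = (\<lambda>i. g (map \<xi> [0..<Suc i]) ! i)"

definition rist_vertex :: "'a list set \<Rightarrow> ('a list \<Rightarrow> 'a list) set \<Rightarrow> 'a list \<Rightarrow> ('a list \<Rightarrow> 'a list) set" where
  "rist_vertex T G v = {g \<in> G. \<forall>w\<in>T. \<not> (\<exists>u. w = v @ u) \<longrightarrow> g w = w}"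

definition rist_level :: "'a list set \<Rightarrow> ('a list \<Rightarrow> 'a list) set \<Rightarrow> nat \<Rightarrow> ('a list \<Rightarrow> 'a list) set" where
  "rist_level T G n = generate (fun_group G) (\<Union>v\<in>{v\<in>T. length v = n}. rist_vertex T G v)"

definition level_transitive :: "'a list set \<Rightarrow> ('a list \<Rightarrow> 'a list) set \<Rightarrow> bool" where
  "level_transitive T G \<longleftrightarrow>
     (\<forall>v\<in>T. \<forall>w\<in>T. length v = length w \<longrightarrow> (\<exists>g\<in>G. g v = w))"

definition branch_group :: "'a list set \<Rightarrow> ('a list \<Rightarrow> 'a list) set \<Rightarrow> bool" where
  "branch_group T G \<longleftrightarrow> subgroup G (aut_group T) \<and> level_transitive T G \<and>
     (\<forall>n\<ge>1. finite (rcosets\<^bsub>fun_group G\<^esub> (rist_level T G n)))"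

definition finitely_generated :: "('g, 'b) monoid_scheme \<Rightarrow> bool" where
  "finitely_generated K \<longleftrightarrow> (\<exists>S. finite S \<and> S \<subseteq> carrier K \<and> generate K S = carrier K)"

definition homeo_group :: "'x topology \<Rightarrow> ('x \<Rightarrow> 'x) monoid" where
  "homeo_group X = fun_group {h. homeomorphic_map X X h \<and> (\<forall>x. x \<notin> topspace X \<longrightarrow> h x = x)}"

definition totally_disconnected_space :: "'x topology \<Rightarrow> bool" where
  "totally_disconnected_space X \<longleftrightarrow> (\<forall>S. connectedin X S \<longrightarrow> (\<exists>a. S \<subseteq> {a}))"

definition supp_act :: "'x topology \<Rightarrow> ('g \<Rightarrow> 'x \<Rightarrow> 'x) \<Rightarrow> 'g set \<Rightarrow> 'x set" where
  "supp_act X \<rho> K = X closure_of {x \<in> topspace X. \<exists>g\<in>K. \<rho> g x \<noteq> x}"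

definition essential_support ::
  "'a list set \<Rightarrow> ('a list \<Rightarrow> 'a list) set \<Rightarrow> 'x topology \<Rightarrow> (('a list \<Rightarrow> 'a list) \<Rightarrow> 'x \<Rightarrow> 'x) \<Rightarrow> 'x set" where
  "essential_support T G X \<rho> =
     (\<Inter>n\<in>{1..}. supp_act X \<rho> (derived (fun_group G) (rist_level T G n)))"

record bratteli =
  BV :: "nat \<Rightarrow> nat set"
  BE :: "nat \<Rightarrow> nat set"           \<comment> \<open>E_n, used for n \<ge> 1\<close>
  Bo :: "nat \<Rightarrow> nat \<Rightarrow> nat"      \<comment> \<open>o : E_n \<rightarrow> V_{n-1}\<close>
  Bt :: "nat \<Rightarrow> nat \<Rightarrow> nat"      \<comment> \<open>t : E_n \<rightarrow> V_n\<close>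

definition bratteli_diagram :: "bratteli \<Rightarrow> bool" where
  "bratteli_diagram B \<longleftrightarrow>
     (\<forall>n. finite (BV B n) \<and> BV B n \<noteq> {}) \<and>
     (\<forall>n\<ge>1. finite (BE B n) \<and> BE B n \<noteq> {} \<and>
        Bo B n ` BE B n = BV B (n - 1) \<and> Bt B n ` BE B n = BV B n)"

text \<open>Infinite paths e_1 e_2 ...; the path p has p i = e_(i+1).\<close>
definition path_space :: "bratteli \<Rightarrow> (nat \<Rightarrow> nat) set" where
  "path_space B = {p. \<forall>i. p i \<in> BE B (Suc i) \<and> Bt B (Suc i) (p i) = Bo B (Suc (Suc i)) (p (Suc i))}"

definition path_top :: "bratteli \<Rightarrow> (nat \<Rightarrow> nat) topology" where
  "path_top B = subtopology (product_topology (\<lambda>_. discrete_topology UNIV) UNIV) (path_space B)"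

text \<open>Finite paths of length n ending at v (v \<in> V_n); for n = 0 the empty path at v.\<close>
definition fin_paths :: "bratteli \<Rightarrow> nat \<Rightarrow> nat \<Rightarrow> nat list set" where
  "fin_paths B n v = {\<gamma>. length \<gamma> = n \<and> v \<in> BV B n \<and>
     (\<forall>i<n. \<gamma> ! i \<in> BE B (Suc i)) \<and>
     (\<forall>i. Suc i < n \<longrightarrow> Bt B (Suc i) (\<gamma> ! i) = Bo B (Suc (Suc i)) (\<gamma> ! Suc i)) \<and>
     (n \<ge> 1 \<longrightarrow> Bt B n (\<gamma> ! (n - 1)) = v)}"

text \<open>Cylinder of a finite path \<gamma> ending at v \<in> V_n (for n = 0: paths starting at v).\<close>
definition cyl :: "bratteli \<Rightarrow> nat \<Rightarrow> nat \<Rightarrow> nat list \<Rightarrow> (nat \<Rightarrow> nat) set" where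
  "cyl B n v \<gamma> = {p \<in> path_space B. (\<forall>i<n. p i = \<gamma> ! i) \<and> Bo B (Suc n) (p n) = v}"

text \<open>Prefix replacement F_{\<gamma>,\<eta>} (as a map on C_\<gamma>).\<close>
definition prefix_repl :: "nat \<Rightarrow> nat list \<Rightarrow> (nat \<Rightarrow> nat) \<Rightarrow> (nat \<Rightarrow> nat)" where
  "prefix_repl n \<eta> p = (\<lambda>i. if i < n then \<eta> ! i else p i)"

definition singularity :: "bratteli \<Rightarrow> ((nat \<Rightarrow> nat) \<Rightarrow> (nat \<Rightarrow> nat)) \<Rightarrow> (nat \<Rightarrow> nat) \<Rightarrow> bool" where
  "singularity B g x \<longleftrightarrow> x \<in> path_space B \<and>
     \<not> (\<exists>n v \<gamma> \<eta>. \<gamma> \<in> fin_paths B n v \<and> \<eta> \<in> fin_paths B n v \<and> x \<in> cyl B n v \<gamma> \<and>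
          (\<exists>U. openin (path_top B) U \<and> x \<in> U \<and> U \<subseteq> cyl B n v \<gamma> \<and>
               (\<forall>y\<in>U. g y = prefix_repl n \<eta> y)))"

definition A_count :: "bratteli \<Rightarrow> ((nat \<Rightarrow> nat) \<Rightarrow> (nat \<Rightarrow> nat)) \<Rightarrow> nat \<Rightarrow> nat \<Rightarrow> nat" where
  "A_count B g n v = card {\<gamma> \<in> fin_paths B n v.
      \<not> (\<exists>\<eta>\<in>fin_paths B n v. \<forall>y\<in>cyl B n v \<gamma>. g y = prefix_repl n \<eta> y)}"

definition bounded_type :: "bratteli \<Rightarrow> ((nat \<Rightarrow> nat) \<Rightarrow> (nat \<Rightarrow> nat)) \<Rightarrow> bool" where
  "bounded_type B g \<longleftrightarrow> homeomorphic_map (path_top B) (path_top B) g \<and>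
     finite {x. singularity B g x} \<and>
     (\<exists>M. \<forall>n. \<forall>v\<in>BV B n. A_count B g n v \<le> M)"

definition stab :: "'x topology \<Rightarrow> ('x \<Rightarrow> 'x) set \<Rightarrow> 'x \<Rightarrow> ('x \<Rightarrow> 'x) set" where
  "stab X H x = {h \<in> H. h x = x}"

definition germ_stab :: "'x topology \<Rightarrow> ('x \<Rightarrow> 'x) set \<Rightarrow> 'x \<Rightarrow> ('x \<Rightarrow> 'x) set" where
  "germ_stab X H x = {h \<in> H. \<exists>U. openin X U \<and> x \<in> U \<and> (\<forall>y\<in>U. h y = y)}"

definition strongly_bounded_type_B :: "bratteli \<Rightarrow> ((nat \<Rightarrow> nat) \<Rightarrow> (nat \<Rightarrow> nat)) set \<Rightarrow> bool" where
  "strongly_bounded_type_B B H \<longleftrightarrow>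
     (\<forall>h\<in>H. bounded_type B h) \<and>
     (\<forall>x\<in>path_space B. locally_finite_group
        (fun_group (stab (path_top B) H x) Mod germ_stab (path_top B) H x))"

definition conj_map :: "bratteli \<Rightarrow> ('x \<Rightarrow> nat \<Rightarrow> nat) \<Rightarrow> ((nat \<Rightarrow> nat) \<Rightarrow> 'x) \<Rightarrow> ('x \<Rightarrow> 'x)
    \<Rightarrow> (nat \<Rightarrow> nat) \<Rightarrow> (nat \<Rightarrow> nat)" where
  "conj_map B \<phi> \<psi> h p = (if p \<in> path_space B then \<phi> (h (\<psi> p)) else p)"

definition strongly_bounded_type :: "'x topology \<Rightarrow> ('x \<Rightarrow> 'x) set \<Rightarrow> bool" where
  "strongly_bounded_type X H \<longleftrightarrow>
     (\<exists>B \<phi> \<psi>. bratteli_diagram B \<and> homeomorphic_maps X (path_top B) \<phi> \<psi> \<and>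
        strongly_bounded_type_B B (conj_map B \<phi> \<psi> ` H))"

end

theory Submission
  imports Defs "HOL-Library.Sublist"
begin

text \<open>
For a vertex \<open>u\<close> let \<open>Z(u)\<close> be the closure of the set of points of \<open>X\<close> that are moved by a
commutator of two elements of \<open>Rist(u)\<close>. As levels are finite, every point \<open>y\<close> of the essential
support lies in \<open>Z(u)\<close> for vertices \<open>u\<close> of every level, so on each level some vertex \<open>v\<close> is deep
at \<open>y\<close>: it has descendants \<open>u\<close> with \<open>y \<in> Z(u)\<close> on all further levels. The map \<open>q\<close> sends \<open>y\<close> to
the ray of deep vertices, and the point is that a level contains only one of them.

Suppose \<open>v \<noteq> w\<close> of the same level are deep at \<open>y\<close>. Then \<open>Rist(v)\<close> and \<open>Rist(w)\<close> have infinite orbits at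
\<open>y\<close>, since otherwise local finiteness of the isotropy groups would make a finite index subgroup act
trivially near \<open>y\<close>. Elements of bounded type change tails of paths in boundedly many places only, so
orbits of commuting finitely generated groups \<open>K\<close>, \<open>L\<close> contain no large two-dimensional grids: if
\<open>L y\<close> is infinite, then the \<open>K\<close>-orbits on the set of \<open>L\<close>-orbits near \<open>y\<close> are uniformly finite, and a
finite index subgroup of \<open>K\<close> preserves all these \<open>L\<close>-orbits. Taking \<open>K = Rist(v)\<close>, \<open>L = Rist(w)\<close>, this
yields a deep \<open>u\<close> below \<open>v\<close> and a translate \<open>u' \<noteq> u\<close> of it such that \<open>Rist(u')\<close> has an infinite orbit
at \<open>y\<close> too. Then a finite index subgroup of \<open>Rist(u)\<close> acts near \<open>y\<close> both through \<open>Rist(u')\<close> and through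
\<open>Rist(w)\<close>. All three groups commute, so this action is abelian, and it follows that \<open>u\<close> is not deep.
\<close>

section \<open>Groups of permutations\<close>

text \<open>Why a finite index subgroup can refute depth: let \<open>B\<close> be normal of finite
  index in \<open>R v\<close>. It contains pairs whose commutator moves a given vertex
  \<open>e\<close> far below \<open>v\<close> off itself, and then every commutator of two elements
  of \<open>R e\<close> is a product of \<open>R v\<close>-conjugates of such a commutator and of
  its inverse. By normality these conjugates are again commutators in \<open>B\<close>. So if
  commutators of \<open>B\<close> are trivial near \<open>y\<close>, then \<open>y\<close> lies in
  no \<open>Z e\<close> for \<open>e\<close> on some level below \<open>v\<close>. This asks for
  normal subgroups and for one neighbourhood serving all of \<open>B\<close>; both rely on finite
  generation, which \<open>R v\<close> inherits from \<open>G\<close>.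

  The grid bound depends on an order of quantifiers: a generator changes the tail class at a number
  of points bounded independently of the level \<open>n\<close>. Hence the number of rows is fixed
  before \<open>n\<close>, and the row length after it.

  Uniqueness of deep vertices also gives continuity, since the finitely many closed sets belonging
  to one level become disjoint. Nontrivial rigid stabilizers are not assumed but derived from a
  point of the essential support.\<close>

abbreviation finv :: "('b \<Rightarrow> 'b) \<Rightarrow> 'b \<Rightarrow> 'b" where
  "finv \<equiv> inv_into UNIV"

definition perm_group :: "('b \<Rightarrow> 'b) set \<Rightarrow> bool" where
  "perm_group K \<longleftrightarrow> id \<in> K \<and> (\<forall>g\<in>K. bij g \<and> finv g \<in> K) \<and> (\<forall>g\<in>K. \<forall>h\<in>K. g \<circ> h \<in> K)"

definition acts :: "('b \<Rightarrow> 'b) set \<Rightarrow> (('b \<Rightarrow> 'b) \<Rightarrow> 'w \<Rightarrow> 'w) \<Rightarrow> bool" where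
  "acts K \<beta> \<longleftrightarrow> (\<forall>\<omega>. \<beta> id \<omega> = \<omega>) \<and> (\<forall>g\<in>K. \<forall>h\<in>K. \<forall>\<omega>. \<beta> (g \<circ> h) \<omega> = \<beta> g (\<beta> h \<omega>))"

definition orb :: "(('b \<Rightarrow> 'b) \<Rightarrow> 'w \<Rightarrow> 'w) \<Rightarrow> ('b \<Rightarrow> 'b) set \<Rightarrow> 'w \<Rightarrow> 'w set" where
  "orb \<beta> K \<omega> = (\<lambda>k. \<beta> k \<omega>) ` K"

definition comm :: "('b \<Rightarrow> 'b) \<Rightarrow> ('b \<Rightarrow> 'b) \<Rightarrow> 'b \<Rightarrow> 'b" where
  "comm g h = g \<circ> h \<circ> finv g \<circ> finv h"

text \<open>Generation is phrased as an induction principle along the Cayley graph, for a generating set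
  closed under inverses.\<close>
definition gens :: "('b \<Rightarrow> 'b) set \<Rightarrow> ('b \<Rightarrow> 'b) set \<Rightarrow> bool" where
  "gens S K \<longleftrightarrow> finite S \<and> S \<subseteq> K \<and> (\<forall>s\<in>S. finv s \<in> S) \<and>
     (\<forall>P. id \<in> P \<and> (\<forall>s\<in>S. \<forall>p\<in>P. s \<circ> p \<in> P) \<longrightarrow> K \<subseteq> P)"

definition finite_index :: "('b \<Rightarrow> 'b) set \<Rightarrow> ('b \<Rightarrow> 'b) set \<Rightarrow> bool" where
  "finite_index A K \<longleftrightarrow> (\<exists>F. finite F \<and> F \<subseteq> K \<and> (\<forall>k\<in>K. \<exists>f\<in>F. finv f \<circ> k \<in> A))"

lemma perm_groupD:
  assumes "perm_group K"
  shows "id \<in> K" "g \<in> K \<Longrightarrow> bij g" "g \<in> K \<Longrightarrow> finv g \<in> K" "g \<in> K \<Longrightarrow> h \<in> K \<Longrightarrow> g \<circ> h \<in> K"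
  using assms by (auto simp: perm_group_def)

lemma perm_group_inv_simps:
  assumes "perm_group K" "g \<in> K"
  shows "g (finv g x) = x" "finv g (g x) = x" "g \<circ> finv g = id" "finv g \<circ> g = id" "finv (finv g) = g"
  using perm_groupD(2)[OF assms]
  by (auto simp: bij_is_inj bij_is_surj surj_f_inv_f inv_inv_eq fun_eq_iff)

lemma perm_group_inv_comp:
  assumes "perm_group K" "g \<in> K" "h \<in> K"
  shows "finv (g \<circ> h) = finv h \<circ> finv g"
  using o_inv_distrib perm_groupD(2)[OF assms(1)] assms(2,3) by blast

lemma perm_group_cancel:
  assumes "perm_group K" "g \<in> K"
  shows "g \<circ> (finv g \<circ> f) = f" "finv g \<circ> (g \<circ> f) = f"
  using perm_group_inv_simps[OF assms] by (auto simp: fun_eq_iff)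

lemma comm_in: "perm_group K \<Longrightarrow> g \<in> K \<Longrightarrow> h \<in> K \<Longrightarrow> comm g h \<in> K"
  unfolding comm_def by (intro perm_groupD(4) perm_groupD(3)) auto

lemma perm_group_Int: "perm_group A \<Longrightarrow> perm_group B \<Longrightarrow> perm_group (A \<inter> B)"
  by (auto simp: perm_group_def)

lemma actsD:
  assumes "acts K \<beta>"
  shows "\<beta> id \<omega> = \<omega>" "g \<in> K \<Longrightarrow> h \<in> K \<Longrightarrow> \<beta> (g \<circ> h) \<omega> = \<beta> g (\<beta> h \<omega>)"
  using assms by (auto simp: acts_def)

lemma acts_mono: "acts K \<beta> \<Longrightarrow> L \<subseteq> K \<Longrightarrow> acts L \<beta>"
  unfolding acts_def by blast

lemma acts_inv:
  assumes "perm_group K" "acts K \<beta>" "g \<in> K"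
  shows "\<beta> g (\<beta> (finv g) \<omega>) = \<omega>" "\<beta> (finv g) (\<beta> g \<omega>) = \<omega>"
  using actsD[OF assms(2)] perm_group_inv_simps[OF assms(1,3)] perm_groupD(3)[OF assms(1,3)] assms(3)
  by metis+

lemma acts_eq_iff:
  assumes "perm_group K" "acts K \<beta>" "g \<in> K"
  shows "\<beta> g \<omega> = \<beta> g \<eta> \<longleftrightarrow> \<omega> = \<eta>"
  using acts_inv[OF assms] by metis

lemma acts_image: "acts K \<beta> \<Longrightarrow> acts K (\<lambda>k W. \<beta> k ` W)"
  by (auto simp: acts_def image_image)

lemma perm_group_stab:
  assumes "perm_group K" "acts K \<beta>"
  shows "perm_group {k\<in>K. \<forall>\<omega>\<in>\<Omega>. \<beta> k \<omega> = \<omega>}"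
proof -
  have "\<beta> (finv k) \<omega> = \<omega>" if "k \<in> K" "\<beta> k \<omega> = \<omega>" for k \<omega>
    using acts_inv[OF assms that(1)] that(2) by metis
  then show ?thesis
    using assms by (auto simp: perm_group_def acts_def)
qed

lemma perm_group_stab1:
  assumes "perm_group K" "acts K \<beta>"
  shows "perm_group {k\<in>K. \<beta> k \<omega> = \<omega>}"
  using perm_group_stab[OF assms, of "{\<omega>}"] by simp

text \<open>Invariance of \<open>\<Omega>\<close> makes the pointwise stabilizer the kernel of an
  action. Normality is wanted because \<open>rist_derived_le\<close> conjugates elements of the
  subgroup by all of \<open>R v\<close>.\<close>

lemma kernel_normal:
  assumes K: "perm_group K" and a: "acts K \<beta>"
    and inv: "\<And>k \<omega>. k \<in> K \<Longrightarrow> \<omega> \<in> \<Omega> \<Longrightarrow> \<beta> k \<omega> \<in> \<Omega>"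
    and k: "k \<in> K" and b: "b \<in> {k\<in>K. \<forall>\<omega>\<in>\<Omega>. \<beta> k \<omega> = \<omega>}"
  shows "k \<circ> b \<circ> finv k \<in> {k\<in>K. \<forall>\<omega>\<in>\<Omega>. \<beta> k \<omega> = \<omega>}"
proof -
  have bK: "b \<in> K" and ki: "finv k \<in> K" using b perm_groupD(3)[OF K k] by auto
  have "\<beta> (k \<circ> b \<circ> finv k) \<omega> = \<omega>" if o: "\<omega> \<in> \<Omega>" for \<omega>
  proof -
    have "\<beta> (k \<circ> b \<circ> finv k) \<omega> = \<beta> k (\<beta> b (\<beta> (finv k) \<omega>))"
      unfolding actsD(2)[OF a perm_groupD(4)[OF K k bK] ki] actsD(2)[OF a k bK] ..
    also have "\<beta> b (\<beta> (finv k) \<omega>) = \<beta> (finv k) \<omega>" using b inv[OF ki o] by blast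
    also have "\<beta> k (\<beta> (finv k) \<omega>) = \<omega>" using acts_inv(1)[OF K a k] .
    finally show ?thesis .
  qed
  moreover have "k \<circ> b \<circ> finv k \<in> K" by (intro perm_groupD(4)[OF K] k bK ki)
  ultimately show ?thesis by blast
qed

section \<open>Conjugation and commutators\<close>

definition conjby :: "('b \<Rightarrow> 'b) \<Rightarrow> ('b \<Rightarrow> 'b) \<Rightarrow> 'b \<Rightarrow> 'b" where
  "conjby g k = g \<circ> k \<circ> finv g"

lemma conjby_comp:
  assumes "perm_group K" "g \<in> K"
  shows "conjby g (a \<circ> b) = conjby g a \<circ> conjby g b"
  unfolding conjby_def by (simp add: comp_assoc perm_group_cancel[OF assms])

lemma conjby_inv:
  assumes "perm_group K" "g \<in> K" "a \<in> K"
  shows "conjby g (finv a) = finv (conjby g a)"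
proof -
  note c = perm_groupD(3,4)[OF assms(1)] assms(2,3)
  have "finv (conjby g a) = finv (finv g) \<circ> (finv a \<circ> finv g)"
    unfolding conjby_def by (simp only: c perm_group_inv_comp[OF assms(1)])
  then show ?thesis unfolding conjby_def by (simp only: perm_group_inv_simps(5)[OF assms(1,2)] comp_assoc)
qed

lemma conjby_conjby:
  assumes "perm_group K" "g \<in> K" "h \<in> K"
  shows "conjby g (conjby h a) = conjby (g \<circ> h) a"
  unfolding conjby_def by (simp only: perm_group_inv_comp[OF assms] comp_assoc)

lemma conjby_comm:
  assumes "perm_group K" "g \<in> K" "a \<in> K" "b \<in> K"
  shows "conjby g (comm a b) = comm (conjby g a) (conjby g b)"
  unfolding comm_def using assms by (simp only: conjby_comp[OF assms(1,2)] conjby_inv)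

lemma comm_conjby: "comm g f = conjby g f \<circ> finv f"
  unfolding comm_def conjby_def ..

text \<open>The last hypothesis holds when \<^term>\<open>f\<close> moves the support of \<^term>\<open>g\<close> off that of \<^term>\<open>h\<close>.\<close>
lemma double_commutator:
  assumes "perm_group K" "g \<in> K" "h \<in> K" "f \<in> K" "conjby f (finv g) \<circ> h = h \<circ> conjby f (finv g)"
  shows "comm (comm g f) h = comm g h"
proof -
  note c = perm_groupD(3,4)[OF assms(1)] assms(2-4)
  define f' where "f' = conjby f (finv g)"
  have f': "f' \<in> K" unfolding f'_def conjby_def by (simp only: c)
  have e: "comm g f = g \<circ> f'" unfolding comm_def f'_def conjby_def by (simp only: comp_assoc)
  have "comm (comm g f) h = g \<circ> (f' \<circ> h) \<circ> (finv f' \<circ> finv g) \<circ> finv h"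
    unfolding e comm_def[of "g \<circ> f'"] by (simp only: perm_group_inv_comp[OF assms(1) assms(2) f'] comp_assoc)
  also have "\<dots> = g \<circ> (h \<circ> f') \<circ> (finv f' \<circ> finv g) \<circ> finv h" using assms(5) unfolding f'_def by (simp only:)
  also have "\<dots> = comm g h" unfolding comm_def
    by (simp only: comp_assoc perm_group_cancel[OF assms(1) f'])
  finally show ?thesis .
qed

lemma perm_group_if_subgroup:
  assumes "subgroup J (fun_group K)" "perm_group K" "\<And>g. g \<in> K \<Longrightarrow> m_inv (fun_group K) g = finv g"
  shows "perm_group J" "J \<subseteq> K"
proof -
  show sub: "J \<subseteq> K" using subgroup.subset[OF assms(1)] by (simp add: fun_group_def)
  have "finv g \<in> J" if "g \<in> J" for g
    using subgroup.m_inv_closed[OF assms(1) that] assms(3)[of g] that sub by auto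
  moreover have "g \<circ> h \<in> J" if "g \<in> J" "h \<in> J" for g h
    using subgroup.m_closed[OF assms(1) that] by (simp add: fun_group_def)
  moreover have "id \<in> J" using subgroup.one_closed[OF assms(1)] by (simp add: fun_group_def)
  ultimately show "perm_group J" using sub perm_groupD(2)[OF assms(2)] unfolding perm_group_def by blast
qed

section \<open>Generating sets and finite index\<close>

lemma gensI:
  assumes "perm_group K" "finite S" "S \<subseteq> K"
    and "\<And>P. id \<in> P \<Longrightarrow> (\<And>s p. s \<in> S \<Longrightarrow> p \<in> P \<Longrightarrow> s \<circ> p \<in> P) \<Longrightarrow>
       (\<And>s p. s \<in> S \<Longrightarrow> p \<in> P \<Longrightarrow> finv s \<circ> p \<in> P) \<Longrightarrow> K \<subseteq> P"
  shows "gens (S \<union> finv ` S) K"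
  unfolding gens_def
proof (intro conjI allI impI)
  show "finite (S \<union> finv ` S)" using assms(2) by simp
  show "S \<union> finv ` S \<subseteq> K" using assms(1,3) by (auto simp: perm_group_def)
  have "finv (finv s) = s" if "s \<in> S" for s
    using perm_group_inv_simps(5)[OF assms(1)] that assms(3) by blast
  then show "\<forall>s\<in>S \<union> finv ` S. finv s \<in> S \<union> finv ` S" by auto
  fix P assume "id \<in> P \<and> (\<forall>s\<in>S \<union> finv ` S. \<forall>p\<in>P. s \<circ> p \<in> P)"
  then show "K \<subseteq> P" by (intro assms(4)) auto
qed

lemma gensD:
  assumes "gens S K"
  shows "finite S" "S \<subseteq> K" "s \<in> S \<Longrightarrow> finv s \<in> S"
  using assms by (auto simp: gens_def)

lemma gens_induct [consumes 2, case_names id step]: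
  assumes "gens S K" "k \<in> K" "Q id" "\<And>s k. s \<in> S \<Longrightarrow> k \<in> K \<Longrightarrow> Q k \<Longrightarrow> Q (s \<circ> k)"
    and "perm_group K"
  shows "Q k"
proof -
  have "id \<in> {k\<in>K. Q k} \<and> (\<forall>s\<in>S. \<forall>p\<in>{k\<in>K. Q k}. s \<circ> p \<in> {k\<in>K. Q k})"
    using assms(3,4) perm_groupD[OF assms(5)] gensD(2)[OF assms(1)] by auto
  then have "K \<subseteq> {k\<in>K. Q k}"
    using assms(1) unfolding gens_def by blast
  then show ?thesis using assms(2) by auto
qed

lemma gens_image:
  assumes "perm_group K" "gens S K" "perm_group L" "\<pi> ` K = L"
    and hom: "\<And>g h. g \<in> K \<Longrightarrow> h \<in> K \<Longrightarrow> \<pi> (g \<circ> h) = \<pi> g \<circ> \<pi> h"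
  shows "\<exists>S'. gens S' L"
proof -
  \<comment> \<open>Only multiplicativity is given, so \<open>\<pi> id\<close> is first seen to be
    idempotent; cancellation in \<open>L\<close> then makes it the identity.\<close>
  have "\<pi> id \<circ> \<pi> id = \<pi> id" using hom[of id id] perm_groupD(1)[OF assms(1)] by simp
  moreover have "\<pi> id \<in> L" using assms(4) perm_groupD(1)[OF assms(1)] by auto
  ultimately have pid: "\<pi> id = id"
    using perm_group_cancel(2)[OF assms(3), of "\<pi> id" "\<pi> id"] perm_group_inv_simps(4)[OF assms(3)] by metis
  have "gens (\<pi> ` S \<union> finv ` \<pi> ` S) L"
  proof (rule gensI)
    show "finite (\<pi> ` S)" "\<pi> ` S \<subseteq> L" using assms(4) gensD[OF assms(2)] by auto
    fix P assume P: "id \<in> P" "\<And>s p. s \<in> \<pi> ` S \<Longrightarrow> p \<in> P \<Longrightarrow> s \<circ> p \<in> P"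
    have "\<pi> k \<in> P" if "k \<in> K" for k
      using assms(2) that
    proof (induct rule: gens_induct)
      case (step s k)
      then have "\<pi> (s \<circ> k) = \<pi> s \<circ> \<pi> k" using hom gensD(2)[OF assms(2)] by blast
      then show ?case using P(2)[of "\<pi> s" "\<pi> k"] step by (simp only: imageI)
    next
      case id
      show ?case using P(1) by (simp only: pid)
    qed (rule assms(1))
    then show "L \<subseteq> P" using assms(4) by auto
  qed fact
  then show ?thesis by blast
qed

text \<open>A function on \<open>K\<close> with finite range whose fibres lie in left cosets of
  \<open>A\<close> bounds the index, so a proof of finite index amounts to finding such an
  invariant.\<close>

lemma finite_indexI:
  assumes "finite (\<Psi> ` K)" "\<And>k k'. k \<in> K \<Longrightarrow> k' \<in> K \<Longrightarrow> \<Psi> k = \<Psi> k' \<Longrightarrow> finv k \<circ> k' \<in> A"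
  shows "finite_index A K"
proof -
  obtain F where F: "F \<subseteq> K" "finite F" "\<Psi> ` K = \<Psi> ` F"
    using finite_subset_image[OF assms(1), of \<Psi> K] by (metis subset_refl)
  have "\<exists>f\<in>F. finv f \<circ> k \<in> A" if "k \<in> K" for k
  proof -
    have "\<Psi> k \<in> \<Psi> ` F" using imageI[OF that, of \<Psi>] by (simp only: F(3))
    then obtain f where "f \<in> F" "\<Psi> k = \<Psi> f" by (elim imageE)
    then have "finv f \<circ> k \<in> A" using assms(2)[of f k] F(1) that by (metis subsetD)
    then show ?thesis using \<open>f \<in> F\<close> by blast
  qed
  then show ?thesis using F unfolding finite_index_def by blast
qed

lemma finite_indexE:
  assumes "finite_index A K"
  obtains \<Psi> where "finite (\<Psi> ` K)" "\<And>k. k \<in> K \<Longrightarrow> \<Psi> k \<in> K \<and> finv (\<Psi> k) \<circ> k \<in> A"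
proof -
  obtain F where F: "finite F" "F \<subseteq> K" "\<forall>k\<in>K. \<exists>f\<in>F. finv f \<circ> k \<in> A"
    using assms by (auto simp: finite_index_def)
  define \<Psi> where "\<Psi> k = (SOME f. f \<in> F \<and> finv f \<circ> k \<in> A)" for k
  have "\<Psi> k \<in> F \<and> finv (\<Psi> k) \<circ> k \<in> A" if "k \<in> K" for k
    unfolding \<Psi>_def using F(3) that by (metis (mono_tags, lifting) someI_ex)
  moreover from this have "finite (\<Psi> ` K)"
    using F(1) by (meson finite_subset image_subsetI)
  ultimately show ?thesis using that F(2) by blast
qed

lemma finite_index_mono:
  assumes "finite_index A K" "A \<subseteq> A'" shows "finite_index A' K"
proof -
  obtain F where "finite F" "F \<subseteq> K" "\<forall>k\<in>K. \<exists>f\<in>F. finv f \<circ> k \<in> A"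
    using assms(1) unfolding finite_index_def by blast
  then show ?thesis unfolding finite_index_def using assms(2) by (intro exI[of _ F] conjI) blast+
qed

lemma inv_comp_quotient:
  assumes "perm_group K" "perm_group A" "f \<in> K" "k \<in> K" "k' \<in> K" "finv f \<circ> k \<in> A" "finv f \<circ> k' \<in> A"
  shows "finv k \<circ> k' \<in> A"
proof -
  have "finv (finv f \<circ> k) = finv k \<circ> f"
    using perm_group_inv_comp[OF assms(1), of "finv f" k] assms perm_groupD(3)[OF assms(1)]
      perm_group_inv_simps(5)[OF assms(1,3)] by simp
  then have "(finv k \<circ> f) \<circ> (finv f \<circ> k') \<in> A"
    using perm_groupD(3,4)[OF assms(2)] assms(6,7) by metis
  then show ?thesis by (simp add: comp_assoc perm_group_cancel(1)[OF assms(1,3)])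
qed

lemma finite_index_Int:
  assumes "perm_group K" "perm_group A" "perm_group B" "finite_index A K" "finite_index B K"
  shows "finite_index (A \<inter> B) K"
proof -
  obtain \<Psi> where P: "finite (\<Psi> ` K)" "\<And>k. k \<in> K \<Longrightarrow> \<Psi> k \<in> K \<and> finv (\<Psi> k) \<circ> k \<in> A"
    using finite_indexE[OF assms(4)] by blast
  obtain \<Phi> where Q: "finite (\<Phi> ` K)" "\<And>k. k \<in> K \<Longrightarrow> \<Phi> k \<in> K \<and> finv (\<Phi> k) \<circ> k \<in> B"
    using finite_indexE[OF assms(5)] by blast
  show ?thesis
  proof (rule finite_indexI[where \<Psi> = "\<lambda>k. (\<Psi> k, \<Phi> k)"])
    show "finite ((\<lambda>k. (\<Psi> k, \<Phi> k)) ` K)"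
      by (rule finite_subset[of _ "\<Psi> ` K \<times> \<Phi> ` K"]) (use P(1) Q(1) in auto)
    fix k k' assume "k \<in> K" "k' \<in> K" "(\<Psi> k, \<Phi> k) = (\<Psi> k', \<Phi> k')"
    then show "finv k \<circ> k' \<in> A \<inter> B"
      using P(2)[of k] P(2)[of k'] Q(2)[of k] Q(2)[of k']
        inv_comp_quotient[OF assms(1,2), of "\<Psi> k" k k'] inv_comp_quotient[OF assms(1,3), of "\<Phi> k" k k']
      by auto
  qed
qed

lemma finite_index_restrict:
  assumes "perm_group K" "perm_group A" "finite_index A K" "perm_group J" "J \<subseteq> K"
  shows "finite_index (A \<inter> J) J"
proof -
  obtain \<Psi> where P: "finite (\<Psi> ` K)" "\<And>k. k \<in> K \<Longrightarrow> \<Psi> k \<in> K \<and> finv (\<Psi> k) \<circ> k \<in> A"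
    using finite_indexE[OF assms(3)] by blast
  show ?thesis
  proof (rule finite_indexI)
    show "finite (\<Psi> ` J)" using P(1) assms(5) by (meson finite_subset image_mono)
    fix k k' assume k: "k \<in> J" "k' \<in> J" "\<Psi> k = \<Psi> k'"
    then have "finv k \<circ> k' \<in> A"
      using P(2)[of k] P(2)[of k'] assms(5) inv_comp_quotient[OF assms(1,2), of "\<Psi> k" k k'] by auto
    moreover have "finv k \<circ> k' \<in> J" using k perm_groupD[OF assms(4)] by blast
    ultimately show "finv k \<circ> k' \<in> A \<inter> J" by blast
  qed
qed

section \<open>Stabilizers and kernels of actions\<close>

lemma finite_index_stab:
  assumes "perm_group K" "acts K \<beta>" "finite (orb \<beta> K \<omega>)"
  shows "finite_index {k\<in>K. \<beta> k \<omega> = \<omega>} K"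
proof (rule finite_indexI[where \<Psi> = "\<lambda>k. \<beta> k \<omega>"])
  show "finite ((\<lambda>k. \<beta> k \<omega>) ` K)" using assms(3) by (simp add: orb_def)
  fix k k' assume k: "k \<in> K" "k' \<in> K" "\<beta> k \<omega> = \<beta> k' \<omega>"
  then have "\<beta> (finv k \<circ> k') \<omega> = \<omega>"
    using actsD(2)[OF assms(2)] perm_groupD(3)[OF assms(1)] acts_inv(2)[OF assms(1,2)] by metis
  then show "finv k \<circ> k' \<in> {k \<in> K. \<beta> k \<omega> = \<omega>}"
    using k perm_groupD[OF assms(1)] by blast
qed

text \<open>Schreier's lemma, with \<open>t\<close> a transversal of the orbit and
  \<open>\<sigma>\<close> giving the Schreier generators. The action is arbitrary because the lemma
  is applied to points, to germs and to cosets.\<close>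

lemma schreier_gens_stab:
  assumes K: "perm_group K" and S: "gens S K" and a: "acts K \<beta>" and fin: "finite (orb \<beta> K \<omega>)"
  shows "\<exists>S'. gens S' {k\<in>K. \<beta> k \<omega> = \<omega>}"
proof -
  define t where "t \<eta> = (SOME k. k \<in> K \<and> \<beta> k \<omega> = \<eta>)" for \<eta>
  have t: "t \<eta> \<in> K \<and> \<beta> (t \<eta>) \<omega> = \<eta>" if "\<eta> \<in> orb \<beta> K \<omega>" for \<eta>
  proof -
    have "\<exists>k. k \<in> K \<and> \<beta> k \<omega> = \<eta>" using that by (auto simp: orb_def)
    then show ?thesis unfolding t_def by (rule someI_ex)
  qed
  have om: "\<beta> k \<omega> \<in> orb \<beta> K \<omega>" if "k \<in> K" for k using that by (auto simp: orb_def)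
  have om0: "\<omega> \<in> orb \<beta> K \<omega>" using om[OF perm_groupD(1)[OF K]] actsD(1)[OF a] by simp
  define \<sigma> where "\<sigma> = (\<lambda>(s,\<eta>). finv (t (\<beta> s \<eta>)) \<circ> s \<circ> t \<eta>)"
  \<comment> \<open>\<open>t \<omega>\<close> fixes \<open>\<omega>\<close> but need not be
    \<open>id\<close>, so it is added to be able to cancel it at both ends of a word.\<close>
  define S0 where "S0 = insert (t \<omega>) (\<sigma> ` (S \<times> orb \<beta> K \<omega>))"
  let ?Q = "{k\<in>K. \<beta> k \<omega> = \<omega>}"
  have SK: "s \<in> K" if "s \<in> S" for s using that gensD[OF S] by auto
  have orbS: "\<beta> s \<eta> \<in> orb \<beta> K \<omega>" if s: "s \<in> S" and e: "\<eta> \<in> orb \<beta> K \<omega>" for s \<eta>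
  proof -
    obtain k where "k \<in> K" "\<eta> = \<beta> k \<omega>" using e by (auto simp: orb_def)
    then have "\<beta> s \<eta> = \<beta> (s \<circ> k) \<omega>" "s \<circ> k \<in> K"
      using actsD(2)[OF a] SK[OF s] perm_groupD(4)[OF K] by auto
    then show ?thesis using om by metis
  qed
  have sub: "S0 \<subseteq> ?Q"
  proof -
    have "\<sigma> (s,\<eta>) \<in> ?Q" if s: "s \<in> S" and e: "\<eta> \<in> orb \<beta> K \<omega>" for s \<eta>
    proof -
      have t1: "t \<eta> \<in> K" "\<beta> (t \<eta>) \<omega> = \<eta>" using t[OF e] by auto
      have t2: "t (\<beta> s \<eta>) \<in> K" "\<beta> (t (\<beta> s \<eta>)) \<omega> = \<beta> s \<eta>" using t[OF orbS[OF s e]] by auto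
      have i: "finv (t (\<beta> s \<eta>)) \<in> K" using perm_groupD(3)[OF K t2(1)] .
      have "\<beta> (finv (t (\<beta> s \<eta>)) \<circ> s \<circ> t \<eta>) \<omega> = \<beta> (finv (t (\<beta> s \<eta>))) (\<beta> s \<eta>)"
        using actsD(2)[OF a] i SK[OF s] t1 perm_groupD(4)[OF K] by (metis comp_assoc)
      also have "\<dots> = \<omega>" using acts_inv(2)[OF K a t2(1), of \<omega>] t2(2) by simp
      finally show ?thesis unfolding \<sigma>_def using i SK[OF s] t1 perm_groupD(4)[OF K] by auto
    qed
    then show ?thesis using t[OF om0] unfolding S0_def by auto
  qed
  have "gens (S0 \<union> finv ` S0) ?Q"
  proof (rule gensI[OF perm_group_stab1[OF K a]])
    show "finite S0" unfolding S0_def using gensD(1)[OF S] fin by auto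
    show "S0 \<subseteq> ?Q" by fact
    fix P assume P: "id \<in> P" "\<And>s p. s \<in> S0 \<Longrightarrow> p \<in> P \<Longrightarrow> s \<circ> p \<in> P"
      "\<And>s p. s \<in> S0 \<Longrightarrow> p \<in> P \<Longrightarrow> finv s \<circ> p \<in> P"
    have main: "\<forall>p\<in>P. (finv (t (\<beta> k \<omega>)) \<circ> k) \<circ> p \<in> P" if "k \<in> K" for k
      using S that
    proof (induct rule: gens_induct)
      case id
      show ?case using P(3)[of "t \<omega>"] by (simp only: actsD(1)[OF a] S0_def comp_id) blast
    next
      case (step s k)
      define \<eta> where "\<eta> = \<beta> k \<omega>"
      have e: "\<eta> \<in> orb \<beta> K \<omega>" unfolding \<eta>_def using om step(2) .
      have "\<beta> (s \<circ> k) \<omega> = \<beta> s \<eta>" unfolding \<eta>_def using actsD(2)[OF a] SK step by auto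
      \<comment> \<open>Telescoping: the two factors \<open>t \<eta>\<close> cancel, and one
        Schreier generator splits off on the left.\<close>
      then have eq: "finv (t (\<beta> (s \<circ> k) \<omega>)) \<circ> (s \<circ> k) = \<sigma> (s,\<eta>) \<circ> (finv (t \<eta>) \<circ> k)"
        unfolding \<sigma>_def using t[OF e]
        by (simp add: comp_assoc perm_group_cancel(1)[OF K, of "t \<eta>"])
      show ?case
      proof
        fix p assume "p \<in> P"
        then have "(finv (t \<eta>) \<circ> k) \<circ> p \<in> P" using step(3) unfolding \<eta>_def by blast
        then have "\<sigma> (s,\<eta>) \<circ> ((finv (t \<eta>) \<circ> k) \<circ> p) \<in> P"
          using P(2)[of "\<sigma> (s,\<eta>)"] step(1) e unfolding S0_def by blast
        then show "finv (t (\<beta> (s \<circ> k) \<omega>)) \<circ> (s \<circ> k) \<circ> p \<in> P" unfolding eq by (simp add: comp_assoc)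
      qed
    qed (rule K)
    show "?Q \<subseteq> P"
    proof
      fix k assume k: "k \<in> ?Q"
      then have "(finv (t \<omega>) \<circ> k) \<circ> id \<in> P" using main[of k] P(1) by auto
      then have "t \<omega> \<circ> ((finv (t \<omega>) \<circ> k) \<circ> id) \<in> P" using P(2)[of "t \<omega>"] unfolding S0_def by blast
      then show "k \<in> P" using t[OF om0] by (simp add: comp_assoc perm_group_cancel(1)[OF K, of "t \<omega>"])
    qed
  qed
  then show ?thesis by blast
qed

text \<open>An orbit with at most \<open>m\<close> points is determined, up to labelling its points by numbers, by the
  permutations induced by the generators, for which there are only finitely many possibilities.\<close>
lemma finite_index_kernel:
  assumes K: "perm_group K" and S: "gens S K" and a: "acts K \<beta>"
    and bd: "\<And>\<omega>. \<omega> \<in> \<Omega> \<Longrightarrow> finite (orb \<beta> K \<omega>) \<and> card (orb \<beta> K \<omega>) \<le> m"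
  shows "finite_index {k\<in>K. \<forall>\<omega>\<in>\<Omega>. \<beta> k \<omega> = \<omega>} K"
proof -
  have "\<exists>f. inj_on f (orb \<beta> K \<omega>) \<and> f ` orb \<beta> K \<omega> \<subseteq> {..m}" if o: "\<omega> \<in> \<Omega>" for \<omega>
  proof -
    obtain f where "bij_betw f (orb \<beta> K \<omega>) {0..<card (orb \<beta> K \<omega>)}"
      using ex_bij_betw_finite_nat bd[OF o] by blast
    then show ?thesis using bd[OF o] unfolding bij_betw_def by (intro exI[of _ f]) auto
  qed
  then obtain lam where lam: "\<And>\<omega>. \<omega> \<in> \<Omega> \<Longrightarrow> inj_on (lam \<omega>) (orb \<beta> K \<omega>)"
    "\<And>\<omega>. \<omega> \<in> \<Omega> \<Longrightarrow> lam \<omega> ` orb \<beta> K \<omega> \<subseteq> {..m}" by metis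
  have om: "\<beta> k \<omega> \<in> orb \<beta> K \<omega>" if "k \<in> K" for k \<omega> using that by (auto simp: orb_def)
  have SK: "s \<in> K" if "s \<in> S" for s using that gensD[OF S] by auto
  \<comment> \<open>The code of \<open>\<omega>\<close> consists of its own label and of the effect
    of each generator on the labels of its orbit. Labels are at most \<open>m\<close>, so
    \<open>min m\<close> and the default 0 only keep the values off the orbit and the range formally
    bounded.\<close>
  define code where "code \<omega> = (lam \<omega> \<omega>, (\<lambda>(s,i)\<in>S \<times> {..m}.
      if i \<in> lam \<omega> ` orb \<beta> K \<omega> then min m (lam \<omega> (\<beta> s (inv_into (orb \<beta> K \<omega>) (lam \<omega>) i))) else 0))" for \<omega>
  have codefin: "finite (code ` \<Omega>)"
  proof (rule finite_subset)
    show "finite ({..m} \<times> (S \<times> {..m} \<rightarrow>\<^sub>E {..m}))"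
      using gensD(1)[OF S] by (intro finite_cartesian_product finite_PiE) auto
    show "code ` \<Omega> \<subseteq> {..m} \<times> (S \<times> {..m} \<rightarrow>\<^sub>E {..m})"
    proof
      fix c assume "c \<in> code ` \<Omega>"
      then obtain \<omega> where o: "\<omega> \<in> \<Omega>" "c = code \<omega>" by auto
      have "lam \<omega> \<omega> \<le> m" using lam(2)[OF o(1)] om[OF perm_groupD(1)[OF K], of \<omega>] actsD(1)[OF a] by auto
      then show "c \<in> {..m} \<times> (S \<times> {..m} \<rightarrow>\<^sub>E {..m})" unfolding o(2) code_def by auto
    qed
  qed
  \<comment> \<open>Equal codes describe the same labelled Schreier graph with the same base point,
    so every \<open>k\<close> leads to equally labelled points.\<close>
  have code_eq: "lam \<omega> (\<beta> k \<omega>) = lam \<omega>' (\<beta> k \<omega>')"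
    if o: "\<omega> \<in> \<Omega>" "\<omega>' \<in> \<Omega>" "code \<omega> = code \<omega>'" and k: "k \<in> K" for \<omega> \<omega>' k
    using S k
  proof (induct rule: gens_induct)
    case id
    have "lam \<omega> \<omega> = lam \<omega>' \<omega>'" using o(3) by (simp add: code_def)
    then show ?case by (simp only: actsD(1)[OF a])
  next
    case (step s k)
    have *: "snd (code \<omega>) (s, lam \<omega> (\<beta> k \<omega>)) = lam \<omega> (\<beta> (s \<circ> k) \<omega>)" if o: "\<omega> \<in> \<Omega>" for \<omega>
    proof -
      have "lam \<omega> (\<beta> k \<omega>) \<in> {..m}" "lam \<omega> (\<beta> (s \<circ> k) \<omega>) \<in> {..m}"
        using lam(2)[OF o] om step(2) perm_groupD(4)[OF K] SK[OF step(1)] by blast+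
      moreover have "inv_into (orb \<beta> K \<omega>) (lam \<omega>) (lam \<omega> (\<beta> k \<omega>)) = \<beta> k \<omega>"
        using lam(1)[OF o] om[OF step(2)] by (simp add: inv_into_f_f)
      ultimately show ?thesis
        unfolding code_def using step(1,2) om actsD(2)[OF a SK[OF step(1)] step(2)] by auto
    qed
    show ?case using *[OF o(1)] *[OF o(2)] o(3) step(3) by metis
  qed (rule K)
  define pick where "pick c = (SOME \<omega>. \<omega> \<in> \<Omega> \<and> code \<omega> = c)" for c
  have pick: "pick c \<in> \<Omega> \<and> code (pick c) = c" if "c \<in> code ` \<Omega>" for c
  proof -
    have "\<exists>\<omega>. \<omega> \<in> \<Omega> \<and> code \<omega> = c" using that by auto
    then show ?thesis unfolding pick_def by (rule someI_ex)
  qed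
  \<comment> \<open>By \<open>code_eq\<close> the effect of \<open>k\<close> on all of
    \<open>\<Omega>\<close> is known from its effect on one representative for each code.\<close>
  define \<Psi> where "\<Psi> k = (\<lambda>c\<in>code ` \<Omega>. lam (pick c) (\<beta> k (pick c)))" for k
  show ?thesis
  proof (rule finite_indexI[where \<Psi> = \<Psi>])
    show "finite (\<Psi> ` K)"
    proof (rule finite_subset)
      show "finite (code ` \<Omega> \<rightarrow>\<^sub>E {..m})" using codefin by (intro finite_PiE) auto
      show "\<Psi> ` K \<subseteq> code ` \<Omega> \<rightarrow>\<^sub>E {..m}"
      proof (intro image_subsetI)
        fix k assume k: "k \<in> K"
        show "\<Psi> k \<in> code ` \<Omega> \<rightarrow>\<^sub>E {..m}"
          unfolding \<Psi>_def
        proof (rule restrict_PiE_iff[THEN iffD2], rule ballI)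
          fix c assume "c \<in> code ` \<Omega>"
          then show "lam (pick c) (\<beta> k (pick c)) \<in> {..m}" using pick lam(2) om[OF k] by blast
        qed
      qed
    qed
    fix k k' assume k: "k \<in> K" "k' \<in> K" "\<Psi> k = \<Psi> k'"
    have "\<beta> k \<omega> = \<beta> k' \<omega>" if o: "\<omega> \<in> \<Omega>" for \<omega>
    proof -
      have c: "code \<omega> \<in> code ` \<Omega>" using o by auto
      have "lam \<omega> (\<beta> k \<omega>) = \<Psi> k (code \<omega>)" "lam \<omega> (\<beta> k' \<omega>) = \<Psi> k' (code \<omega>)"
        unfolding \<Psi>_def using code_eq[OF o, of "pick (code \<omega>)"] pick[OF c] c k by auto
      then show ?thesis using k lam(1)[OF o] om unfolding inj_on_def by metis
    qed
    then have "\<beta> (finv k \<circ> k') \<omega> = \<omega>" if "\<omega> \<in> \<Omega>" for \<omega>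
      using that k(1,2) perm_groupD(3)[OF K] actsD(2)[OF a] acts_inv(2)[OF K a] by metis
    then show "finv k \<circ> k' \<in> {k \<in> K. \<forall>\<omega>\<in>\<Omega>. \<beta> k \<omega> = \<omega>}"
      using k(1,2) perm_groupD(3,4)[OF K] by blast
  qed
qed

section \<open>Permutation groups as abstract groups\<close>

lemma perm_group_fun_group:
  assumes "perm_group K"
  shows "Group.group (fun_group K)" "g \<in> K \<Longrightarrow> m_inv (fun_group K) g = finv g"
proof -
  show g: "Group.group (fun_group K)"
  proof (rule groupI)
    fix x assume "x \<in> carrier (fun_group K)"
    then show "\<exists>y\<in>carrier (fun_group K). y \<otimes>\<^bsub>fun_group K\<^esub> x = \<one>\<^bsub>fun_group K\<^esub>"
      using perm_groupD(3)[OF assms] perm_group_inv_simps(4)[OF assms]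
      by (intro bexI[of _ "finv x"]) (auto simp: fun_group_def)
  qed (use perm_groupD[OF assms] in \<open>auto simp: fun_group_def\<close>)
  show "m_inv (fun_group K) g = finv g" if "g \<in> K"
    using perm_groupD(3)[OF assms that] perm_group_inv_simps(4)[OF assms that] that
    by (intro group.inv_equality[OF g]) (auto simp: fun_group_def)
qed

lemma gens_if_finitely_generated:
  assumes K: "perm_group K" and "finitely_generated (fun_group K)"
  shows "\<exists>S. gens S K"
proof -
  obtain S where S: "finite S" "S \<subseteq> K" "generate (fun_group K) S = K"
    using assms(2) by (auto simp: finitely_generated_def fun_group_def)
  have "gens (S \<union> finv ` S) K"
  proof (rule gensI[OF K S(1,2)])
    fix P assume P: "id \<in> P" "\<And>s p. s \<in> S \<Longrightarrow> p \<in> P \<Longrightarrow> s \<circ> p \<in> P"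
      "\<And>s p. s \<in> S \<Longrightarrow> p \<in> P \<Longrightarrow> finv s \<circ> p \<in> P"
    \<comment> \<open>\<open>P\<close> is closed only under left multiplication by generators and
      their inverses. Quantifying over the right factor \<open>p\<close> makes the induction pass
      through products of two generated elements.\<close>
    have "\<forall>p\<in>P. k \<circ> p \<in> P" if "k \<in> generate (fun_group K) S" for k
      using that
    proof (induct rule: generate.induct)
      case one
      then show ?case by (simp add: fun_group_def)
    next
      case (incl h)
      then show ?case using P(2) by blast
    next
      case (inv h)
      then have "inv\<^bsub>fun_group K\<^esub> h = finv h" using perm_group_fun_group(2)[OF K] S(2) by blast
      then show ?case using P(3) inv by (simp only:) blast
    next
      case (eng h1 h2)
      have "h1 \<otimes>\<^bsub>fun_group K\<^esub> h2 = h1 \<circ> h2" by (simp add: fun_group_def)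
      then show ?case using eng by (simp only: comp_assoc) blast
    qed
    then show "K \<subseteq> P" using P(1) S(3) by fastforce
  qed
  then show ?thesis by blast
qed

section \<open>Commuting subgroups acting by homeomorphisms of bounded type\<close>

text \<open>The last clause expresses that \<open>F\<close> is connected in the Cayley graph: a
  property that holds at \<open>id\<close> and passes along edges inside \<open>F\<close> holds on
  all of \<open>F\<close>. The set is grown greedily, one edge at a time.\<close>

lemma connected_transversal:
  assumes K: "perm_group K" and S: "gens S K" and a: "acts K \<beta>"
    and large: "\<not> (finite (orb \<beta> K \<omega>) \<and> card (orb \<beta> K \<omega>) \<le> m)"
  shows "\<exists>F\<subseteq>K. finite F \<and> card F = Suc m \<and> id \<in> F \<and> inj_on (\<lambda>k. \<beta> k \<omega>) F \<and>
    (\<forall>Q. Q id \<longrightarrow> (\<forall>k\<in>F. \<forall>s\<in>S. s \<circ> k \<in> F \<longrightarrow> Q k \<longrightarrow> Q (s \<circ> k)) \<longrightarrow> (\<forall>k\<in>F. Q k))"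
proof -
  have SK: "s \<in> K" if "s \<in> S" for s using that gensD[OF S] by auto
  have "\<exists>F\<subseteq>K. finite F \<and> card F = Suc j \<and> id \<in> F \<and> inj_on (\<lambda>k. \<beta> k \<omega>) F \<and>
    (\<forall>Q. Q id \<longrightarrow> (\<forall>k\<in>F. \<forall>s\<in>S. s \<circ> k \<in> F \<longrightarrow> Q k \<longrightarrow> Q (s \<circ> k)) \<longrightarrow> (\<forall>k\<in>F. Q k))"
    if "j \<le> m" for j
    using that
  proof (induct j)
    case 0
    show ?case by (rule exI[of _ "{id}"]) (use perm_groupD(1)[OF K] in auto)
  next
    case (Suc j)
    then obtain F where F: "F \<subseteq> K" "finite F" "card F = Suc j" "id \<in> F" "inj_on (\<lambda>k. \<beta> k \<omega>) F"
      and conn: "\<And>Q. Q id \<Longrightarrow> (\<forall>k\<in>F. \<forall>s\<in>S. s \<circ> k \<in> F \<longrightarrow> Q k \<longrightarrow> Q (s \<circ> k)) \<Longrightarrow> (\<forall>k\<in>F. Q k)"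
      by (metis Suc_leD)
    \<comment> \<open>Otherwise the orbit points already met are closed under the generators and
      form the whole orbit, which then has at most \<open>Suc j\<close> points, hence at most
      \<open>m\<close>.\<close>
    have "\<exists>s\<in>S. \<exists>k\<in>F. \<beta> (s \<circ> k) \<omega> \<notin> (\<lambda>k. \<beta> k \<omega>) ` F"
    proof (rule ccontr)
      assume n: "\<not> ?thesis"
      have "\<beta> k \<omega> \<in> (\<lambda>k. \<beta> k \<omega>) ` F" if "k \<in> K" for k
        using S that
      proof (induct rule: gens_induct)
        case id
        then show ?case using F(4) by blast
      next
        case (step s k)
        then obtain f where f: "f \<in> F" "\<beta> k \<omega> = \<beta> f \<omega>" by blast
        then have "\<beta> (s \<circ> k) \<omega> = \<beta> (s \<circ> f) \<omega>"
          using actsD(2)[OF a SK[OF step(1)] step(2)] actsD(2)[OF a SK[OF step(1)], of f] F(1) by (metis subsetD)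
        then show ?case using n step(1) f(1) by metis
      qed (rule K)
      then have sub: "orb \<beta> K \<omega> \<subseteq> (\<lambda>k. \<beta> k \<omega>) ` F" unfolding orb_def by blast
      have "finite (orb \<beta> K \<omega>)" using finite_subset[OF sub] F(2) by blast
      moreover have "card (orb \<beta> K \<omega>) \<le> card F"
        using card_mono[OF _ sub] card_image_le[OF F(2), of "\<lambda>k. \<beta> k \<omega>"] F(2) by (meson finite_imageI le_trans)
      ultimately show False using large F(3) Suc(2) by simp
    qed
    then obtain s k where sk: "s \<in> S" "k \<in> F" "\<beta> (s \<circ> k) \<omega> \<notin> (\<lambda>k. \<beta> k \<omega>) ` F" by blast
    then have new: "s \<circ> k \<notin> F" by blast
    have inK: "s \<circ> k \<in> K" using SK[OF sk(1)] sk(2) F(1) perm_groupD(4)[OF K] by blast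
    show ?case
    proof (intro exI[of _ "insert (s \<circ> k) F"] conjI allI impI)
      show "insert (s \<circ> k) F \<subseteq> K" using inK F(1) by blast
      show "finite (insert (s \<circ> k) F)" using F(2) by blast
      show "card (insert (s \<circ> k) F) = Suc (Suc j)" using card_insert_disjoint[OF F(2) new] F(3) by (simp only:)
      show "id \<in> insert (s \<circ> k) F" using F(4) by blast
      show "inj_on (\<lambda>k. \<beta> k \<omega>) (insert (s \<circ> k) F)"
        unfolding inj_on_insert using F(5) sk(3) by blast
      fix Q assume Q: "Q id" "\<forall>k'\<in>insert (s \<circ> k) F. \<forall>s'\<in>S. s' \<circ> k' \<in> insert (s \<circ> k) F \<longrightarrow> Q k' \<longrightarrow> Q (s' \<circ> k')"
      then have "\<forall>k\<in>F. Q k" using conn[of Q] by blast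
      then show "\<forall>k'\<in>insert (s \<circ> k) F. Q k'" using Q(2) sk(1,2) by blast
    qed
  qed
  then show ?thesis by blast
qed

text \<open>In the intended instance, \<^term>\<open>E n x y\<close> says that the infinite paths \<^term>\<open>x\<close> and \<^term>\<open>y\<close>
  have the same tail from level \<^term>\<open>n\<close> on.\<close>
locale tame_action =
  fixes X :: "'x topology" and G :: "('b \<Rightarrow> 'b) set" and \<rho> :: "('b \<Rightarrow> 'b) \<Rightarrow> 'x \<Rightarrow> 'x"
    and E :: "nat \<Rightarrow> 'x \<Rightarrow> 'x \<Rightarrow> bool"
  assumes G: "perm_group G" and act: "acts G \<rho>"
    and cont: "g \<in> G \<Longrightarrow> continuous_map X X (\<rho> g)"
    and haus: "Hausdorff_space X"
    and E_refl: "E n x x" and E_sym: "E n x y \<Longrightarrow> E n y x"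
    and E_trans: "E n x y \<Longrightarrow> E n y z \<Longrightarrow> E n x z"
    and E_mono: "E n x y \<Longrightarrow> n \<le> n' \<Longrightarrow> E n' x y"
    and E_fin: "\<exists>m. \<forall>x\<in>topspace X. finite {p\<in>topspace X. E n x p} \<and> card {p\<in>topspace X. E n x p} \<le> m"
    and sing: "g \<in> G \<Longrightarrow>
      finite {x\<in>topspace X. \<not> (\<exists>n U. openin X U \<and> x \<in> U \<and> (\<forall>z\<in>U. E n z (\<rho> g z)))}"
    and bdd: "g \<in> G \<Longrightarrow>
      \<exists>M. \<forall>n. \<forall>x\<in>topspace X. card {p\<in>topspace X. E n x p \<and> \<not> E n x (\<rho> g p)} \<le> M"
    and iso: "K \<subseteq> G \<Longrightarrow> perm_group K \<Longrightarrow> gens S K \<Longrightarrow> x \<in> topspace X \<Longrightarrow> (\<And>k. k \<in> K \<Longrightarrow> \<rho> k x = x) \<Longrightarrow>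
      finite_index {k\<in>K. \<exists>U. openin X U \<and> x \<in> U \<and> (\<forall>z\<in>U. \<rho> k z = z)} K"
begin

section \<open>Elements that keep tails near a point\<close>

lemma in_space: "g \<in> G \<Longrightarrow> x \<in> topspace X \<Longrightarrow> \<rho> g x \<in> topspace X"
  using cont by (auto simp: continuous_map_def)

lemma open_preimage: "g \<in> G \<Longrightarrow> openin X U \<Longrightarrow> openin X {z\<in>topspace X. \<rho> g z \<in> U}"
  using cont by (auto simp: continuous_map_def)

text \<open>The finite set in \<open>sing\<close> consists of the points where this fails. On the
  path space of a Bratteli diagram it holds wherever \<open>g\<close> has no singularity.\<close>

definition loc :: "('b \<Rightarrow> 'b) \<Rightarrow> 'x \<Rightarrow> bool" where
  "loc g x \<longleftrightarrow> (\<exists>n U. openin X U \<and> x \<in> U \<and> (\<forall>z\<in>U. E n z (\<rho> g z)))"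

lemma loc_id: "x \<in> topspace X \<Longrightarrow> loc id x"
  unfolding loc_def using openin_topspace E_refl actsD(1)[OF act] by metis

lemma loc_comp:
  assumes "g \<in> G" "h \<in> G" "loc g x" "loc h (\<rho> g x)"
  shows "loc (h \<circ> g) x"
proof -
  obtain n U where U: "openin X U" "x \<in> U" "\<And>z. z \<in> U \<Longrightarrow> E n z (\<rho> g z)"
    using assms(3) unfolding loc_def by blast
  obtain n' U' where U': "openin X U'" "\<rho> g x \<in> U'" "\<And>z. z \<in> U' \<Longrightarrow> E n' z (\<rho> h z)"
    using assms(4) unfolding loc_def by blast
  let ?V = "U \<inter> {z\<in>topspace X. \<rho> g z \<in> U'}"
  have "openin X ?V" using U(1) open_preimage[OF assms(1) U'(1)] by blast
  moreover have "x \<in> ?V" using U(2) U'(2) openin_subset[OF U(1)] by auto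
  moreover have "E (max n n') z (\<rho> (h \<circ> g) z)" if "z \<in> ?V" for z
  proof -
    have "E (max n n') z (\<rho> g z)" using E_mono[OF U(3)] that by simp
    moreover have "E (max n n') (\<rho> g z) (\<rho> h (\<rho> g z))" using E_mono[OF U'(3)] that by simp
    ultimately show ?thesis using E_trans actsD(2)[OF act assms(2,1)] by metis
  qed
  ultimately show ?thesis unfolding loc_def by blast
qed

lemma loc_inv:
  assumes "g \<in> G" "x \<in> topspace X" "loc g x"
  shows "loc (finv g) (\<rho> g x)"
proof -
  obtain n U where U: "openin X U" "x \<in> U" "\<And>z. z \<in> U \<Longrightarrow> E n z (\<rho> g z)"
    using assms(3) unfolding loc_def by blast
  have gi: "finv g \<in> G" using perm_groupD(3)[OF G assms(1)] .
  let ?V = "{z\<in>topspace X. \<rho> (finv g) z \<in> U}"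
  have "openin X ?V" using open_preimage[OF gi U(1)] .
  moreover have "\<rho> g x \<in> ?V"
    using U(2) in_space[OF assms(1,2)] acts_inv(2)[OF G act assms(1)] by (metis (mono_tags, lifting) mem_Collect_eq)
  moreover have "E n z (\<rho> (finv g) z)" if "z \<in> ?V" for z
    using U(3)[of "\<rho> (finv g) z"] that acts_inv(1)[OF G act assms(1), of z] E_sym by auto
  ultimately show ?thesis unfolding loc_def by blast
qed

text \<open>Call \<open>C p\<close> the set of points reached from \<open>p\<close> by elements that
  are local at \<open>p\<close>. If all these classes were finite, each would contain a point of the
  finite set \<open>\<Sigma>\<close> of singularities of generators, and the orbit would be covered
  by finitely many finite classes.\<close>

lemma infinite_local_class:
  assumes L: "L \<subseteq> G" "perm_group L" and S: "gens S L" and y: "y \<in> topspace X"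
    and inf: "infinite (orb \<rho> L y)"
  shows "\<exists>y'\<in>orb \<rho> L y. infinite ((\<lambda>l. \<rho> l y') ` {l\<in>L. loc l y'})"
proof (rule ccontr)
  assume n: "\<not> ?thesis"
  define C where "C p = (\<lambda>l. \<rho> l p) ` {l\<in>L. loc l p}" for p
  have fin: "finite (C p)" if "p \<in> orb \<rho> L y" for p
    unfolding C_def using n that by blast
  have SG: "s \<in> L" "s \<in> G" if "s \<in> S" for s using that gensD[OF S] L by auto
  define \<Sigma> where "\<Sigma> = (\<Union>s\<in>S. {x\<in>topspace X. \<not> loc s x})"
  have "finite \<Sigma>"
    unfolding \<Sigma>_def loc_def using gensD(1)[OF S] sing SG by blast
  have top: "p \<in> topspace X" if "p \<in> orb \<rho> L y" for p
    using that in_space y L(1) unfolding orb_def by blast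
  have orbc: "\<rho> l p \<in> orb \<rho> L y" if p: "p \<in> orb \<rho> L y" and l: "l \<in> L" for p l
  proof -
    obtain k where "k \<in> L" "p = \<rho> k y" using p by (auto simp: orb_def)
    moreover from this have "\<rho> l p = \<rho> (l \<circ> k) y" "l \<circ> k \<in> L"
      using actsD(2)[OF acts_mono[OF act L(1)], of l k] l perm_groupD(4)[OF L(2) l] by simp_all
    ultimately show ?thesis unfolding orb_def by blast
  qed
  \<comment> \<open>A class avoiding \<open>\<Sigma>\<close> is closed under all generators, because
    each of them is local at each of its points; it is then the whole infinite orbit.\<close>
  have meets: "\<exists>x\<in>\<Sigma>. x \<in> C p" if p: "p \<in> orb \<rho> L y" for p
  proof (rule ccontr)
    assume n: "\<not> ?thesis"
    have "loc l p" if "l \<in> L" for l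
      using S that
    proof (induct rule: gens_induct)
      case id
      then show ?case using loc_id top p by blast
    next
      case (step s l)
      have "\<rho> l p \<in> C p" using step unfolding C_def by blast
      then have "\<rho> l p \<notin> \<Sigma>" using n by blast
      then have "loc s (\<rho> l p)" using top[OF orbc[OF p step(2)]] step(1) unfolding \<Sigma>_def by blast
      then show ?case using loc_comp step SG L(1) by blast
    qed (rule L(2))
    then have eq: "C p = orb \<rho> L p" unfolding C_def orb_def by blast
    obtain k where k: "k \<in> L" "p = \<rho> k y" using p by (auto simp: orb_def)
    have "orb \<rho> L y \<subseteq> orb \<rho> L p"
    proof
      fix q assume "q \<in> orb \<rho> L y"
      then obtain l where l: "l \<in> L" "q = \<rho> l y" by (auto simp: orb_def)
      have "y = \<rho> (finv k) p" using k acts_inv(2)[OF G act] L(1) by auto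
      then have "q = \<rho> (l \<circ> finv k) p"
        using l actsD(2)[OF act] perm_groupD(3)[OF L(2) k(1)] L(1) by (metis subsetD)
      then show "q \<in> orb \<rho> L p"
        using l(1) perm_groupD(3,4)[OF L(2)] k(1) unfolding orb_def by blast
    qed
    then show False using fin[OF p] inf eq by (metis finite_subset)
  qed
  \<comment> \<open>The relation is symmetric by \<open>loc_inv\<close>, so \<open>p\<close> lies in
    the class of the point of \<open>\<Sigma>\<close> that its own class contains.\<close>
  have "orb \<rho> L y \<subseteq> (\<Union>x\<in>\<Sigma> \<inter> orb \<rho> L y. C x)"
  proof
    fix p assume p: "p \<in> orb \<rho> L y"
    obtain l where l: "l \<in> L" "loc l p" "\<rho> l p \<in> \<Sigma>" using meets[OF p] unfolding C_def by blast
    have "loc (finv l) (\<rho> l p)" using loc_inv l L(1) top[OF p] by blast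
    moreover have "\<rho> (finv l) (\<rho> l p) = p" using acts_inv(2)[OF G act] l L(1) by blast
    ultimately have "p \<in> C (\<rho> l p)" unfolding C_def using perm_groupD(3)[OF L(2) l(1)]
      by (metis (mono_tags, lifting) imageI mem_Collect_eq)
    then show "p \<in> (\<Union>x\<in>\<Sigma> \<inter> orb \<rho> L y. C x)" using l(3) orbc[OF p l(1)] by blast
  qed
  moreover have "finite (\<Union>x\<in>\<Sigma> \<inter> orb \<rho> L y. C x)"
    using \<open>finite \<Sigma>\<close> fin by blast
  ultimately show False using inf finite_subset by blast
qed

lemma orb_eq:
  assumes "L \<subseteq> G" "perm_group L" "l \<in> L"
  shows "orb \<rho> L (\<rho> l z) = orb \<rho> L z"
proof -
  have lG: "l \<in> G" "finv l \<in> G" using assms(1,3) perm_groupD(3)[OF assms(2,3)] by auto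
  have "\<rho> k (\<rho> l z) = \<rho> (k \<circ> l) z" if "k \<in> L" for k
    using actsD(2)[OF act _ lG(1)] that assms(1) by (metis subsetD)
  moreover have "\<rho> k z = \<rho> (k \<circ> finv l) (\<rho> l z)" if "k \<in> L" for k
    using actsD(2)[OF act _ lG(2)] acts_inv(2)[OF G act lG(1)] that assms(1) by (metis subsetD)
  moreover have "k \<circ> l \<in> L" "k \<circ> finv l \<in> L" if "k \<in> L" for k
    using that assms perm_groupD(3,4)[OF assms(2)] by blast+
  ultimately show ?thesis unfolding orb_def by (safe; metis (no_types) imageI)
qed

lemma orb_self: "perm_group L \<Longrightarrow> z \<in> orb \<rho> L z"
  unfolding orb_def using perm_groupD(1) actsD(1)[OF act] by (metis imageI)

lemma orb_commute:
  assumes "L \<subseteq> G" "k \<in> G" "\<And>l. l \<in> L \<Longrightarrow> k \<circ> l = l \<circ> k"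
  shows "\<rho> k ` orb \<rho> L z = orb \<rho> L (\<rho> k z)"
proof -
  have "\<rho> k (\<rho> l z) = \<rho> l (\<rho> k z)" if "l \<in> L" for l
    using actsD(2)[OF act] assms(1,2) assms(3)[OF that] that by (metis subsetD)
  then show ?thesis unfolding orb_def image_image by (intro image_cong) auto
qed

text \<open>If \<^term>\<open>K\<close> permutes many of the \<^term>\<open>L\<close>-orbits near \<^term>\<open>y\<close>, the orbits of
  \<^term>\<open>K \<times> L\<close> contain large grids. Consider the \<^term>\<open>E n\<close>-class of a grid point for a fixed large
  \<^term>\<open>n\<close>. It is small compared with the rows of the grid, so every row that meets it also leaves
  it along a generator of \<^term>\<open>K\<close>. By \<open>infinite_local_class\<close> it meets arbitrarily many rows,
  whereas \<open>bdd\<close> bounds the number of exits independently of \<^term>\<open>n\<close>.\<close>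
lemma bounded_orbits_on_quotient:
  assumes K: "K \<subseteq> G" "perm_group K" "gens S K"
    and L: "L \<subseteq> G" "perm_group L" "gens S' L"
    and comm: "\<And>k l. k \<in> K \<Longrightarrow> l \<in> L \<Longrightarrow> k \<circ> l = l \<circ> k"
    and y: "y \<in> topspace X" and inf: "infinite (orb \<rho> L y)"
  shows "\<exists>U m. openin X U \<and> y \<in> U \<and>
    (\<forall>z\<in>U. finite (orb (\<lambda>k W. \<rho> k ` W) K (orb \<rho> L z)) \<and> card (orb (\<lambda>k W. \<rho> k ` W) K (orb \<rho> L z)) \<le> m)"
proof -
  have SK: "s \<in> K" "s \<in> G" if "s \<in> S" for s using that gensD[OF K(3)] K(1) by auto
  obtain l0 where l0: "l0 \<in> L" "infinite ((\<lambda>l. \<rho> l (\<rho> l0 y)) ` {l\<in>L. loc l (\<rho> l0 y)})"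
    using infinite_local_class[OF L y inf] by (auto simp: orb_def)
  define y' where "y' = \<rho> l0 y"
  have y': "y' \<in> topspace X" unfolding y'_def using in_space l0(1) L(1) y by blast
  have "\<forall>s\<in>S. \<exists>M. \<forall>n. \<forall>x\<in>topspace X. card {p\<in>topspace X. E n x p \<and> \<not> E n x (\<rho> s p)} \<le> M"
    using bdd SK by blast
  then obtain M where M: "\<And>s n x. s \<in> S \<Longrightarrow> x \<in> topspace X \<Longrightarrow>
      card {p\<in>topspace X. E n x p \<and> \<not> E n x (\<rho> s p)} \<le> M s"
    by metis
  \<comment> \<open>\<open>D\<close> bounds the exits from a tail class along all generators
    together, whatever the level. One row more than that is taken, and only afterwards is the level
    \<open>n\<close> chosen.\<close>
  define D where "D = (\<Sum>s\<in>S. M s)"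
  obtain W where W: "W \<subseteq> (\<lambda>l. \<rho> l y') ` {l\<in>L. loc l y'}" "finite W" "card W = Suc D"
    using infinite_arbitrarily_large[OF l0(2)[folded y'_def]] by blast
  then obtain \<Lambda> where La: "\<Lambda> \<subseteq> {l\<in>L. loc l y'}" "inj_on (\<lambda>l. \<rho> l y') \<Lambda>" "W = (\<lambda>l. \<rho> l y') ` \<Lambda>"
    by (meson subset_image_inj)
  have cardL: "card \<Lambda> = Suc D" using W(3) La(2,3) card_image by metis
  then have finL: "finite \<Lambda>" using card.infinite by fastforce
  have "\<forall>l\<in>\<Lambda>. \<exists>n U. openin X U \<and> y' \<in> U \<and> (\<forall>z\<in>U. E n z (\<rho> l z))"
    using La(1) unfolding loc_def by blast
  then obtain nn UU where UU: "\<And>l. l \<in> \<Lambda> \<Longrightarrow> openin X (UU l)" "\<And>l. l \<in> \<Lambda> \<Longrightarrow> y' \<in> UU l"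
    "\<And>l z. l \<in> \<Lambda> \<Longrightarrow> z \<in> UU l \<Longrightarrow> E (nn l) z (\<rho> l z)" by metis
  \<comment> \<open>The sum serves as a common upper bound: above it all elements of
    \<open>\<Lambda>\<close> preserve tails near \<open>y'\<close>.\<close>
  define n where "n = (\<Sum>l\<in>\<Lambda>. nn l)"
  have nn: "nn l \<le> n" if "l \<in> \<Lambda>" for l unfolding n_def using finL that by (intro member_le_sum) auto
  \<comment> \<open>Hausdorff separation keeps the rows apart not only at \<open>y'\<close> but at
    all points near it.\<close>
  have "\<exists>V. openin X V \<and> y' \<in> V \<and> (\<forall>z\<in>V. \<rho> l z \<noteq> \<rho> l' z)" if l: "l \<in> \<Lambda>" "l' \<in> \<Lambda>" "l \<noteq> l'" for l l'
  proof -
    have lG: "l \<in> G" "l' \<in> G" using l La(1) L(1) by auto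
    have "\<rho> l y' \<noteq> \<rho> l' y'" using La(2) l unfolding inj_on_def by blast
    then obtain A B where AB: "openin X A" "openin X B" "\<rho> l y' \<in> A" "\<rho> l' y' \<in> B" "disjnt A B"
      using haus in_space[OF lG(1) y'] in_space[OF lG(2) y'] unfolding Hausdorff_space_def by metis
    have "openin X ({z\<in>topspace X. \<rho> l z \<in> A} \<inter> {z\<in>topspace X. \<rho> l' z \<in> B})"
      using open_preimage lG AB by blast
    moreover have "\<forall>z\<in>{z\<in>topspace X. \<rho> l z \<in> A} \<inter> {z\<in>topspace X. \<rho> l' z \<in> B}. \<rho> l z \<noteq> \<rho> l' z"
      using AB(5) unfolding disjnt_def by fastforce
    ultimately show ?thesis using AB(3,4) y' by blast
  qed
  then have "\<forall>l l'. \<exists>V. l \<in> \<Lambda> \<longrightarrow> l' \<in> \<Lambda> \<longrightarrow> l \<noteq> l' \<longrightarrow>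
      openin X V \<and> y' \<in> V \<and> (\<forall>z\<in>V. \<rho> l z \<noteq> \<rho> l' z)" by blast
  then obtain VV where "\<forall>l l'. l \<in> \<Lambda> \<longrightarrow> l' \<in> \<Lambda> \<longrightarrow> l \<noteq> l' \<longrightarrow>
      openin X (VV l l') \<and> y' \<in> VV l l' \<and> (\<forall>z\<in>VV l l'. \<rho> l z \<noteq> \<rho> l' z)"
    unfolding choice_iff by blast
  then have VV: "\<And>l l'. l \<in> \<Lambda> \<Longrightarrow> l' \<in> \<Lambda> \<Longrightarrow> l \<noteq> l' \<Longrightarrow> openin X (VV l l')"
    "\<And>l l'. l \<in> \<Lambda> \<Longrightarrow> l' \<in> \<Lambda> \<Longrightarrow> l \<noteq> l' \<Longrightarrow> y' \<in> VV l l'"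
    "\<And>l l' z. l \<in> \<Lambda> \<Longrightarrow> l' \<in> \<Lambda> \<Longrightarrow> l \<noteq> l' \<Longrightarrow> z \<in> VV l l' \<Longrightarrow> \<rho> l z \<noteq> \<rho> l' z"
    by blast+
  define U where "U = topspace X \<inter> \<Inter> (UU ` \<Lambda> \<union> (\<lambda>(l,l'). VV l l') ` {(l,l')\<in>\<Lambda> \<times> \<Lambda>. l \<noteq> l'})"
  have "openin X U"
    unfolding U_def
  proof (rule openin_Int_Inter)
    show "finite (UU ` \<Lambda> \<union> (\<lambda>(l,l'). VV l l') ` {(l,l')\<in>\<Lambda> \<times> \<Lambda>. l \<noteq> l'})"
      using finL by (intro finite_UnI finite_imageI finite_subset[OF _ finite_cartesian_product[OF finL finL]]) auto
  qed (use UU(1) VV(1) in auto)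
  have "y' \<in> U" unfolding U_def using UU(2) VV(2) y' by auto
  have Uloc: "E n z (\<rho> l z)" if "z \<in> U" "l \<in> \<Lambda>" for z l
  proof -
    have "z \<in> UU l" using that unfolding U_def by blast
    then show ?thesis using E_mono[OF UU(3)[OF that(2)] nn[OF that(2)]] by blast
  qed
  have Uinj: "\<rho> l z \<noteq> \<rho> l' z" if "z \<in> U" "l \<in> \<Lambda>" "l' \<in> \<Lambda>" "l \<noteq> l'" for z l l'
  proof -
    have "z \<in> VV l l'" using that unfolding U_def by blast
    then show ?thesis using VV(3) that by blast
  qed
  obtain m where m: "\<And>x. x \<in> topspace X \<Longrightarrow> finite {p\<in>topspace X. E n x p} \<and> card {p\<in>topspace X. E n x p} \<le> m"
    using E_fin[of n] by blast
  let ?\<beta> = "\<lambda>k W. \<rho> k ` W"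
  have aK: "acts K ?\<beta>" using acts_image[OF acts_mono[OF act K(1)]] .
  have bound: "finite (orb ?\<beta> K (orb \<rho> L z)) \<and> card (orb ?\<beta> K (orb \<rho> L z)) \<le> m" if z: "z \<in> U" for z
  proof (rule ccontr)
    assume n: "\<not> ?thesis"
    have zX: "z \<in> topspace X" using z unfolding U_def by blast
    obtain F where F: "F \<subseteq> K" "finite F" "card F = Suc m" "id \<in> F" "inj_on (\<lambda>k. \<rho> k ` orb \<rho> L z) F"
      and conn: "\<And>Q. Q id \<Longrightarrow> (\<forall>k\<in>F. \<forall>s\<in>S. s \<circ> k \<in> F \<longrightarrow> Q k \<longrightarrow> Q (s \<circ> k)) \<Longrightarrow> (\<forall>k\<in>F. Q k)"
      using connected_transversal[OF K(2,3) aK n] by metis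
    have orbk: "orb \<rho> L (\<rho> k (\<rho> l z)) = \<rho> k ` orb \<rho> L z" if "k \<in> F" "l \<in> \<Lambda>" for k l
    proof -
      have "k \<in> G" "k \<in> K" "l \<in> L" using that F(1) K(1) La(1) by auto
      then show ?thesis
        using orb_commute[OF L(1), of k "\<rho> l z"] orb_eq[OF L(1,2), of l z] comm[of k] by simp
    qed
    define Cl where "Cl = {p\<in>topspace X. E n z p}"
    have pX: "\<rho> k (\<rho> l z) \<in> topspace X" if "k \<in> F" "l \<in> \<Lambda>" for k l
    proof -
      have "k \<in> G" "l \<in> G" using that F(1) K(1) La(1) L(1) by auto
      then show ?thesis using in_space zX by simp
    qed
    \<comment> \<open>Row \<open>l\<close> starts inside the class, since \<open>l\<close> preserves
      tails at \<open>z\<close>, and has \<open>Suc m\<close> different points, while the class has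
      at most \<open>m\<close>. By connectedness of \<open>F\<close> some edge leads out of
      it.\<close>
    have exits: "\<exists>k\<in>F. \<exists>s\<in>S. \<rho> k (\<rho> l z) \<in> Cl \<and> \<rho> s (\<rho> k (\<rho> l z)) \<notin> Cl" if l: "l \<in> \<Lambda>" for l
    proof (rule ccontr)
      assume ne: "\<not> ?thesis"
      have "\<forall>k\<in>F. \<rho> k (\<rho> l z) \<in> Cl"
      proof (rule conn)
        show "\<rho> id (\<rho> l z) \<in> Cl"
          using Uloc[OF z l] pX[OF F(4) l] actsD(1)[OF act] unfolding Cl_def by auto
        show "\<forall>k\<in>F. \<forall>s\<in>S. s \<circ> k \<in> F \<longrightarrow> \<rho> k (\<rho> l z) \<in> Cl \<longrightarrow> \<rho> (s \<circ> k) (\<rho> l z) \<in> Cl"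
        proof (intro ballI impI)
          fix k s assume ks: "k \<in> F" "s \<in> S" "\<rho> k (\<rho> l z) \<in> Cl"
          then have "\<rho> s (\<rho> k (\<rho> l z)) \<in> Cl" using ne by blast
          moreover have "\<rho> (s \<circ> k) (\<rho> l z) = \<rho> s (\<rho> k (\<rho> l z))"
            using actsD(2)[OF act] SK(2) ks(1,2) F(1) K(1) by blast
          ultimately show "\<rho> (s \<circ> k) (\<rho> l z) \<in> Cl" by metis
        qed
      qed
      then have sub: "(\<lambda>k. \<rho> k (\<rho> l z)) ` F \<subseteq> Cl" by blast
      have "inj_on (\<lambda>k. \<rho> k (\<rho> l z)) F"
        using F(5) orbk l unfolding inj_on_def by metis
      then have "Suc m \<le> card Cl"
        using card_mono[OF _ sub] m[OF zX] F(3) card_image unfolding Cl_def by metis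
      then show False using m[OF zX] unfolding Cl_def by simp
    qed
    then obtain kk ss where ks: "\<And>l. l \<in> \<Lambda> \<Longrightarrow> kk l \<in> F" "\<And>l. l \<in> \<Lambda> \<Longrightarrow> ss l \<in> S"
      "\<And>l. l \<in> \<Lambda> \<Longrightarrow> \<rho> (kk l) (\<rho> l z) \<in> Cl" "\<And>l. l \<in> \<Lambda> \<Longrightarrow> \<rho> (ss l) (\<rho> (kk l) (\<rho> l z)) \<notin> Cl"
      by metis
    define Bad where "Bad s = {p\<in>topspace X. E n z p \<and> \<not> E n z (\<rho> s p)}" for s
    \<comment> \<open>An exit point determines its row: its \<open>L\<close>-orbit determines
      \<open>kk l\<close>, as elements of \<open>F\<close> give different orbits, and then
      \<open>Uinj\<close> determines \<open>l\<close>.\<close>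
    have "inj_on (\<lambda>l. (ss l, \<rho> (kk l) (\<rho> l z))) \<Lambda>"
    proof (rule inj_onI)
      fix l l' assume l: "l \<in> \<Lambda>" "l' \<in> \<Lambda>" "(ss l, \<rho> (kk l) (\<rho> l z)) = (ss l', \<rho> (kk l') (\<rho> l' z))"
      then have eq: "\<rho> (kk l) (\<rho> l z) = \<rho> (kk l') (\<rho> l' z)" by simp
      then have "\<rho> (kk l) ` orb \<rho> L z = \<rho> (kk l') ` orb \<rho> L z" using orbk ks(1) l by metis
      then have "kk l = kk l'" using F(5) ks(1) l unfolding inj_on_def by metis
      then have "\<rho> l z = \<rho> l' z" using eq acts_eq_iff[OF G act] ks(1)[OF l(2)] F(1) K(1) by auto
      then show "l = l'" using Uinj[OF z] l by blast
    qed
    moreover have "(\<lambda>l. (ss l, \<rho> (kk l) (\<rho> l z))) ` \<Lambda> \<subseteq> Sigma S Bad"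
    proof (rule image_subsetI)
      fix l assume l: "l \<in> \<Lambda>"
      have "\<rho> (ss l) (\<rho> (kk l) (\<rho> l z)) \<in> topspace X"
        using in_space[OF SK(2)[OF ks(2)[OF l]] pX[OF ks(1)[OF l] l]] .
      then show "(ss l, \<rho> (kk l) (\<rho> l z)) \<in> Sigma S Bad"
        using ks[OF l] unfolding Bad_def Cl_def by blast
    qed
    moreover have finBad: "finite (Bad s)" for s
      using m[OF zX] unfolding Bad_def by (auto intro: finite_subset[of _ "{p\<in>topspace X. E n z p}"])
    ultimately have "card \<Lambda> \<le> card (Sigma S Bad)"
      using gensD(1)[OF K(3)] by (intro card_inj_on_le) auto
    also have "\<dots> = (\<Sum>s\<in>S. card (Bad s))"
      using finBad gensD(1)[OF K(3)] by (intro card_SigmaI) auto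
    also have "\<dots> \<le> D" unfolding D_def Bad_def using M[OF _ zX] by (intro sum_mono) auto
    finally show False using cardL by simp
  qed
  \<comment> \<open>Moving back from \<open>y'\<close> to \<open>y\<close> costs nothing, because
    \<open>z\<close> and \<open>\<rho> l0 z\<close> have the same \<open>L\<close>-orbit.\<close>
  let ?U = "{z\<in>topspace X. \<rho> l0 z \<in> U}"
  have "openin X ?U" using open_preimage l0(1) L(1) \<open>openin X U\<close> by blast
  moreover have "y \<in> ?U" using \<open>y' \<in> U\<close> y unfolding y'_def by blast
  moreover have "finite (orb ?\<beta> K (orb \<rho> L z)) \<and> card (orb ?\<beta> K (orb \<rho> L z)) \<le> m" if "z \<in> ?U" for z
    using bound[of "\<rho> l0 z"] that orb_eq[OF L(1,2) l0(1), of z] by auto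
  ultimately show ?thesis by blast
qed

text \<open>The stabilizer of \<open>y\<close> is finitely generated by Schreier, so
  \<open>iso\<close> applies to it and \<open>K\<close> has only finitely many germs at
  \<open>y\<close>. The elements with trivial germ are again finitely generated, hence trivial on
  one common neighbourhood, and \<open>B\<close> is a normal subgroup of finite index among
  them.\<close>

lemma finite_index_germ_kernel:
  assumes K: "K \<subseteq> G" "perm_group K" "gens S K" and y: "y \<in> topspace X" and fin: "finite (orb \<rho> K y)"
  shows "\<exists>B U. openin X U \<and> y \<in> U \<and> B \<subseteq> K \<and> perm_group B \<and> finite_index B K \<and>
     (\<forall>k\<in>K. \<forall>b\<in>B. k \<circ> b \<circ> finv k \<in> B) \<and> (\<forall>b\<in>B. \<forall>z\<in>U. \<rho> b z = z)"
proof -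
  have aK: "acts K \<rho>" using acts_mono[OF act K(1)] .
  define Ky where "Ky = {k\<in>K. \<rho> k y = y}"
  have Ky: "perm_group Ky" unfolding Ky_def using perm_group_stab1[OF K(2) aK] .
  obtain S1 where S1: "gens S1 Ky" using schreier_gens_stab[OF K(2,3) aK fin] unfolding Ky_def by blast
  have fiKy: "finite_index Ky K" unfolding Ky_def using finite_index_stab[OF K(2) aK fin] .
  \<comment> \<open>A germ is encoded as the set of maps that agree with \<open>f\<close> near
    \<open>y\<close>, so that \<open>K\<close> acts by composition on the left even when it moves
    \<open>y\<close>.\<close>
  define germ where "germ f = {h. \<exists>U. openin X U \<and> y \<in> U \<and> (\<forall>z\<in>U. h z = f z)}" for f :: "'x \<Rightarrow> 'x"
  let ?\<beta> = "\<lambda>k W. (\<lambda>h :: 'x \<Rightarrow> 'x. \<rho> k \<circ> h) ` W"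
  have ab: "acts K ?\<beta>"
  proof -
    have "(\<lambda>h. \<rho> id \<circ> h) = (\<lambda>h :: 'x \<Rightarrow> 'x. h)" using actsD(1)[OF act] by (intro ext) simp
    moreover have "(\<lambda>h. \<rho> (g \<circ> g') \<circ> h) = (\<lambda>h :: 'x \<Rightarrow> 'x. \<rho> g \<circ> (\<rho> g' \<circ> h))" if "g \<in> K" "g' \<in> K" for g g'
      using actsD(2)[OF aK that] by (intro ext) (simp only: comp_apply)
    ultimately show ?thesis unfolding acts_def image_image by (intro conjI allI ballI) (simp_all only: image_ident)
  qed
  have germ_eq: "?\<beta> k (germ (id :: 'x \<Rightarrow> 'x)) = germ (\<rho> k)" if k: "k \<in> K" for k
  proof -
    have kG: "k \<in> G" using k K(1) by blast
    show ?thesis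
    proof (intro equalityI subsetI)
      fix h assume "h \<in> ?\<beta> k (germ id)"
      then show "h \<in> germ (\<rho> k)" unfolding germ_def by auto
    next
      fix h assume "h \<in> germ (\<rho> k)"
      then have "\<rho> (finv k) \<circ> h \<in> germ id"
        unfolding germ_def using acts_inv(2)[OF G act kG] by (auto; metis)
      moreover have "h = \<rho> k \<circ> (\<rho> (finv k) \<circ> h)"
        using acts_inv(1)[OF G act kG] by (auto simp: fun_eq_iff)
      ultimately show "h \<in> ?\<beta> k (germ id)" by blast
    qed
  qed
  have germ_iff: "germ (\<rho> k) = germ (\<rho> k') \<longleftrightarrow> (\<exists>U. openin X U \<and> y \<in> U \<and> (\<forall>z\<in>U. \<rho> k z = \<rho> k' z))" for k k'
  proof
    assume "germ (\<rho> k) = germ (\<rho> k')"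
    moreover have "\<rho> k \<in> germ (\<rho> k)" unfolding germ_def using y openin_topspace by blast
    ultimately show "\<exists>U. openin X U \<and> y \<in> U \<and> (\<forall>z\<in>U. \<rho> k z = \<rho> k' z)" unfolding germ_def by auto
  next
    assume "\<exists>U. openin X U \<and> y \<in> U \<and> (\<forall>z\<in>U. \<rho> k z = \<rho> k' z)"
    then obtain U where U: "openin X U" "y \<in> U" "\<And>z. z \<in> U \<Longrightarrow> \<rho> k z = \<rho> k' z" by blast
    have "(\<exists>V. openin X V \<and> y \<in> V \<and> (\<forall>z\<in>V. h z = \<rho> k z)) \<longleftrightarrow> (\<exists>V. openin X V \<and> y \<in> V \<and> (\<forall>z\<in>V. h z = \<rho> k' z))" for h
    proof
      assume "\<exists>V. openin X V \<and> y \<in> V \<and> (\<forall>z\<in>V. h z = \<rho> k z)"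
      then obtain V where "openin X V" "y \<in> V" "\<forall>z\<in>V. h z = \<rho> k z" by blast
      then show "\<exists>V. openin X V \<and> y \<in> V \<and> (\<forall>z\<in>V. h z = \<rho> k' z)"
        using U by (intro exI[of _ "U \<inter> V"]) auto
    next
      assume "\<exists>V. openin X V \<and> y \<in> V \<and> (\<forall>z\<in>V. h z = \<rho> k' z)"
      then obtain V where "openin X V" "y \<in> V" "\<forall>z\<in>V. h z = \<rho> k' z" by blast
      then show "\<exists>V. openin X V \<and> y \<in> V \<and> (\<forall>z\<in>V. h z = \<rho> k z)"
        using U by (intro exI[of _ "U \<inter> V"]) auto
    qed
    then show "germ (\<rho> k) = germ (\<rho> k')" unfolding germ_def by blast
  qed
  define K0 where "K0 = {k\<in>Ky. \<exists>U. openin X U \<and> y \<in> U \<and> (\<forall>z\<in>U. \<rho> k z = z)}"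
  have fiK0: "finite_index K0 Ky"
    unfolding K0_def by (rule iso[OF _ Ky S1 y]) (use K(1) in \<open>auto simp: Ky_def\<close>)
  define R where "R = {k\<in>K. ?\<beta> k (germ id) = germ id}"
  have rid: "\<rho> id = id" using actsD(1)[OF act] by (auto simp: fun_eq_iff)
  have R_iff: "k \<in> R \<longleftrightarrow> k \<in> K \<and> (\<exists>U. openin X U \<and> y \<in> U \<and> (\<forall>z\<in>U. \<rho> k z = z))" for k
    using germ_eq[of k] germ_iff[of k id] unfolding R_def rid by auto
  obtain F1 where F1: "finite F1" "F1 \<subseteq> K" "\<And>k. k \<in> K \<Longrightarrow> \<exists>f\<in>F1. finv f \<circ> k \<in> Ky"
    using fiKy unfolding finite_index_def by blast
  obtain F2 where F2: "finite F2" "F2 \<subseteq> Ky" "\<And>k. k \<in> Ky \<Longrightarrow> \<exists>f\<in>F2. finv f \<circ> k \<in> K0"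
    using fiK0 unfolding finite_index_def by blast
  \<comment> \<open>Index in two stages: \<open>f1\<close> runs through cosets of the stabilizer,
    \<open>f2\<close> through cosets of the elements with trivial germ in it.\<close>
  have sub: "orb ?\<beta> K (germ id) \<subseteq> (\<lambda>(f1,f2). germ (\<rho> (f1 \<circ> f2))) ` (F1 \<times> F2)"
  proof
    fix W assume "W \<in> orb ?\<beta> K (germ id)"
    then obtain k where k: "k \<in> K" "W = germ (\<rho> k)" using germ_eq by (auto simp: orb_def)
    obtain f1 where f1: "f1 \<in> F1" "finv f1 \<circ> k \<in> Ky" using F1(3)[OF k(1)] by blast
    obtain f2 where f2: "f2 \<in> F2" "finv f2 \<circ> (finv f1 \<circ> k) \<in> K0" using F2(3)[OF f1(2)] by blast
    obtain U where U: "openin X U" "y \<in> U" "\<And>z. z \<in> U \<Longrightarrow> \<rho> (finv f2 \<circ> (finv f1 \<circ> k)) z = z"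
      using f2(2) unfolding K0_def by blast
    have fK: "f1 \<in> K" "f2 \<in> K" using f1(1) f2(1) F1(2) F2(2) unfolding Ky_def by auto
    have k_eq: "k = (f1 \<circ> f2) \<circ> (finv f2 \<circ> (finv f1 \<circ> k))"
      by (simp only: comp_assoc perm_group_cancel(1)[OF K(2) fK(1)] perm_group_cancel(1)[OF K(2) fK(2)])
    have ks: "finv f2 \<circ> (finv f1 \<circ> k) \<in> K" "f1 \<circ> f2 \<in> K"
      by (intro perm_groupD(4)[OF K(2)] perm_groupD(3)[OF K(2)] fK k(1))+
    have "\<rho> k z = \<rho> (f1 \<circ> f2) z" if "z \<in> U" for z
    proof -
      have "\<rho> k z = \<rho> (f1 \<circ> f2 \<circ> (finv f2 \<circ> (finv f1 \<circ> k))) z" by (rule arg_cong[OF k_eq])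
      also have "\<dots> = \<rho> (f1 \<circ> f2) z" unfolding actsD(2)[OF aK ks(2,1), of z] U(3)[OF that] ..
      finally show ?thesis .
    qed
    then have "germ (\<rho> k) = germ (\<rho> (f1 \<circ> f2))" using germ_iff U(1,2) by blast
    then show "W \<in> (\<lambda>(f1,f2). germ (\<rho> (f1 \<circ> f2))) ` (F1 \<times> F2)" using k(2) f1(1) f2(1) by blast
  qed
  have fin2: "finite (orb ?\<beta> K (germ id))"
    using finite_subset[OF sub] F1(1) F2(1) by blast
  obtain S2 where S2: "gens S2 R" using schreier_gens_stab[OF K(2,3) ab fin2] unfolding R_def by blast
  \<comment> \<open>Each element of \<open>R\<close> has its own neighbourhood; intersecting those
    of the finitely many generators gives one for all of \<open>R\<close>.\<close>
  have "\<forall>s\<in>S2. \<exists>U. openin X U \<and> y \<in> U \<and> (\<forall>z\<in>U. \<rho> s z = z)"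
    using gensD(2)[OF S2] R_iff by blast
  then obtain UU where UU: "\<And>s. s \<in> S2 \<Longrightarrow> openin X (UU s)" "\<And>s. s \<in> S2 \<Longrightarrow> y \<in> UU s"
    "\<And>s z. s \<in> S2 \<Longrightarrow> z \<in> UU s \<Longrightarrow> \<rho> s z = z" by metis
  define U where "U = topspace X \<inter> \<Inter> (UU ` S2)"
  have "openin X U" unfolding U_def
    by (rule openin_Int_Inter) (use gensD(1)[OF S2] UU(1) in auto)
  have "y \<in> U" unfolding U_def using y UU(2) by blast
  have Rperm: "perm_group R" unfolding R_def using perm_group_stab1[OF K(2) ab] .
  have Rfix: "\<rho> r z = z" if "r \<in> R" "z \<in> U" for r z
    using S2 that(1)
  proof (induct rule: gens_induct)
    case id
    then show ?case using actsD(1)[OF act] .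
  next
    case (step s k)
    have "s \<in> K" "k \<in> K" using step(1,2) gensD(2)[OF S2] unfolding R_def by auto
    moreover have "\<rho> s z = z" using UU(3) step(1) that(2) unfolding U_def by blast
    ultimately show ?case using actsD(2)[OF aK] step(3) by metis
  qed (rule Rperm)
  \<comment> \<open>\<open>R\<close> stabilizes a single germ and need not be normal. The kernel of
    the action on the whole finite orbit of germs is.\<close>
  define \<Omega> where "\<Omega> = orb ?\<beta> K (germ id)"
  have \<Omega>inv: "?\<beta> k \<omega> \<in> \<Omega>" if k: "k \<in> K" and o: "\<omega> \<in> \<Omega>" for k \<omega>
  proof -
    obtain k' where k': "k' \<in> K" "\<omega> = ?\<beta> k' (germ id)" using o unfolding \<Omega>_def orb_def by blast
    then have "?\<beta> k \<omega> = ?\<beta> (k \<circ> k') (germ id)" using actsD(2)[OF ab k k'(1)] by metis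
    then show ?thesis unfolding \<Omega>_def orb_def using perm_groupD(4)[OF K(2) k k'(1)] by blast
  qed
  define B where "B = {k\<in>K. \<forall>\<omega>\<in>\<Omega>. ?\<beta> k \<omega> = \<omega>}"
  have fiB: "finite_index B K" unfolding B_def
  proof (rule finite_index_kernel[OF K(2,3) ab, where m = "card \<Omega>"])
    fix \<omega> assume o: "\<omega> \<in> \<Omega>"
    have "orb ?\<beta> K \<omega> \<subseteq> \<Omega>" using \<Omega>inv o unfolding orb_def[of ?\<beta> K \<omega>] by blast
    moreover have "finite \<Omega>" unfolding \<Omega>_def by (rule fin2)
    ultimately show "finite (orb ?\<beta> K \<omega>) \<and> card (orb ?\<beta> K \<omega>) \<le> card \<Omega>"
      by (meson card_mono finite_subset)
  qed
  have normal: "k \<circ> b \<circ> finv k \<in> B" if "k \<in> K" "b \<in> B" for k b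
    unfolding B_def by (rule kernel_normal[OF K(2) ab _ that(1) that(2)[unfolded B_def]]) (rule \<Omega>inv)
  have BR: "B \<subseteq> R"
  proof -
    have "germ id \<in> \<Omega>" unfolding \<Omega>_def orb_def
      by (rule image_eqI[OF _ perm_groupD(1)[OF K(2)]]) (simp only: actsD(1)[OF ab])
    then show ?thesis unfolding B_def R_def by blast
  qed
  show ?thesis
  proof (intro exI[of _ B] exI[of _ U] conjI ballI)
    show "perm_group B" unfolding B_def using perm_group_stab[OF K(2) ab] .
    show "B \<subseteq> K" unfolding B_def by blast
    show "\<rho> b z = z" if "b \<in> B" "z \<in> U" for b z using Rfix BR that by blast
  qed (fact | rule normal)+
qed

end

section \<open>Branch groups\<close>

lemma tree_aut_child:
  "tree_aut T g \<Longrightarrow> v \<in> T \<Longrightarrow> w \<in> T \<Longrightarrow> (\<exists>a. w = v @ [a]) \<longleftrightarrow> (\<exists>a. g w = g v @ [a])"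
  unfolding tree_aut_def by blast

lemma tree_aut_level:
  assumes "rooted_tree T" "tree_aut T g"
  shows "w \<in> T \<Longrightarrow> g w \<in> T \<and> length (g w) = length w"
proof (induct w rule: rev_induct)
  case Nil
  then show ?case using assms unfolding tree_aut_def rooted_tree_def by auto
next
  case (snoc a w)
  then have "w \<in> T" using assms(1) unfolding rooted_tree_def by blast
  moreover have "g (w @ [a]) \<in> T" using assms(2) snoc(2) unfolding tree_aut_def bij_betw_def by auto
  moreover obtain b where "g (w @ [a]) = g w @ [b]"
    using assms(2) snoc(2) \<open>w \<in> T\<close> unfolding tree_aut_def by blast
  ultimately show ?case using snoc(1) by auto
qed

lemma tree_aut_prefix:
  assumes "rooted_tree T" "tree_aut T g" "v @ u \<in> T"
  shows "prefix (g v) (g (v @ u))"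
  using assms(3)
proof (induct u rule: rev_induct)
  case (snoc a u)
  then have "(v @ u) @ [a] \<in> T" "v @ u \<in> T" using assms(1) unfolding rooted_tree_def by (simp, metis append_assoc)
  moreover from this obtain b where "g ((v @ u) @ [a]) = g (v @ u) @ [b]"
    using assms(2) unfolding tree_aut_def by blast
  ultimately show ?case using snoc(1) by auto
qed auto

text \<open>Being the identity outside \<open>T\<close> extends the bijection of \<open>T\<close> to
  the whole type, so that \<open>finv\<close> is an honest inverse.\<close>

lemma tree_aut_inv:
  assumes "tree_aut T g"
  shows "bij g" "tree_aut T (finv g)"
proof -
  have b: "bij_betw g T T" and out: "\<And>v. v \<notin> T \<Longrightarrow> g v = v" using assms unfolding tree_aut_def by auto
  have "bij_betw g (- T) (- T)"
    by (rule bij_betw_imageI) (use out in \<open>auto simp: inj_on_def image_iff\<close>)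
  then have "bij_betw g (T \<union> - T) (T \<union> - T)" using b by (intro bij_betw_combine) auto
  then show bij: "bij g" by simp
  have fi: "finv g v = w \<longleftrightarrow> v = g w" for v w
    using bij bij_inv_eq_iff by metis
  have gT: "g v \<in> T \<longleftrightarrow> v \<in> T" for v using b out unfolding bij_betw_def by (metis image_eqI)
  have iT: "finv g v \<in> T \<longleftrightarrow> v \<in> T" for v using gT[of "finv g v"] fi by metis
  show "tree_aut T (finv g)"
    unfolding tree_aut_def
  proof (intro conjI ballI allI impI)
    show "bij_betw (finv g) T T"
    proof (rule bij_betw_imageI)
      show "inj_on (finv g) T" using bij_imp_bij_inv[OF bij] by (meson bij_is_inj inj_on_subset subset_UNIV)
      show "finv g ` T = T"
      proof
        show "finv g ` T \<subseteq> T" using iT by auto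
        show "T \<subseteq> finv g ` T" using gT fi by (metis image_eqI subsetI)
      qed
    qed
    show "finv g [] = []" using assms fi unfolding tree_aut_def by metis
    show "finv g v = v" if "v \<notin> T" for v using out[OF that] fi by metis
    fix v w assume "v \<in> T" "w \<in> T"
    then have "(\<exists>a. finv g w = finv g v @ [a]) \<longleftrightarrow> (\<exists>a. g (finv g w) = g (finv g v) @ [a])"
      using iT by (intro tree_aut_child[OF assms]) auto
    moreover have "g (finv g x) = x" for x using fi by metis
    ultimately show "(\<exists>a. w = v @ [a]) \<longleftrightarrow> (\<exists>a. finv g w = finv g v @ [a])" by simp
  qed
qed

lemma perm_group_tree_aut: "perm_group {g. tree_aut T g}"
  unfolding perm_group_def
proof (intro conjI ballI)
  show "id \<in> {g. tree_aut T g}" unfolding tree_aut_def by (simp add: bij_betw_def)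
  fix g assume g: "g \<in> {g. tree_aut T g}"
  show "bij g" "finv g \<in> {g. tree_aut T g}" using tree_aut_inv g by auto
  fix h assume h: "h \<in> {g. tree_aut T g}"
  have "bij_betw g T T" "bij_betw h T T" using g h unfolding tree_aut_def by simp_all
  then have "bij_betw (g \<circ> h) T T" by (rule bij_betw_trans[rotated])
  moreover have hT: "h v \<in> T" if "v \<in> T" for v using h that unfolding tree_aut_def bij_betw_def by auto
  moreover have "(\<exists>a. w = v @ [a]) = (\<exists>a. (g \<circ> h) w = (g \<circ> h) v @ [a])" if "v \<in> T" "w \<in> T" for v w
  proof -
    have "(\<exists>a. w = v @ [a]) = (\<exists>a. h w = h v @ [a])" using tree_aut_child[of T h] h that by simp
    also have "\<dots> = (\<exists>a. g (h w) = g (h v) @ [a])" using tree_aut_child[of T g "h v" "h w"] g hT that by simp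
    finally show ?thesis by simp
  qed
  ultimately show "g \<circ> h \<in> {g. tree_aut T g}" using g h unfolding tree_aut_def by auto
qed

lemma prefix_same_length: "prefix u w \<Longrightarrow> prefix v w \<Longrightarrow> length u = length v \<Longrightarrow> u = v"
  by (metis append_eq_append_conv prefix_def)

locale branch_tree =
  fixes T :: "'a list set" and G :: "('a list \<Rightarrow> 'a list) set"
  assumes tree: "infinite_locally_finite_rooted_tree T" and branch: "branch_group T G"
    and fg: "finitely_generated (fun_group G)"
begin

lemma rooted: "rooted_tree T"
  using tree unfolding infinite_locally_finite_rooted_tree_def by blast

lemma prefix_in_T: "prefix v w \<Longrightarrow> w \<in> T \<Longrightarrow> v \<in> T"
  using rooted unfolding rooted_tree_def prefix_def by blast

lemma G: "perm_group G" and G_aut: "g \<in> G \<Longrightarrow> tree_aut T g"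
proof -
  have "subgroup G (fun_group {g. tree_aut T g})"
    using branch unfolding branch_group_def aut_group_def by blast
  note * = perm_group_if_subgroup[OF this perm_group_tree_aut perm_group_fun_group(2)[OF perm_group_tree_aut]]
  show "perm_group G" using * by blast
  show "g \<in> G \<Longrightarrow> tree_aut T g" using * by blast
qed

lemma G_out: "g \<in> G \<Longrightarrow> w \<notin> T \<Longrightarrow> g w = w"
  using G_aut unfolding tree_aut_def by blast

lemma G_length: "g \<in> G \<Longrightarrow> length (g w) = length w"
  using tree_aut_level[OF rooted G_aut] G_out by metis

lemma G_T: "g \<in> G \<Longrightarrow> w \<in> T \<Longrightarrow> g w \<in> T"
  using tree_aut_level[OF rooted G_aut] by blast

lemma G_prefix: "g \<in> G \<Longrightarrow> prefix v w \<Longrightarrow> w \<in> T \<Longrightarrow> prefix (g v) (g w)"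
  using tree_aut_prefix[OF rooted G_aut] unfolding prefix_def by blast

section \<open>Rigid vertex stabilizers\<close>

abbreviation "R \<equiv> rist_vertex T G"

definition lev :: "nat \<Rightarrow> 'a list set" where
  "lev n = {v\<in>T. length v = n}"

lemma R_iff: "k \<in> R v \<longleftrightarrow> k \<in> G \<and> (\<forall>w. \<not> prefix v w \<longrightarrow> k w = w)"
  unfolding rist_vertex_def prefix_def using G_out by blast

lemma R_G: "R v \<subseteq> G"
  using R_iff by blast

text \<open>A moved \<open>v\<close> would have its image on the same level, thus not below
  \<open>v\<close>. There \<open>k\<close> is the identity, which contradicts injectivity.\<close>

lemma R_vertex:
  assumes "k \<in> R v" shows "k v = v"
proof (rule ccontr)
  assume "k v \<noteq> v"
  moreover have len: "length (k v) = length v" using G_length assms R_G by blast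
  ultimately have "\<not> prefix v (k v)" using prefix_same_length[of v "k v" "k v"] by auto
  then have "k (k v) = k v" using assms R_iff by blast
  moreover have "bij k" using perm_groupD(2)[OF G] assms R_G by blast
  ultimately show False using \<open>k v \<noteq> v\<close> by (metis bij_pointE)
qed

lemma R_prefix:
  assumes "k \<in> R v" shows "prefix v (k w) \<longleftrightarrow> prefix v w"
proof
  assume "prefix v w"
  then show "prefix v (k w)"
    using G_prefix[of k v w] R_vertex[OF assms] subsetD[OF R_G assms] G_out[of k w] by (cases "w \<in> T") auto
next
  assume "prefix v (k w)"
  then show "prefix v w" using assms R_iff by metis
qed

lemma R_perm: "perm_group (R v)"
proof -
  have "finv k w = w" if "k \<in> G" "k w = w" for k w
    using perm_group_inv_simps(2)[OF G that(1), of w] that(2) by simp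
  then show ?thesis
    using perm_groupD[OF G] unfolding perm_group_def by (auto simp: R_iff)
qed

lemma R_mono: "prefix v u \<Longrightarrow> R u \<subseteq> R v"
  using prefix_order.trans unfolding R_iff subset_iff by blast

lemma R_commute:
  assumes "\<not> prefix v w" "\<not> prefix w v" "k \<in> R v" "l \<in> R w"
  shows "k \<circ> l = l \<circ> k"
proof
  fix x
  consider "prefix v x" "\<not> prefix w x" | "prefix w x" "\<not> prefix v x" | "\<not> prefix w x" "\<not> prefix v x"
    using prefix_same_cases assms(1,2) by blast
  then show "(k \<circ> l) x = (l \<circ> k) x"
  proof cases
    case 1
    then have "\<not> prefix w (k x)" using R_prefix[OF assms(3), of x] prefix_same_cases assms(1,2) by blast
    then show ?thesis using 1 assms(4) R_iff by simp
  next
    case 2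
    then have "\<not> prefix v (l x)" using R_prefix[OF assms(4), of x] prefix_same_cases assms(1,2) by blast
    then show ?thesis using 2 assms(3) R_iff by simp
  next
    case 3
    then show ?thesis using assms(3,4) R_iff by simp
  qed
qed

lemma R_conj:
  assumes g: "g \<in> G" and v: "v \<in> T" and k: "k \<in> R v"
  shows "conjby g k \<in> R (g v)"
proof -
  have i: "finv g \<in> G" using perm_groupD(3)[OF G g] .
  have "conjby g k w = w" if "\<not> prefix (g v) w" for w
  proof -
    have gi: "g (finv g w) = w" using perm_group_inv_simps(1)[OF G g] .
    have "k (finv g w) = finv g w"
    proof (cases "w \<in> T")
      case True
      then have "\<not> prefix v (finv g w)" using G_prefix[OF g, of v "finv g w"] G_T[OF i] gi that by auto
      then show ?thesis using k R_iff by blast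
    next
      case False
      then have "finv g w = w" using G_out[OF i] by blast
      then show ?thesis using G_out False k R_G by auto
    qed
    then show ?thesis unfolding conjby_def using gi by simp
  qed
  moreover have "conjby g k \<in> G"
    unfolding conjby_def using perm_groupD(4)[OF G] g i k R_G by blast
  ultimately show ?thesis unfolding R_iff by blast
qed

lemma R_conj_image:
  assumes g: "g \<in> G" and v: "v \<in> T"
  shows "conjby g ` R v = R (g v)"
proof
  show "conjby g ` R v \<subseteq> R (g v)" using R_conj[OF g v] by blast
  show "R (g v) \<subseteq> conjby g ` R v"
  proof
    fix k assume k: "k \<in> R (g v)"
    have i: "finv g \<in> G" using perm_groupD(3)[OF G g] .
    have "finv g (g v) = v" using perm_group_inv_simps(2)[OF G g] .
    then have "conjby (finv g) k \<in> R v" using R_conj[OF i G_T[OF g v] k] by metis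
    moreover have "k = conjby g (conjby (finv g) k)"
      unfolding conjby_conjby[OF G g i] perm_group_inv_simps(3)[OF G g] by (simp add: conjby_def)
    ultimately show "k \<in> conjby g ` R v" by blast
  qed
qed

section \<open>Levels of the tree\<close>

lemma lev_finite: "finite (lev n)"
proof (induct n)
  case 0
  have "lev 0 \<subseteq> {[]}" unfolding lev_def by auto
  then show ?case using finite_subset by blast
next
  case (Suc n)
  have "lev (Suc n) \<subseteq> (\<Union>v\<in>lev n. (\<lambda>a. v @ [a]) ` {a. v @ [a] \<in> T})"
  proof
    fix w assume w: "w \<in> lev (Suc n)"
    then have "w \<noteq> []" unfolding lev_def by auto
    then obtain v a where va: "w = v @ [a]" by (metis rev_exhaust)
    then have "v \<in> T" using w prefix_in_T[of v w] unfolding lev_def by auto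
    then show "w \<in> (\<Union>v\<in>lev n. (\<lambda>a. v @ [a]) ` {a. v @ [a] \<in> T})" using w va unfolding lev_def by auto
  qed
  moreover have "finite {a. v @ [a] \<in> T}" if "v \<in> lev n" for v
    using tree that unfolding infinite_locally_finite_rooted_tree_def lev_def by blast
  ultimately show ?case using Suc by (meson finite_UN finite_imageI finite_subset)
qed

lemma take_lev: "w \<in> lev m \<Longrightarrow> n \<le> m \<Longrightarrow> take n w \<in> lev n"
  using prefix_in_T[OF take_is_prefix, of w n] unfolding lev_def by auto

lemma lev_nonempty: "lev n \<noteq> {}"
proof
  assume e: "lev n = {}"
  have "T \<subseteq> (\<Union>m<n. lev m)"
  proof
    fix w assume w: "w \<in> T"
    have "length w < n"
    proof (rule ccontr)
      assume "\<not> length w < n"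
      then have "take n w \<in> lev n" using take_lev[of w "length w" n] w unfolding lev_def by auto
      then show False using e by blast
    qed
    then show "w \<in> (\<Union>m<n. lev m)" using w unfolding lev_def by auto
  qed
  moreover have "finite (\<Union>m<n. lev m)" using lev_finite by blast
  ultimately show False
    using tree finite_subset unfolding infinite_locally_finite_rooted_tree_def by blast
qed

lemma lev_trans: "v \<in> lev n \<Longrightarrow> w \<in> lev n \<Longrightarrow> \<exists>g\<in>G. g v = w"
proof -
  assume "v \<in> lev n" "w \<in> lev n"
  then have "v \<in> T" "w \<in> T" "length v = length w" unfolding lev_def by simp_all
  moreover have "level_transitive T G" using branch unfolding branch_group_def by simp
  ultimately show ?thesis unfolding level_transitive_def by simp
qed

lemma lev_G: "g \<in> G \<Longrightarrow> v \<in> lev n \<Longrightarrow> g v \<in> lev n"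
  using G_T G_length unfolding lev_def by auto

text \<open>Leaves are excluded by level transitivity: some vertex of level \<open>m\<close> exists,
  and an element that moves its ancestor on level \<open>n\<close> to \<open>w\<close> carries it
  below \<open>w\<close>.\<close>

lemma lev_extend:
  assumes "w \<in> lev n" "n \<le> m" shows "\<exists>u\<in>lev m. prefix w u"
proof -
  obtain u where u: "u \<in> lev m" using lev_nonempty by blast
  obtain g where g: "g \<in> G" "g (take n u) = w" using lev_trans[OF take_lev[OF u assms(2)] assms(1)] by blast
  have "prefix w (g u)" using G_prefix[OF g(1) take_is_prefix, of u n] u g(2) unfolding lev_def by auto
  then show ?thesis using lev_G[OF g(1) u] by blast
qed

lemma moved_extend:
  assumes "g \<in> G" "g u \<noteq> u" "prefix u w" "w \<in> T" shows "g w \<noteq> w"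
proof
  assume "g w = w"
  then have "prefix (g u) w" using G_prefix[OF assms(1,3,4)] by simp
  then show False using prefix_same_length[OF _ assms(3)] G_length[OF assms(1)] assms(2) by blast
qed

section \<open>Rigid level stabilizers and their components\<close>

definition restr :: "'a list \<Rightarrow> ('a list \<Rightarrow> 'a list) \<Rightarrow> 'a list \<Rightarrow> 'a list" where
  "restr v k = (\<lambda>w. if prefix v w then k w else w)"

lemma restr_R: "k \<in> R v \<Longrightarrow> restr v k = k"
  unfolding restr_def R_iff by auto

text \<open>For arbitrary \<open>h\<close> the restriction need not preserve the subtree below
  \<open>v\<close>. The hypothesis ensures that it does, as is the case for elements of the rigid
  level stabilizer.\<close>

lemma restr_comp:
  assumes "restr v h \<in> R v"
  shows "restr v (g \<circ> h) = restr v g \<circ> restr v h"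
proof
  fix w
  show "restr v (g \<circ> h) w = (restr v g \<circ> restr v h) w"
    using R_prefix[OF assms, of w] unfolding restr_def by (cases "prefix v w") auto
qed

lemma rist_level_group: "perm_group (rist_level T G n)" "rist_level T G n \<subseteq> G"
proof -
  have "subgroup (rist_level T G n) (fun_group G)"
    unfolding rist_level_def
    by (rule group.generate_is_subgroup[OF perm_group_fun_group(1)[OF G]]) (use R_G in \<open>auto simp: fun_group_def\<close>)
  note * = perm_group_if_subgroup[OF this G perm_group_fun_group(2)[OF G]]
  show "perm_group (rist_level T G n)" "rist_level T G n \<subseteq> G" using * by blast+
qed

lemma R_rist_level: "v \<in> lev n \<Longrightarrow> R v \<subseteq> rist_level T G n"
  unfolding rist_level_def lev_def[symmetric] by (intro subsetI generate.incl UN_I)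

lemma restr_other:
  assumes "k \<in> R v0" "v \<noteq> v0" "length v = length v0" shows "restr v k = id"
proof
  fix w
  show "restr v k w = id w"
  proof (cases "prefix v w")
    case True
    then have "\<not> prefix v0 w" using prefix_same_length assms(2,3) by blast
    then show ?thesis using assms(1) R_iff unfolding restr_def by simp
  qed (simp add: restr_def)
qed

text \<open>On a generator each restriction is either the generator itself or the identity, and
  restriction respects products. The second clause covers the vertices above level \<open>n\<close>,
  which no restriction sees.\<close>

lemma rist_level_restr:
  assumes "k \<in> rist_level T G n"
  shows "(\<forall>v\<in>lev n. restr v k \<in> R v) \<and> (\<forall>w\<in>T. length w < n \<longrightarrow> k w = w)"
proof -
  have base: "(\<forall>v\<in>lev n. restr v k \<in> R v) \<and> (\<forall>w\<in>T. length w < n \<longrightarrow> k w = w)"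
    if "k \<in> R v0" "v0 \<in> lev n" for k v0
  proof (intro conjI ballI impI)
    fix v assume "v \<in> lev n"
    then have "restr v k \<in> {k, id}"
      using restr_R[OF that(1)] restr_other[OF that(1), of v] that(2) unfolding lev_def by auto
    then show "restr v k \<in> R v"
      using perm_groupD(1)[OF R_perm] restr_R[OF that(1)] restr_other[OF that(1), of v] that \<open>v \<in> lev n\<close>
      unfolding lev_def by (cases "v = v0") auto
  next
    fix w assume "w \<in> T" "length w < n"
    then have "\<not> prefix v0 w" using that(2) prefix_length_le[of v0 w] unfolding lev_def by auto
    then show "k w = w" using that(1) R_iff by blast
  qed
  have "k \<in> generate (fun_group G) (\<Union>v\<in>lev n. R v)"
    using assms unfolding rist_level_def lev_def .
  then show ?thesis
  proof (induct rule: generate.induct)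
    case one
    have "restr v id = id" for v unfolding restr_def by auto
    then show ?case using perm_groupD(1)[OF R_perm] unfolding fun_group_def monoid.simps by (simp only:) simp
  next
    case (incl h)
    then show ?case using base by blast
  next
    case (inv h)
    then obtain v0 where v0: "v0 \<in> lev n" "h \<in> R v0" by blast
    then have "inv\<^bsub>fun_group G\<^esub> h = finv h" using perm_group_fun_group(2)[OF G] R_G by blast
    then show ?case using base[OF perm_groupD(3)[OF R_perm v0(2)] v0(1)] by metis
  next
    case (eng h1 h2)
    have m: "h1 \<otimes>\<^bsub>fun_group G\<^esub> h2 = h1 \<circ> h2" by (simp add: fun_group_def)
    have "restr v (h1 \<circ> h2) \<in> R v" if "v \<in> lev n" for v
    proof -
      have "restr v h1 \<in> R v" "restr v h2 \<in> R v" using eng(2,4) that by blast+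
      then show ?thesis using restr_comp[of v h2 h1] perm_groupD(4)[OF R_perm] by metis
    qed
    moreover have "(h1 \<circ> h2) w = w" if "w \<in> T" "length w < n" for w using eng(2,4) that by simp
    ultimately show ?case unfolding m by blast
  qed
qed

text \<open>An element of the rigid level stabilizer is the product of its restrictions, which is why it fixes a
  point as soon as all restrictions do.\<close>
lemma rist_level_fixes:
  assumes k: "k \<in> rist_level T G n" and a: "acts G \<rho>"
    and fix1: "\<And>v. v \<in> lev n \<Longrightarrow> \<rho> (restr v k) x = x"
  shows "\<rho> k x = x"
proof -
  have rk: "restr v k \<in> R v" if "v \<in> lev n" for v using rist_level_restr[OF k] that by blast
  \<comment> \<open>\<open>c V\<close> is the product of the restrictions to the vertices of
    \<open>V\<close>, given in closed form so that no order of the factors has to be chosen.\<close>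
  define c where "c V w = (if \<exists>v\<in>V. prefix v w then k w else w)" for V w
  have "c V \<in> G \<and> \<rho> (c V) x = x" if "V \<subseteq> lev n" "finite V" for V
    using that(2,1)
  proof (induct V rule: finite_induct)
    case empty
    have "c {} = id" unfolding c_def by auto
    then show ?case using perm_groupD(1)[OF G] actsD(1)[OF a] by (simp only:)
  next
    case (insert v V)
    have vl: "v \<in> lev n" using insert(4) by blast
    have eq: "c (insert v V) = c V \<circ> restr v k"
    proof
      fix w
      show "c (insert v V) w = (c V \<circ> restr v k) w"
      proof (cases "prefix v w")
        case True
        then have "prefix v (k w)" using R_prefix[OF rk[OF vl], of w] unfolding restr_def by simp
        then have "\<not> (\<exists>v'\<in>V. prefix v' (k w))"
          using prefix_same_length[of v "k w"] insert(2,4) unfolding lev_def by blast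
        then show ?thesis using True unfolding c_def restr_def by simp
      qed (simp add: c_def restr_def)
    qed
    have c: "c V \<in> G" "\<rho> (c V) x = x" using insert by blast+
    have r: "restr v k \<in> G" using rk[OF vl] R_G by blast
    show ?case unfolding eq actsD(2)[OF a c(1) r] fix1[OF vl] using perm_groupD(4)[OF G c(1) r] c(2) by blast
  qed
  moreover have "c (lev n) = k"
  proof
    fix w
    consider "w \<notin> T" | "w \<in> T" "length w < n" | "w \<in> T" "n \<le> length w" by linarith
    then show "c (lev n) w = k w"
    proof cases
      case 1
      then show ?thesis using G_out[OF subsetD[OF rist_level_group(2) k]] unfolding c_def by simp
    next
      case 2
      then show ?thesis using rist_level_restr[OF k] unfolding c_def by auto
    next
      case 3
      then have "take n w \<in> lev n" using take_lev[of w "length w" n] unfolding lev_def by auto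
      then show ?thesis using take_is_prefix unfolding c_def by auto
    qed
  qed
  ultimately show ?thesis using lev_finite by (metis subset_refl)
qed

text \<open>\<open>branch_group\<close> counts right cosets, \<open>finite_index\<close> left ones;
  inverting the elements exchanges the two.\<close>

lemma rist_level_finite_index:
  assumes "n \<ge> 1" shows "finite_index (rist_level T G n) G"
proof -
  let ?N = "rist_level T G n"
  have fin: "finite (rcosets\<^bsub>fun_group G\<^esub> ?N)"
    using branch assms unfolding branch_group_def by blast
  interpret FG: Group.group "fun_group G" using perm_group_fun_group(1)[OF G] .
  have car: "carrier (fun_group G) = G" by (simp add: fun_group_def)
  have sub: "subgroup ?N (fun_group G)"
    unfolding rist_level_def
    by (rule FG.generate_is_subgroup) (use R_G in \<open>auto simp: fun_group_def\<close>)
  show ?thesis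
  proof (rule finite_indexI[where \<Psi> = "\<lambda>g. ?N #>\<^bsub>fun_group G\<^esub> finv g"])
    show "finite ((\<lambda>g. ?N #>\<^bsub>fun_group G\<^esub> finv g) ` G)"
    proof (rule finite_subset[OF _ fin], rule image_subsetI)
      fix g assume "g \<in> G"
      then show "?N #>\<^bsub>fun_group G\<^esub> finv g \<in> rcosets\<^bsub>fun_group G\<^esub> ?N"
        using FG.rcosetsI[of ?N "finv g"] rist_level_group(2) perm_groupD(3)[OF G] unfolding car by blast
    qed
    fix k k' assume k: "k \<in> G" "k' \<in> G" "?N #>\<^bsub>fun_group G\<^esub> finv k = ?N #>\<^bsub>fun_group G\<^esub> finv k'"
    have "finv k \<in> ?N #>\<^bsub>fun_group G\<^esub> finv k"
      using FG.rcos_self[OF _ sub] perm_groupD(3)[OF G k(1)] unfolding car by blast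
    then have "finv k \<in> ?N #>\<^bsub>fun_group G\<^esub> finv k'" unfolding k(3) .
    then obtain r where r: "r \<in> ?N" "finv k = r \<circ> finv k'"
      unfolding r_coset_def by (auto simp: fun_group_def)
    have "finv k \<circ> k' = r" unfolding r(2) comp_assoc perm_group_inv_simps(4)[OF G k(2)] by (rule comp_id)
    then show "finv k \<circ> k' \<in> ?N" using r(1) by blast
  qed
qed

text \<open>A finite index subgroup of a finitely generated group is finitely generated: Schreier's
  lemma for the action on left cosets, in which the subgroup is the stabilizer of itself.\<close>

lemma rist_level_gens:
  assumes "n \<ge> 1" shows "\<exists>S. gens S (rist_level T G n)"
proof -
  let ?N = "rist_level T G n"
  obtain S where S: "gens S G" using gens_if_finitely_generated[OF G fg] by blast
  let ?\<beta> = "\<lambda>g W. (\<lambda>h :: 'a list \<Rightarrow> 'a list. g \<circ> h) ` W"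
  have ab: "acts G ?\<beta>" unfolding acts_def image_image by (simp add: comp_assoc image_image)
  have N: "perm_group ?N" "?N \<subseteq> G" using rist_level_group by blast+
  have stable: "?\<beta> r ?N = ?N" if r: "r \<in> ?N" for r
  proof
    show "?\<beta> r ?N \<subseteq> ?N" using perm_groupD(4)[OF N(1) r] by blast
    show "?N \<subseteq> ?\<beta> r ?N"
    proof
      fix h assume "h \<in> ?N"
      then have "finv r \<circ> h \<in> ?N" using perm_groupD(3,4)[OF N(1)] r by blast
      moreover have "h = r \<circ> (finv r \<circ> h)" using perm_group_cancel(1)[OF N(1) r] by metis
      ultimately show "h \<in> ?\<beta> r ?N" by blast
    qed
  qed
  obtain F where F: "finite F" "F \<subseteq> G" "\<And>g. g \<in> G \<Longrightarrow> \<exists>f\<in>F. finv f \<circ> g \<in> ?N"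
    using rist_level_finite_index[OF assms] unfolding finite_index_def by blast
  have "orb ?\<beta> G ?N \<subseteq> (\<lambda>f. ?\<beta> f ?N) ` F"
  proof
    fix W assume "W \<in> orb ?\<beta> G ?N"
    then obtain g where g: "g \<in> G" "W = ?\<beta> g ?N" unfolding orb_def by blast
    obtain f where f: "f \<in> F" "finv f \<circ> g \<in> ?N" using F(3)[OF g(1)] by blast
    have fG: "f \<in> G" using f F(2) by blast
    have "W = ?\<beta> (f \<circ> (finv f \<circ> g)) ?N" unfolding g(2) perm_group_cancel(1)[OF G fG] ..
    also have "\<dots> = ?\<beta> f (?\<beta> (finv f \<circ> g) ?N)" using actsD(2)[OF ab fG] f(2) N(2) by blast
    finally have "W = ?\<beta> f ?N" unfolding stable[OF f(2)] .
    then show "W \<in> (\<lambda>f. ?\<beta> f ?N) ` F" using f(1) by blast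
  qed
  then have "finite (orb ?\<beta> G ?N)" using F(1) finite_subset by blast
  then obtain S' where S': "gens S' {g\<in>G. ?\<beta> g ?N = ?N}" using schreier_gens_stab[OF G S ab] by blast
  have "{g\<in>G. ?\<beta> g ?N = ?N} = ?N"
  proof
    show "?N \<subseteq> {g\<in>G. ?\<beta> g ?N = ?N}" using stable N(2) by blast
    show "{g\<in>G. ?\<beta> g ?N = ?N} \<subseteq> ?N"
    proof
      fix g assume "g \<in> {g\<in>G. ?\<beta> g ?N = ?N}"
      moreover have "g \<circ> id \<in> ?\<beta> g ?N" using perm_groupD(1)[OF N(1)] by (rule imageI)
      ultimately show "g \<in> ?N" by simp
    qed
  qed
  then show ?thesis using S' by metis
qed

text \<open>Restriction to \<open>v\<close> projects the finitely generated rigid level stabilizer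
  onto \<open>R v\<close>.\<close>

lemma R_gens:
  assumes v: "v \<in> lev n" "n \<ge> 1" shows "\<exists>S. gens S (R v)"
proof -
  obtain S where S: "gens S (rist_level T G n)" using rist_level_gens[OF v(2)] by blast
  have r: "restr v k \<in> R v" if "k \<in> rist_level T G n" for k using rist_level_restr[OF that] v(1) by blast
  show ?thesis
  proof (rule gens_image[OF rist_level_group(1) S R_perm])
    show "restr v ` rist_level T G n = R v"
    proof
      show "restr v ` rist_level T G n \<subseteq> R v" using r by blast
      show "R v \<subseteq> restr v ` rist_level T G n"
      proof
        fix k assume k: "k \<in> R v"
        then have "k \<in> rist_level T G n" using R_rist_level[OF v(1)] by blast
        then show "k \<in> restr v ` rist_level T G n" by (metis restr_R[OF k] image_eqI)
      qed
    qed
    show "restr v (g \<circ> h) = restr v g \<circ> restr v h"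
      if "g \<in> rist_level T G n" "h \<in> rist_level T G n" for g h using restr_comp[OF r[OF that(2)]] .
  qed
qed

lemma restr_comm:
  assumes a: "a \<in> rist_level T G n" and b: "b \<in> rist_level T G n" and v: "v \<in> lev n"
  shows "restr v (comm a b) = comm (restr v a) (restr v b)"
proof -
  have N: "perm_group (rist_level T G n)" using rist_level_group(1) .
  have r: "restr v k \<in> R v" if "k \<in> rist_level T G n" for k using rist_level_restr[OF that] v by blast
  have c: "restr v (g \<circ> k) = restr v g \<circ> restr v k" if "k \<in> rist_level T G n" for g k
    using restr_comp[OF r[OF that]] .
  have i: "restr v (finv k) = finv (restr v k)" if k: "k \<in> rist_level T G n" for k
  proof -
    have "restr v (finv k) \<circ> restr v k = restr v (finv k \<circ> k)" using c[OF k] by simp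
    also have "\<dots> = id" unfolding perm_group_inv_simps(4)[OF N k] restr_def by auto
    finally have "restr v (finv k) \<circ> (restr v k \<circ> finv (restr v k)) = finv (restr v k)"
      unfolding comp_assoc[symmetric] by (simp only: id_comp)
    then show ?thesis unfolding perm_group_inv_simps(3)[OF R_perm r[OF k]] by (simp only: comp_id)
  qed
  have ai: "finv a \<in> rist_level T G n" and bi: "finv b \<in> rist_level T G n"
    using perm_groupD(3)[OF N] a b by blast+
  show ?thesis unfolding comm_def c[OF bi] c[OF ai] c[OF b] i[OF a] i[OF b] ..
qed

text \<open>This reduces the derived subgroup to single commutators inside single rigid vertex
  stabilizers, and is the reason why \<open>Z\<close> is defined by such commutators.\<close>

lemma derived_rist_level_fixes:
  assumes act: "acts G \<rho>" and k: "k \<in> derived (fun_group G) (rist_level T G n)"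
    and fixes1: "\<And>v g h. v \<in> lev n \<Longrightarrow> g \<in> R v \<Longrightarrow> h \<in> R v \<Longrightarrow> \<rho> (comm g h) x = x"
  shows "\<rho> k x = x"
proof -
  have comm_fixes: "\<rho> (comm a b) x = x" "comm a b \<in> G" if a: "a \<in> rist_level T G n" and b: "b \<in> rist_level T G n" for a b
  proof -
    have "comm a b \<in> rist_level T G n" using comm_in[OF rist_level_group(1) a b] .
    then show "comm a b \<in> G" "\<rho> (comm a b) x = x"
      using rist_level_group(2) rist_level_fixes[OF _ act] restr_comm[OF a b]
        fixes1 rist_level_restr[OF a] rist_level_restr[OF b] by (blast, metis)
  qed
  have inv: "inv\<^bsub>fun_group G\<^esub> a = finv a" if "a \<in> rist_level T G n" for a
    using perm_group_fun_group(2)[OF G] rist_level_group(2) that by blast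
  have gen: "h \<in> G \<and> \<rho> h x = x" if h: "h \<in> derived_set (fun_group G) (rist_level T G n)" for h
  proof -
    obtain a b where ab: "a \<in> rist_level T G n" "b \<in> rist_level T G n"
      "h = a \<otimes>\<^bsub>fun_group G\<^esub> b \<otimes>\<^bsub>fun_group G\<^esub> inv\<^bsub>fun_group G\<^esub> a \<otimes>\<^bsub>fun_group G\<^esub> inv\<^bsub>fun_group G\<^esub> b"
      using h by blast
    then have "h = comm a b" unfolding inv[OF ab(1)] inv[OF ab(2)] comm_def by (simp add: fun_group_def)
    then show ?thesis using comm_fixes[OF ab(1,2)] by blast
  qed
  have "k \<in> G \<and> \<rho> k x = x"
    using k unfolding derived_def
  proof (induct rule: generate.induct)
    case one
    have "\<one>\<^bsub>fun_group G\<^esub> = id" by (simp add: fun_group_def)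
    then show ?case using actsD(1)[OF act] perm_groupD(1)[OF G] by (simp only: conj_ac)
  next
    case (incl h)
    then show ?case using gen by blast
  next
    case (inv h)
    then have h: "h \<in> G" "\<rho> h x = x" using gen by blast+
    then show ?case
      unfolding perm_group_fun_group(2)[OF G h(1)]
      using perm_groupD(3)[OF G h(1)] acts_inv(2)[OF G act h(1), of x] by simp
  next
    case (eng h1 h2)
    have "h1 \<otimes>\<^bsub>fun_group G\<^esub> h2 = h1 \<circ> h2" by (simp add: fun_group_def)
    then show ?case using eng(2,4) actsD(2)[OF act, of h1 h2 x] perm_groupD(4)[OF G, of h1 h2] by (simp only:)
  qed
  then show ?thesis by blast
qed

text \<open>All rigid stabilizers on one level are conjugate, and \<open>R u\<close> contains those
  of the vertices below \<open>u\<close>.\<close>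

lemma R_nontrivial:
  assumes "\<And>n. n \<ge> 1 \<Longrightarrow> \<exists>u\<in>lev n. \<exists>k\<in>R u. k \<noteq> id" and u: "u \<in> T"
  shows "\<exists>k\<in>R u. k \<noteq> id"
proof -
  \<comment> \<open>One level below \<open>u\<close>, so that \<open>n\<close> is at least 1 also
    when \<open>u\<close> is the root.\<close>
  define n where "n = Suc (length u)"
  have ul: "u \<in> lev (length u)" using u unfolding lev_def by simp
  obtain w where w: "w \<in> lev n" "prefix u w" using lev_extend[OF ul, of n] unfolding n_def by auto
  obtain v k where v: "v \<in> lev n" "k \<in> R v" "k \<noteq> id" using assms(1)[of n] unfolding n_def by auto
  obtain g where g: "g \<in> G" "g v = w" using lev_trans[OF v(1) w(1)] by blast
  have "conjby g k \<in> R u" using R_conj[OF g(1) _ v(2)] v(1) g(2) R_mono[OF w(2)] unfolding lev_def by auto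
  moreover have "conjby g k \<noteq> id"
  proof
    assume e: "conjby g k = id"
    have "k x = x" for x
    proof -
      have "g (k (finv g (g x))) = g x" using fun_cong[OF e, of "g x"] unfolding conjby_def by simp
      then show ?thesis using perm_group_inv_simps(2)[OF G g(1)] by metis
    qed
    then show False using v(3) by auto
  qed
  ultimately show ?thesis by blast
qed

end

section \<open>Commutators of finite index subgroups of rigid stabilizers\<close>

locale nontrivial_branch_tree = branch_tree +
  assumes nontriv: "u \<in> T \<Longrightarrow> \<exists>k\<in>R u. k \<noteq> id"
begin

text \<open>A nontrivial element of \<open>R u\<close> moves some \<open>w\<close> below
  \<open>u\<close>. Then \<open>w\<close> and its image have the same ancestor on the level of
  \<open>u\<close>, so the level of \<open>w\<close> has more vertices.\<close>

lemma lev_unbounded: "\<exists>m\<ge>n. N < card (lev m)"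
proof (induct N)
  case 0
  show ?case using lev_nonempty[of n] lev_finite[of n] by (intro exI[of _ n]) (simp add: card_gt_0_iff)
next
  case (Suc N)
  then obtain m where m: "m \<ge> n" "N < card (lev m)" by blast
  obtain u where u: "u \<in> lev m" using lev_nonempty by blast
  then obtain k where k: "k \<in> R u" "k \<noteq> id" using nontriv unfolding lev_def by blast
  obtain w where w: "k w \<noteq> w" using k(2) by (auto simp: fun_eq_iff)
  have kG: "k \<in> G" using k(1) R_G by blast
  have wT: "w \<in> T" using w G_out[OF kG] by blast
  have uw: "prefix u w" "prefix u (k w)" using w k(1) R_iff R_prefix[OF k(1)] by blast+
  define m' where "m' = length w"
  have wl: "w \<in> lev m'" "k w \<in> lev m'" using wT G_T[OF kG] G_length[OF kG] unfolding lev_def m'_def by auto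
  have mm: "m \<le> m'" using uw(1) u prefix_length_le unfolding lev_def m'_def by auto
  have tk: "take m w = take m (k w)"
    using uw u unfolding lev_def prefix_def by auto
  have "lev m \<subseteq> take m ` (lev m' - {w})"
  proof
    fix x assume x: "x \<in> lev m"
    then obtain x' where x': "x' \<in> lev m'" "prefix x x'" using lev_extend mm by blast
    have tx: "take m x' = x" using x x'(2) unfolding lev_def prefix_def by auto
    show "x \<in> take m ` (lev m' - {w})"
    proof (cases "x' = w")
      case True
      then have "x = take m (k w)" using tx tk by simp
      then show ?thesis using wl(2) w by blast
    next
      case False
      then show ?thesis using tx x'(1) by blast
    qed
  qed
  then have "card (lev m) \<le> card (lev m' - {w})"
    using surj_card_le[of "lev m' - {w}" "lev m" "take m"] lev_finite by blast
  then have "Suc N < card (lev m')"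
    using m(2) card_Diff1_less[OF lev_finite wl(1)] by linarith
  then show ?case using mm m(1) le_trans by blast
qed

text \<open>If \<open>A\<close> fixed \<open>u\<close>, then \<open>G\<close> would move
  \<open>u\<close> to at most \<open>card F1 * card F2\<close> places: one factor counts cosets of
  the rigid level stabilizer, the other cosets of \<open>A\<close> in \<open>R v\<close>. By
  transitivity these places form the whole level.\<close>

lemma finite_index_moves:
  assumes v: "v \<in> lev n" "n \<ge> 1" and A: "A \<subseteq> R v" "finite_index A (R v)"
  shows "\<exists>m\<ge>n. \<forall>u\<in>lev m. prefix v u \<longrightarrow> (\<exists>a\<in>A. a u \<noteq> u)"
proof -
  obtain F1 where F1: "finite F1" "F1 \<subseteq> G" "\<And>g. g \<in> G \<Longrightarrow> \<exists>f\<in>F1. finv f \<circ> g \<in> rist_level T G n"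
    using rist_level_finite_index[OF v(2)] unfolding finite_index_def by blast
  obtain F2 where F2: "finite F2" "F2 \<subseteq> R v" "\<And>g. g \<in> R v \<Longrightarrow> \<exists>f\<in>F2. finv f \<circ> g \<in> A"
    using A(2) unfolding finite_index_def by blast
  obtain m where m: "m \<ge> n" "card F1 * card F2 < card (lev m)" using lev_unbounded by blast
  have "\<exists>a\<in>A. a u \<noteq> u" if u: "u \<in> lev m" "prefix v u" for u
  proof (rule ccontr)
    assume "\<not> ?thesis"
    then have fix1: "a u = u" if "a \<in> A" for a using that by blast
    have "lev m \<subseteq> (\<lambda>(f,k). f (k u)) ` (F1 \<times> F2)"
    proof
      fix w assume "w \<in> lev m"
      then obtain g where g: "g \<in> G" "g u = w" using lev_trans u(1) by blast
      obtain f where f: "f \<in> F1" "finv f \<circ> g \<in> rist_level T G n" using F1(3)[OF g(1)] by blast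
      let ?r = "restr v (finv f \<circ> g)"
      have r: "?r \<in> R v" using rist_level_restr[OF f(2)] v(1) by blast
      obtain k where k: "k \<in> F2" "finv k \<circ> ?r \<in> A" using F2(3)[OF r] by blast
      have fG: "f \<in> G" "k \<in> G" using f(1) F1(2) k(1) F2(2) R_G by auto
      have "?r u = k ((finv k \<circ> ?r) u)" using perm_group_inv_simps(1)[OF G fG(2)] by simp
      also have "\<dots> = k u" using fix1[OF k(2)] by simp
      finally have "finv f w = k u" using u(2) g(2) unfolding restr_def by simp
      then have "w = f (k u)" using perm_group_inv_simps(1)[OF G fG(1), of w] by simp
      then show "w \<in> (\<lambda>(f,k). f (k u)) ` (F1 \<times> F2)"
        using f(1) k(1) by (intro image_eqI[of _ _ "(f, k)"]) simp_all
    qed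
    then have "card (lev m) \<le> card (F1 \<times> F2)"
      using F1(1) F2(1) by (meson card_image_le card_mono finite_SigmaI finite_imageI le_trans)
    then show False using m(2) card_cartesian_product[of F1 F2] by simp
  qed
  then show ?thesis using m(1) by blast
qed

text \<open>For \<open>e\<close> deep enough, a commutator \<open>f\<close> of elements of
  \<open>B\<close> moves \<open>e\<close> off itself, whence
  \<open>comm g h = comm (comm g f) h\<close> by \<open>double_commutator\<close>. Expanding the
  right side leaves only \<open>R v\<close>-conjugates of \<open>f\<close> and inverses of such.
  \<open>M\<close> itself need not be normal: these conjugates are commutators in the normal
  subgroup \<open>B\<close>.\<close>

lemma rist_derived_le:
  assumes v: "v \<in> lev n" "n \<ge> 1" and B: "B \<subseteq> R v" "perm_group B" "finite_index B (R v)"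
    and normal: "\<And>k b. k \<in> R v \<Longrightarrow> b \<in> B \<Longrightarrow> conjby k b \<in> B"
    and M: "perm_group M" "\<And>b b'. b \<in> B \<Longrightarrow> b' \<in> B \<Longrightarrow> comm b b' \<in> M"
  shows "\<exists>m\<ge>n. \<forall>e\<in>lev m. prefix v e \<longrightarrow> (\<forall>g\<in>R e. \<forall>h\<in>R e. comm g h \<in> M)"
proof -
  obtain m1 where m1: "m1 \<ge> n" "\<And>u. u \<in> lev m1 \<Longrightarrow> prefix v u \<Longrightarrow> \<exists>a\<in>B. a u \<noteq> u"
    using finite_index_moves[OF v B(1,3)] by blast
  \<comment> \<open>A second application, to \<open>B \<inter> R e\<close>, supplies elements of
    \<open>B\<close> that act only below \<open>e\<close>. The two kinds of elements will be the
    entries of the commutator \<open>f\<close>.\<close>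
  have "\<exists>m\<ge>m1. \<forall>u\<in>lev m. prefix e u \<longrightarrow> (\<exists>a\<in>B \<inter> R e. a u \<noteq> u)" if e: "e \<in> lev m1" "prefix v e" for e
    using finite_index_restrict[OF R_perm B(2,3) R_perm R_mono[OF e(2)]] finite_index_moves[OF e(1)] m1(1) v(2)
    by (meson inf_le2 le_trans)
  then have "\<forall>e. \<exists>m. e \<in> lev m1 \<longrightarrow> prefix v e \<longrightarrow>
      m \<ge> m1 \<and> (\<forall>u\<in>lev m. prefix e u \<longrightarrow> (\<exists>a\<in>B \<inter> R e. a u \<noteq> u))" by blast
  then obtain m2 where m2: "\<And>e. e \<in> lev m1 \<Longrightarrow> prefix v e \<Longrightarrow>
      m2 e \<ge> m1 \<and> (\<forall>u\<in>lev (m2 e). prefix e u \<longrightarrow> (\<exists>a\<in>B \<inter> R e. a u \<noteq> u))" by metis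
  \<comment> \<open>The second level depends on the vertex of level \<open>m1\<close>; the sum over
    this finite level dominates all choices.\<close>
  define m where "m = m1 + (\<Sum>e\<in>lev m1. m2 e)"
  have m2m: "m2 e \<le> m" if "e \<in> lev m1" for e
    unfolding m_def using member_le_sum[OF that, of m2] lev_finite by simp
  have "comm g h \<in> M" if e: "e \<in> lev m" "prefix v e" and g: "g \<in> R e" and h: "h \<in> R e" for e g h
  proof -
    define e' where "e' = take m1 e"
    have m1m: "m1 \<le> m" unfolding m_def by simp
    have e': "e' \<in> lev m1" unfolding e'_def using take_lev[OF e(1) m1m] .
    have e'e: "prefix e' e" unfolding e'_def by (rule take_is_prefix)
    have ve': "prefix v e'"
      using prefix_length_prefix[OF e(2) e'e] v(1) e' m1(1) unfolding lev_def by auto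
    obtain b where b: "b \<in> B" "b e' \<noteq> e'" using m1(2)[OF e' ve'] by blast
    define e0 where "e0 = take (m2 e') e"
    have e0: "e0 \<in> lev (m2 e')" unfolding e0_def using take_lev[OF e(1) m2m[OF e']] .
    have e0e: "prefix e0 e" unfolding e0_def by (rule take_is_prefix)
    have "prefix e' e0"
      using prefix_length_prefix[OF e'e e0e] e' e0 m2[OF e' ve'] unfolding lev_def by auto
    then obtain c where c: "c \<in> B" "c \<in> R e'" "c e0 \<noteq> e0" using m2[OF e' ve'] e0 by blast
    have eT: "e \<in> T" using e(1) unfolding lev_def by blast
    have cG: "c \<in> G" "b \<in> G" using c(2) b(1) B(1) R_G by blast+
    have ce: "c e \<noteq> e" using moved_extend[OF cG(1) c(3) e0e eT] .
    have gv: "g \<in> R v" "h \<in> R v" using g h R_mono[OF e(2)] by auto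
    have gG: "g \<in> G" "h \<in> G" using g h R_G by auto
    define f where "f = comm b c"
    have fM: "f \<in> M" unfolding f_def using M(2)[OF b(1) c(1)] .
    have fG: "f \<in> G" unfolding f_def by (rule comm_in[OF G cG(2,1)])
    \<comment> \<open>\<open>f\<close> sends \<open>e\<close> to \<open>finv c e\<close>: as
      \<open>b\<close> moves \<open>e'\<close>, the vertex \<open>finv b (finv c e)\<close> has left
      the subtree below \<open>e'\<close>, so the inner factor \<open>c\<close> does not affect it,
      and \<open>b\<close> cancels.\<close>
    define e2 where "e2 = finv c e"
    have e2: "e2 \<noteq> e" unfolding e2_def using ce perm_group_inv_simps(1)[OF G cG(1), of e] by metis
    have ic: "finv c \<in> R e'" using perm_groupD(3)[OF R_perm c(2)] .
    have ib: "finv b \<in> G" using perm_groupD(3)[OF G cG(2)] .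
    have "prefix e' e2" unfolding e2_def using R_prefix[OF ic] e'e by blast
    moreover have "e2 \<in> T" unfolding e2_def using G_T[OF _ eT] ic R_G by blast
    ultimately have "prefix (finv b e') (finv b e2)" using G_prefix[OF ib] by blast
    moreover have "finv b e' \<noteq> e'" using b(2) perm_group_inv_simps(1)[OF G cG(2), of e'] by metis
    ultimately have "\<not> prefix e' (finv b e2)"
      using prefix_same_length G_length[OF ib, of e'] by metis
    then have "c (finv b e2) = finv b e2" using c(2) R_iff by blast
    then have "f e = e2"
      unfolding f_def comm_def using perm_group_inv_simps(1)[OF G cG(2), of e2] by (simp add: e2_def)
    then have fe: "f e \<noteq> e" "length (f e) = length e" using e2 G_length[OF fG] by auto
    have inc: "\<not> prefix (f e) e" "\<not> prefix e (f e)"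
      using fe by (metis prefix_same_length prefix_order.refl)+
    have "conjby f (finv g) \<in> R (f e)" using R_conj[OF fG eT] perm_groupD(3)[OF R_perm g] by blast
    then have comm1: "conjby f (finv g) \<circ> h = h \<circ> conjby f (finv g)" using R_commute[OF inc] h by blast
    have cM: "conjby k f \<in> M" if "k \<in> R v" for k
    proof -
      have "k \<in> G" using that R_G by blast
      then have "conjby k f = comm (conjby k b) (conjby k c)" unfolding f_def using conjby_comm[OF G _ cG(2,1)] by blast
      then show ?thesis using M(2) normal[OF that b(1)] normal[OF that c(1)] by metis
    qed
    let ?c = "comm g f"
    have "?c \<in> M" unfolding comm_conjby using perm_groupD(3,4)[OF M(1)] cM[OF gv(1)] fM by blast
    \<comment> \<open>Conjugating \<open>conjby g f \<circ> finv f\<close> by \<open>h\<close> gives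
      two conjugates of \<open>f\<close>, by \<open>h \<circ> g\<close> and by \<open>h\<close>,
      both covered by \<open>cM\<close>.\<close>
    moreover have "conjby h ?c \<in> M"
    proof -
      have "conjby h ?c = conjby (h \<circ> g) f \<circ> finv (conjby h f)"
        unfolding comm_conjby conjby_comp[OF G gG(2)] conjby_conjby[OF G gG(2,1)] conjby_inv[OF G gG(2) fG] ..
      then show ?thesis
        using perm_groupD(3,4)[OF M(1)] cM[OF gv(2)] cM[OF perm_groupD(4)[OF R_perm gv(2,1)]] by metis
    qed
    moreover have "comm ?c h = ?c \<circ> finv (conjby h ?c)"
    proof -
      have cc: "?c \<in> G" using comm_in[OF G gG(1) fG] .
      have "finv (conjby h ?c) = conjby h (finv ?c)" using conjby_inv[OF G gG(2) cc] ..
      then show ?thesis unfolding comm_def[of "comm g f" h] conjby_def by (simp only: comp_assoc)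
    qed
    ultimately have "comm ?c h \<in> M" using perm_groupD(3,4)[OF M(1)] by metis
    then show ?thesis using double_commutator[OF G gG fG comm1] by metis
  qed
  moreover have "n \<le> m" using m1(1) unfolding m_def by simp
  ultimately show ?thesis by blast
qed

end

section \<open>Branch groups acting by homeomorphisms of bounded type\<close>

locale branch_action = nontrivial_branch_tree T G + tame_action X G \<rho> E
  for T :: "'a list set" and G :: "('a list \<Rightarrow> 'a list) set"
    and X :: "'x topology" and \<rho> :: "('a list \<Rightarrow> 'a list) \<Rightarrow> 'x \<Rightarrow> 'x" and E
begin

definition Z :: "'a list \<Rightarrow> 'x set" where
  "Z u = X closure_of {x\<in>topspace X. \<exists>g\<in>R u. \<exists>h\<in>R u. \<rho> (comm g h) x \<noteq> x}"

text \<open>Asking for descendants on every level, and not just for \<open>y\<close> in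
  \<open>Z v\<close>, is what lets the property pass to a descendant in
  \<open>deep_descend\<close>.\<close>

definition deep :: "'a list \<Rightarrow> 'x \<Rightarrow> bool" where
  "deep v y \<longleftrightarrow> (\<forall>m\<ge>length v. \<exists>u\<in>lev m. prefix v u \<and> y \<in> Z u)"

lemma Z_mono: "prefix v u \<Longrightarrow> Z u \<subseteq> Z v"
  unfolding Z_def by (rule closure_of_mono) (use R_mono[of v u] in blast)

text \<open>With \<open>M\<close> the elements that are trivial on \<open>U\<close>,
  \<open>rist_derived_le\<close> makes all commutators of \<open>R e\<close> trivial on
  \<open>U\<close> for every \<open>e\<close> below \<open>v\<close> on some level. Then
  \<open>U\<close> separates \<open>y\<close> from the points moved by them.\<close>

lemma not_deep_if_fixed:
  assumes v: "v \<in> lev n" "n \<ge> 1" and B: "B \<subseteq> R v" "perm_group B" "finite_index B (R v)"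
    and normal: "\<And>k b. k \<in> R v \<Longrightarrow> b \<in> B \<Longrightarrow> conjby k b \<in> B"
    and U: "openin X U" "y \<in> U"
    and fix1: "\<And>b b' z. b \<in> B \<Longrightarrow> b' \<in> B \<Longrightarrow> z \<in> U \<Longrightarrow> \<rho> (comm b b') z = z"
  shows "\<not> deep v y"
proof
  assume d: "deep v y"
  define M where "M = {g\<in>G. \<forall>z\<in>U. \<rho> g z = z}"
  have M: "perm_group M" unfolding M_def by (rule perm_group_stab[OF G act])
  have "comm b b' \<in> M" if "b \<in> B" "b' \<in> B" for b b'
  proof -
    have "b \<in> G" "b' \<in> G" using that B(1) R_G by blast+
    then have "comm b b' \<in> G" by (rule comm_in[OF G])
    then show ?thesis unfolding M_def using fix1[OF that] by simp
  qed
  then obtain m where m: "m \<ge> n" "\<And>e g h. e \<in> lev m \<Longrightarrow> prefix v e \<Longrightarrow> g \<in> R e \<Longrightarrow> h \<in> R e \<Longrightarrow> comm g h \<in> M"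
    using rist_derived_le[OF v B normal M] by blast
  have "length v \<le> m" using m(1) v(1) unfolding lev_def by simp
  then obtain e where e: "e \<in> lev m" "prefix v e" "y \<in> Z e" using d unfolding deep_def by blast
  then have "\<exists>x. x \<in> {x\<in>topspace X. \<exists>g\<in>R e. \<exists>h\<in>R e. \<rho> (comm g h) x \<noteq> x} \<and> x \<in> U"
    using U unfolding Z_def in_closure_of by meson
  then obtain x where x: "x \<in> U" "\<exists>g\<in>R e. \<exists>h\<in>R e. \<rho> (comm g h) x \<noteq> x" by blast
  then show False using m(2)[OF e(1,2)] unfolding M_def by blast
qed

lemma infinite_orbit_if_deep:
  assumes v: "v \<in> lev n" "n \<ge> 1" and y: "y \<in> topspace X" and d: "deep v y"
  shows "infinite (orb \<rho> (R v) y)"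
proof
  assume fin: "finite (orb \<rho> (R v) y)"
  obtain S where S: "gens S (R v)" using R_gens[OF v] by blast
  obtain B U where B: "openin X U" "y \<in> U" "B \<subseteq> R v" "perm_group B" "finite_index B (R v)"
    and normal: "\<And>k b. k \<in> R v \<Longrightarrow> b \<in> B \<Longrightarrow> k \<circ> b \<circ> finv k \<in> B"
    and fix1: "\<And>b z. b \<in> B \<Longrightarrow> z \<in> U \<Longrightarrow> \<rho> b z = z"
    using finite_index_germ_kernel[OF R_G R_perm S y fin] by metis
  have "\<not> deep v y"
    by (rule not_deep_if_fixed[OF v B(3-5) normal[folded conjby_def] B(1,2)])
      (use fix1 comm_in[OF B(4)] in blast)+
  then show False using d by blast
qed

text \<open>\<open>B\<close> is the kernel of the action of \<open>R u\<close> on the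
  \<open>R u1\<close>-orbits near \<open>y\<close> and their translates. Translates are included to
  make \<open>B\<close> normal, and because \<open>not_deep_if_two_infinite\<close> evaluates
  elements of \<open>B\<close> at a translate of \<open>z\<close> that may leave
  \<open>U\<close>.\<close>

lemma orbits_preserved:
  assumes u: "u \<in> lev n" "n \<ge> 1" and u1: "u1 \<in> lev n1" "n1 \<ge> 1"
    and inc: "\<not> prefix u u1" "\<not> prefix u1 u"
    and y: "y \<in> topspace X" and inf: "infinite (orb \<rho> (R u1) y)"
  shows "\<exists>U B. openin X U \<and> y \<in> U \<and> B \<subseteq> R u \<and> perm_group B \<and> finite_index B (R u) \<and>
    (\<forall>k\<in>R u. \<forall>b\<in>B. conjby k b \<in> B) \<and>
    (\<forall>z\<in>U. \<forall>k\<in>R u. \<forall>b\<in>B. \<rho> b (\<rho> k z) \<in> orb \<rho> (R u1) (\<rho> k z))"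
proof -
  let ?\<beta> = "\<lambda>k W. \<rho> k ` W"
  obtain S where S: "gens S (R u)" using R_gens[OF u] by blast
  obtain S1 where S1: "gens S1 (R u1)" using R_gens[OF u1] by blast
  have c: "k \<circ> l = l \<circ> k" if "k \<in> R u" "l \<in> R u1" for k l using R_commute[OF inc that] .
  obtain U m where U: "openin X U" "y \<in> U"
    "\<And>z. z \<in> U \<Longrightarrow> finite (orb ?\<beta> (R u) (orb \<rho> (R u1) z)) \<and> card (orb ?\<beta> (R u) (orb \<rho> (R u1) z)) \<le> m"
    using bounded_orbits_on_quotient[OF R_G R_perm S R_G R_perm S1 c y inf] by blast
  have aR: "acts (R u) ?\<beta>" using acts_image[OF acts_mono[OF act R_G]] .
  define \<Omega> where "\<Omega> = (\<Union>z\<in>U. orb ?\<beta> (R u) (orb \<rho> (R u1) z))"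
  have orb_sub: "orb ?\<beta> (R u) \<omega> \<subseteq> orb ?\<beta> (R u) W" if \<omega>: "\<omega> \<in> orb ?\<beta> (R u) W" for \<omega> W
  proof -
    obtain k' where k': "k' \<in> R u" "\<omega> = ?\<beta> k' W" using \<omega> unfolding orb_def by blast
    have "?\<beta> k \<omega> = ?\<beta> (k \<circ> k') W" "k \<circ> k' \<in> R u" if "k \<in> R u" for k
      using actsD(2)[OF aR that k'(1), of W] k'(2) perm_groupD(4)[OF R_perm that k'(1)] by simp_all
    then show ?thesis unfolding orb_def by blast
  qed
  have inv\<Omega>: "?\<beta> k \<omega> \<in> \<Omega>" if "k \<in> R u" "\<omega> \<in> \<Omega>" for k \<omega>
  proof -
    have "?\<beta> k \<omega> \<in> orb ?\<beta> (R u) \<omega>" unfolding orb_def[of ?\<beta> _ \<omega>] using that(1) by blast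
    then show ?thesis using orb_sub that(2) unfolding \<Omega>_def by blast
  qed
  define B where "B = {k\<in>R u. \<forall>\<omega>\<in>\<Omega>. ?\<beta> k \<omega> = \<omega>}"
  have "finite_index B (R u)"
    unfolding B_def
  proof (rule finite_index_kernel[OF R_perm S aR, where m = m])
    fix \<omega> assume "\<omega> \<in> \<Omega>"
    then obtain z where z: "z \<in> U" "\<omega> \<in> orb ?\<beta> (R u) (orb \<rho> (R u1) z)" unfolding \<Omega>_def by blast
    show "finite (orb ?\<beta> (R u) \<omega>) \<and> card (orb ?\<beta> (R u) \<omega>) \<le> m"
      using U(3)[OF z(1)] orb_sub[OF z(2)] by (meson card_mono finite_subset le_trans)
  qed
  moreover have "perm_group B" unfolding B_def by (rule perm_group_stab[OF R_perm aR])
  moreover have "conjby k b \<in> B" if "k \<in> R u" "b \<in> B" for k b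
    unfolding B_def conjby_def by (rule kernel_normal[OF R_perm aR _ that(1) that(2)[unfolded B_def]]) (rule inv\<Omega>)
  moreover have "\<rho> b (\<rho> k z) \<in> orb \<rho> (R u1) (\<rho> k z)" if z: "z \<in> U" and k: "k \<in> R u" and b: "b \<in> B" for z k b
  proof -
    have "\<rho> k ` orb \<rho> (R u1) z = orb \<rho> (R u1) (\<rho> k z)"
      using orb_commute[OF R_G _ c[OF k]] k R_G by blast
    then have "orb \<rho> (R u1) (\<rho> k z) \<in> \<Omega>"
      unfolding \<Omega>_def orb_def[of ?\<beta>] using z k by blast
    then have "?\<beta> b (orb \<rho> (R u1) (\<rho> k z)) = orb \<rho> (R u1) (\<rho> k z)" using b unfolding B_def by blast
    then show ?thesis using orb_self[OF R_perm, of "\<rho> k z" u1] by blast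
  qed
  moreover have "B \<subseteq> R u" unfolding B_def by blast
  ultimately show ?thesis using U(1,2) by metis
qed

text \<open>The elements of a finite index subgroup of \<^term>\<open>R u\<close> act on points near \<^term>\<open>y\<close> both like
  elements of \<^term>\<open>R u1\<close> and like elements of \<^term>\<open>R u2\<close>. As these two groups commute with each
  other and with \<^term>\<open>R u\<close>, the action is commutative.\<close>
lemma not_deep_if_two_infinite:
  assumes u: "u \<in> lev n" "n \<ge> 1" and u1: "u1 \<in> lev n1" "n1 \<ge> 1" and u2: "u2 \<in> lev n2" "n2 \<ge> 1"
    and inc1: "\<not> prefix u u1" "\<not> prefix u1 u" and inc2: "\<not> prefix u u2" "\<not> prefix u2 u"
    and inc: "\<not> prefix u1 u2" "\<not> prefix u2 u1"
    and y: "y \<in> topspace X" and inf: "infinite (orb \<rho> (R u1) y)" "infinite (orb \<rho> (R u2) y)"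
  shows "\<not> deep u y"
proof -
  obtain U1 B1 where B1: "openin X U1" "y \<in> U1" "B1 \<subseteq> R u" "perm_group B1" "finite_index B1 (R u)"
    "\<And>k b. k \<in> R u \<Longrightarrow> b \<in> B1 \<Longrightarrow> conjby k b \<in> B1"
    "\<And>z k b. z \<in> U1 \<Longrightarrow> k \<in> R u \<Longrightarrow> b \<in> B1 \<Longrightarrow> \<rho> b (\<rho> k z) \<in> orb \<rho> (R u1) (\<rho> k z)"
    using orbits_preserved[OF u u1 inc1 y inf(1)] by metis
  obtain U2 B2 where B2: "openin X U2" "y \<in> U2" "B2 \<subseteq> R u" "perm_group B2" "finite_index B2 (R u)"
    "\<And>k b. k \<in> R u \<Longrightarrow> b \<in> B2 \<Longrightarrow> conjby k b \<in> B2"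
    "\<And>z k b. z \<in> U2 \<Longrightarrow> k \<in> R u \<Longrightarrow> b \<in> B2 \<Longrightarrow> \<rho> b (\<rho> k z) \<in> orb \<rho> (R u2) (\<rho> k z)"
    using orbits_preserved[OF u u2 inc2 y inf(2)] by metis
  have swap: "\<rho> k (\<rho> l x) = \<rho> l (\<rho> k x)" if "k \<circ> l = l \<circ> k" "k \<in> G" "l \<in> G" for k l x
    using actsD(2)[OF act that(2,3), of x] actsD(2)[OF act that(3,2), of x] that(1) by simp
  show ?thesis
  proof (rule not_deep_if_fixed[OF u, of "B1 \<inter> B2" "U1 \<inter> U2"])
    fix b b' z assume b: "b \<in> B1 \<inter> B2" "b' \<in> B1 \<inter> B2" and z: "z \<in> U1 \<inter> U2"
    have bR: "b \<in> R u" "b' \<in> R u" using b B1(3) by auto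
    have bG: "b \<in> G" "b' \<in> G" using bR R_G by auto
    \<comment> \<open>Chosen so that \<open>comm b b'\<close> is
      \<open>b \<circ> b' \<circ> p\<close> while \<open>b' \<circ> b \<circ> p\<close> is
      \<open>id\<close>; it remains to let \<open>b\<close> and \<open>b'\<close> commute at the
      single point \<open>x\<close>.\<close>
    define p where "p = finv b \<circ> finv b'"
    have pR: "p \<in> R u" unfolding p_def using perm_groupD(3,4)[OF R_perm] bR by blast
    have pG: "p \<in> G" using pR R_G by blast
    define x where "x = \<rho> p z"
    obtain l1 where l1: "l1 \<in> R u1" "\<rho> b x = \<rho> l1 x"
      using B1(7)[OF _ pR, of z b] b(1) z unfolding x_def orb_def by auto
    obtain l2 where l2: "l2 \<in> R u2" "\<rho> b' x = \<rho> l2 x"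
      using B2(7)[OF _ pR, of z b'] b(2) z unfolding x_def orb_def by auto
    have lG: "l1 \<in> G" "l2 \<in> G" using l1(1) l2(1) R_G by auto
    \<comment> \<open>At \<open>x\<close>, \<open>b\<close> is replaced by \<open>l1\<close> and
      \<open>b'\<close> by \<open>l2\<close>. Every exchange is then between rigid stabilizers of
      incomparable vertices.\<close>
    have "\<rho> b (\<rho> b' x) = \<rho> l2 (\<rho> b x)"
      unfolding l2(2) by (rule swap[OF R_commute[OF inc2 bR(1) l2(1)] bG(1) lG(2)])
    also have "\<dots> = \<rho> l1 (\<rho> l2 x)"
      unfolding l1(2) by (rule swap[OF R_commute[OF inc l1(1) l2(1)] lG, symmetric])
    also have "\<dots> = \<rho> b' (\<rho> b x)"
      unfolding l2(2)[symmetric] l1(2)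
      by (rule swap[OF R_commute[OF inc1 bR(2) l1(1)] bG(2) lG(1), symmetric])
    finally have eq: "\<rho> b (\<rho> b' x) = \<rho> b' (\<rho> b x)" .
    have "\<rho> (comm b b') z = \<rho> b (\<rho> b' x)"
    proof -
      have "comm b b' = b \<circ> (b' \<circ> p)" unfolding comm_def p_def by (simp only: comp_assoc)
      then show ?thesis
        unfolding x_def using actsD(2)[OF act bG(1) perm_groupD(4)[OF G bG(2) pG], of z]
          actsD(2)[OF act bG(2) pG, of z] by simp
    qed
    also have "\<dots> = \<rho> (b' \<circ> (b \<circ> p)) z"
      unfolding eq unfolding x_def using actsD(2)[OF act bG(2) perm_groupD(4)[OF G bG(1) pG], of z]
        actsD(2)[OF act bG(1) pG, of z] by simp
    also have "b' \<circ> (b \<circ> p) = id"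
      unfolding p_def by (simp only: perm_group_cancel(1)[OF G bG(1)] perm_group_inv_simps(3)[OF G bG(2)])
    finally show "\<rho> (comm b b') z = z" unfolding actsD(1)[OF act] .
  next
    show "finite_index (B1 \<inter> B2) (R u)" using finite_index_Int[OF R_perm B1(4) B2(4) B1(5) B2(5)] .
    show "perm_group (B1 \<inter> B2)" using perm_group_Int[OF B1(4) B2(4)] .
  qed (use B1(1-3,6) B2(1-3,6) in blast)+
qed

section \<open>Deep vertices form a ray\<close>

lemma deep_prefix:
  assumes "deep v y" "n \<le> length v" shows "deep (take n v) y"
  unfolding deep_def
proof (intro allI impI)
  fix m assume m: "length (take n v) \<le> m"
  show "\<exists>u\<in>lev m. prefix (take n v) u \<and> y \<in> Z u"
  proof (cases "length v \<le> m")
    case True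
    then obtain u where "u \<in> lev m" "prefix v u" "y \<in> Z u" using assms(1) unfolding deep_def by blast
    then show ?thesis using take_is_prefix prefix_order.trans by blast
  next
    case False
    obtain u where u: "u \<in> lev (length v)" "prefix v u" "y \<in> Z u" using assms(1) unfolding deep_def by blast
    then have uv: "u = v" using prefix_same_length[of v u u] unfolding lev_def by auto
    have "take m v \<in> lev m" using take_lev[OF u(1)] False unfolding uv by simp
    moreover have "y \<in> Z (take m v)" using Z_mono[OF take_is_prefix] u(3) unfolding uv by blast
    moreover have "prefix (take n v) (take m v)"
      using m False assms(2) prefix_length_prefix[OF take_is_prefix take_is_prefix, of n v m] by simp
    ultimately show ?thesis by blast
  qed
qed

text \<open>A Koenig argument: if each of the finitely many candidates \<open>u\<close> failed on a
  level \<open>f u\<close>, a witness for \<open>v\<close> on a level \<open>M\<close> beyond all of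
  these would have an ancestor contradicting the failure.\<close>

lemma deep_descend:
  assumes v: "v \<in> lev n" "n \<le> m" and d: "deep v y"
  shows "\<exists>u\<in>lev m. prefix v u \<and> deep u y"
proof (rule ccontr)
  assume "\<not> ?thesis"
  then have "\<forall>u. \<exists>m'. u \<in> lev m \<longrightarrow> prefix v u \<longrightarrow> m' \<ge> m \<and> \<not> (\<exists>w\<in>lev m'. prefix u w \<and> y \<in> Z w)"
    unfolding deep_def lev_def by blast
  then obtain f where f: "\<And>u. u \<in> lev m \<Longrightarrow> prefix v u \<Longrightarrow>
      f u \<ge> m \<and> \<not> (\<exists>w\<in>lev (f u). prefix u w \<and> y \<in> Z w)" by metis
  define M where "M = m + (\<Sum>u\<in>lev m. f u)"
  have "length v \<le> M" using v unfolding M_def lev_def by simp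
  then obtain w where w: "w \<in> lev M" "prefix v w" "y \<in> Z w" using d unfolding deep_def by blast
  have u: "take m w \<in> lev m" using take_lev[OF w(1)] unfolding M_def by simp
  have vu: "prefix v (take m w)"
    using prefix_length_prefix[OF w(2) take_is_prefix, of m] u v unfolding lev_def by auto
  have le: "f (take m w) \<le> M" unfolding M_def using member_le_sum[OF u, of f] lev_finite by simp
  have "take (f (take m w)) w \<in> lev (f (take m w))" using take_lev[OF w(1) le] .
  moreover have "prefix (take m w) (take (f (take m w)) w)"
    using prefix_length_prefix[OF take_is_prefix take_is_prefix, of m w "f (take m w)"] f[OF u vu] by (simp add: min_le_iff_disj)
  moreover have "y \<in> Z (take (f (take m w)) w)" using Z_mono[OF take_is_prefix] w(3) by blast
  ultimately show False using f[OF u vu] by blast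
qed

lemma deep_unique:
  assumes v: "v \<in> lev n" and w: "w \<in> lev n" and y: "y \<in> topspace X" and d: "deep v y" "deep w y"
  shows "v = w"
proof (rule ccontr)
  assume ne: "v \<noteq> w"
  then have n: "n \<ge> 1" using v w unfolding lev_def by (cases n) auto
  have len: "length v = n" "length w = n" using v w unfolding lev_def by auto
  have inc: "\<not> prefix v w" "\<not> prefix w v"
    using ne prefix_same_length[of v w w] prefix_same_length[of w v v] len by auto
  have infw: "infinite (orb \<rho> (R w) y)" using infinite_orbit_if_deep[OF w n y d(2)] .
  obtain S where S: "gens S (R v)" using R_gens[OF v n] by blast
  obtain S' where S': "gens S' (R w)" using R_gens[OF w n] by blast
  let ?\<beta> = "\<lambda>k W. \<rho> k ` W" and ?L = "orb \<rho> (R w) y"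
  have aR: "acts (R v) ?\<beta>" using acts_image[OF acts_mono[OF act R_G]] .
  have fin: "finite (orb ?\<beta> (R v) ?L)"
    using bounded_orbits_on_quotient[OF R_G R_perm S R_G R_perm S' R_commute[OF inc] y infw] by blast
  \<comment> \<open>Only the one orbit through \<open>y\<close> has to be preserved here, so a
    stabilizer is enough and no normality is required.\<close>
  define A where "A = {k\<in>R v. ?\<beta> k ?L = ?L}"
  have A: "A \<subseteq> R v" "finite_index A (R v)" "perm_group A"
    unfolding A_def using finite_index_stab[OF R_perm aR fin] perm_group_stab1[OF R_perm aR] by auto
  obtain m where m: "m \<ge> n" "\<And>u. u \<in> lev m \<Longrightarrow> prefix v u \<Longrightarrow> \<exists>a\<in>A. a u \<noteq> u"
    using finite_index_moves[OF v n A(1,2)] by blast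
  obtain u where u: "u \<in> lev m" "prefix v u" "deep u y" using deep_descend[OF v m(1) d(1)] by blast
  have m1: "m \<ge> 1" using m(1) n by simp
  obtain a where a: "a \<in> A" "a u \<noteq> u" using m(2)[OF u(1,2)] by blast
  have aRv: "a \<in> R v" using a(1) A(1) by blast
  have aG: "a \<in> G" using aRv R_G by blast
  have uT: "u \<in> T" using u(1) unfolding lev_def by blast
  have au: "a u \<in> lev m" "prefix v (a u)" using lev_G[OF aG u(1)] R_prefix[OF aRv] u(2) by blast+
  have below: "\<not> prefix x w" "\<not> prefix w x" if "prefix v x" for x
    using inc prefix_same_cases[of w x v] prefix_order.trans[OF that, of w] that by blast+
  have infu: "infinite (orb \<rho> (R u) y)" using infinite_orbit_if_deep[OF u(1) m1 y u(3)] .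
  have "\<rho> (finv a) y \<in> ?L"
  proof -
    have "finv a \<in> A" using perm_groupD(3)[OF A(3) a(1)] .
    then have "?\<beta> (finv a) ?L = ?L" unfolding A_def by blast
    then show ?thesis using orb_self[OF R_perm, of y w] by blast
  qed
  then obtain l where l: "l \<in> R w" "\<rho> (finv a) y = \<rho> l y" unfolding orb_def by blast
  have lG: "l \<in> G" using l(1) R_G by blast
  have aiG: "finv a \<in> G" using perm_groupD(3)[OF G aG] .
  \<comment> \<open>As \<open>a\<close> preserves the \<open>R w\<close>-orbit of \<open>y\<close>,
    \<open>finv a\<close> acts on \<open>y\<close> like some \<open>l\<close> in \<open>R w\<close>,
    which commutes with \<open>R u\<close>. So the orbit of \<open>y\<close> under
    \<open>R (a u)\<close> is the image of its orbit under \<open>R u\<close> by an injective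
    map.\<close>
  have "\<rho> (conjby a k) y = \<rho> a (\<rho> l (\<rho> k y))" if k: "k \<in> R u" for k
  proof -
    have kG: "k \<in> G" using k R_G by blast
    have "\<rho> (conjby a k) y = \<rho> a (\<rho> k (\<rho> l y))"
      unfolding conjby_def actsD(2)[OF act perm_groupD(4)[OF G aG kG] aiG] actsD(2)[OF act aG kG] l(2) ..
    also have "\<rho> k (\<rho> l y) = \<rho> l (\<rho> k y)"
      using actsD(2)[OF act kG lG, of y] actsD(2)[OF act lG kG, of y]
        R_commute[OF below[OF u(2)] k l(1)] by simp
    finally show ?thesis .
  qed
  then have "orb \<rho> (R (a u)) y = (\<lambda>x. \<rho> a (\<rho> l x)) ` orb \<rho> (R u) y"
    unfolding orb_def R_conj_image[OF aG uT, symmetric] image_image by (intro image_cong) auto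
  moreover have "inj (\<lambda>x. \<rho> a (\<rho> l x))"
    by (rule injI) (simp only: acts_eq_iff[OF G act aG] acts_eq_iff[OF G act lG])
  ultimately have infau: "infinite (orb \<rho> (R (a u)) y)"
    using infu by (metis finite_imageD inj_on_subset subset_UNIV)
  have inc1: "\<not> prefix u (a u)" "\<not> prefix (a u) u"
    using a(2) prefix_same_length[of u "a u" "a u"] prefix_same_length[of "a u" u u] G_length[OF aG, of u] by auto
  have "\<not> deep u y"
    by (rule not_deep_if_two_infinite[OF u(1) m1 au(1) m1 w n inc1 below[OF u(2)] below[OF au(2)] y infau infw])
  then show False using u(3) by blast
qed

lemma Z_equivariant:
  assumes g: "g \<in> G" and u: "u \<in> T" and y: "y \<in> Z u" shows "\<rho> g y \<in> Z (g u)"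
  unfolding Z_def in_closure_of
proof (intro conjI allI impI)
  have yX: "y \<in> topspace X" using y unfolding Z_def in_closure_of by blast
  show "\<rho> g y \<in> topspace X" using in_space[OF g yX] .
  fix V assume V: "\<rho> g y \<in> V \<and> openin X V"
  have "openin X {z\<in>topspace X. \<rho> g z \<in> V}" using open_preimage[OF g] V by blast
  moreover have "y \<in> {z\<in>topspace X. \<rho> g z \<in> V}" using yX V by simp
  ultimately have "\<exists>x. x \<in> {x\<in>topspace X. \<exists>a\<in>R u. \<exists>b\<in>R u. \<rho> (comm a b) x \<noteq> x} \<and> x \<in> {z\<in>topspace X. \<rho> g z \<in> V}"
    using conjunct2[OF y[unfolded Z_def in_closure_of]] by meson
  then obtain x a b where x: "x \<in> topspace X" "\<rho> g x \<in> V" "a \<in> R u" "b \<in> R u" "\<rho> (comm a b) x \<noteq> x"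
    by (elim exE conjE CollectE bexE)
  have aG: "a \<in> G" "b \<in> G" using x(3,4) R_G by auto
  have cG: "comm a b \<in> G" using comm_in[OF G aG] .
  have gi: "finv g \<in> G" using perm_groupD(3)[OF G g] .
  have "\<rho> (comm (conjby g a) (conjby g b)) (\<rho> g x) = \<rho> g (\<rho> (comm a b) (\<rho> (finv g) (\<rho> g x)))"
    unfolding conjby_comm[OF G g aG, symmetric] conjby_def[of g "comm a b"] actsD(2)[OF act perm_groupD(4)[OF G g cG] gi]
      actsD(2)[OF act g cG] ..
  also have "\<dots> \<noteq> \<rho> g x" unfolding acts_inv(2)[OF G act g] acts_eq_iff[OF G act g] by (rule x(5))
  finally show "\<exists>z. z \<in> {x\<in>topspace X. \<exists>a\<in>R (g u). \<exists>b\<in>R (g u). \<rho> (comm a b) x \<noteq> x} \<and> z \<in> V"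
    using x(2) in_space[OF g x(1)] R_conj[OF g u x(3)] R_conj[OF g u x(4)] by blast
qed

lemma deep_equivariant:
  assumes g: "g \<in> G" and v: "v \<in> T" and d: "deep v y" shows "deep (g v) (\<rho> g y)"
  unfolding deep_def
proof (intro allI impI)
  fix m assume "length (g v) \<le> m"
  then have "length v \<le> m" using G_length[OF g] by simp
  then obtain u where u: "u \<in> lev m" "prefix v u" "y \<in> Z u" using d unfolding deep_def by blast
  have uT: "u \<in> T" using u(1) unfolding lev_def by blast
  show "\<exists>u\<in>lev m. prefix (g v) u \<and> \<rho> g y \<in> Z u"
    using lev_G[OF g u(1)] G_prefix[OF g u(2) uT] Z_equivariant[OF g uT u(3)] by blast
qed

text \<open>Finiteness of the levels matters: only finite unions of the closed sets
  \<open>Z u\<close> are certain to be closed.\<close>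

lemma deep_closed: "closedin X {y\<in>topspace X. deep v y}"
proof -
  have "closedin X (\<Union>u\<in>{u\<in>lev m. prefix v u}. Z u)" for m
    using lev_finite[of m] by (intro closedin_Union) (auto simp: Z_def)
  then have "closedin X (\<Inter>m\<in>{length v..}. \<Union>u\<in>{u\<in>lev m. prefix v u}. Z u)"
    by (intro closedin_Inter) auto
  moreover have "Z u \<subseteq> topspace X" for u unfolding Z_def by (rule closure_of_subset_topspace)
  then have "{y\<in>topspace X. deep v y} = (\<Inter>m\<in>{length v..}. \<Union>u\<in>{u\<in>lev m. prefix v u}. Z u)"
    unfolding deep_def by fastforce
  ultimately show ?thesis by simp
qed

section \<open>The map to the boundary\<close>

definition vtx :: "nat \<Rightarrow> 'x \<Rightarrow> 'a list" where
  "vtx n y = (THE v. v \<in> lev n \<and> deep v y)"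

lemma vtx_eq: "y \<in> topspace X \<Longrightarrow> v \<in> lev n \<Longrightarrow> deep v y \<Longrightarrow> vtx n y = v"
  unfolding vtx_def using deep_unique by (intro the_equality) blast+

text \<open>The covering hypothesis makes the root deep; a deep vertex on each level then comes from
  \<open>deep_descend\<close>, its uniqueness from \<open>deep_unique\<close>. Equivariance follows
  from uniqueness, since \<open>g\<close> carries deep vertices of \<open>y\<close> to deep vertices
  of \<open>\<rho> g y\<close>.\<close>

lemma factor_map:
  assumes Y: "Y \<subseteq> topspace X" and cover: "\<And>n. n \<ge> 1 \<Longrightarrow> Y \<subseteq> (\<Union>u\<in>lev n. Z u)"
  shows "\<exists>q. continuous_map (subtopology X Y) (boundary_top T) q \<and>
           (\<forall>g\<in>G. \<forall>y\<in>Y. q (\<rho> g y) = bd_act g (q y))"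
proof -
  have nil: "[] \<in> lev 0" using rooted unfolding lev_def rooted_tree_def by simp
  have dnil: "deep [] y" if "y \<in> Y" for y
    unfolding deep_def
  proof (intro allI impI)
    fix m
    \<comment> \<open>The covering is given from level 1 on, so one level further down is used and
      cut back; this includes \<open>m = 0\<close>.\<close>
    obtain u where u: "u \<in> lev (Suc m)" "y \<in> Z u" using cover[of "Suc m"] \<open>y \<in> Y\<close> by auto
    show "\<exists>u\<in>lev m. prefix [] u \<and> y \<in> Z u"
      using take_lev[OF u(1), of m] Z_mono[OF take_is_prefix[of m u]] u(2) by auto
  qed
  have v: "vtx n y \<in> lev n \<and> deep (vtx n y) y" if "y \<in> Y" for n y
  proof -
    have yX: "y \<in> topspace X" using that Y by blast
    obtain v where v: "v \<in> lev n" "deep v y" using deep_descend[OF nil le0 dnil[OF \<open>y \<in> Y\<close>]] by blast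
    then show ?thesis using vtx_eq[OF yX v] by simp
  qed
  have vtx_take: "take n (vtx m y) = vtx n y" if y: "y \<in> Y" and nm: "n \<le> m" for n m y
  proof -
    have "length (vtx m y) = m" using v[OF y] unfolding lev_def by blast
    then have "deep (take n (vtx m y)) y" using deep_prefix v[OF y] nm by metis
    then show ?thesis using vtx_eq[of y] take_lev[OF _ nm] v[OF y] Y y by (metis subsetD)
  qed
  \<comment> \<open>Coordinate \<open>i\<close> is the last letter of the deep vertex of level
    \<open>Suc i\<close>; by \<open>vtx_take\<close> these letters fit together to one ray.\<close>
  define q where "q y = (\<lambda>i. vtx (Suc i) y ! i)" for y
  have q_map: "map (q y) [0..<n] = vtx n y" if y: "y \<in> Y" for y n
  proof (rule nth_equalityI)
    show len: "length (map (q y) [0..<n]) = length (vtx n y)" using v[OF y, of n] unfolding lev_def by simp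
    fix i assume "i < length (map (q y) [0..<n])"
    then have i: "i < n" by simp
    have "vtx (Suc i) y = take (Suc i) (vtx n y)" using vtx_take[OF y, of "Suc i" n] i by simp
    then show "map (q y) [0..<n] ! i = vtx n y ! i" using i unfolding q_def by simp
  qed
  have top: "topspace (subtopology X Y) = Y" using Y by auto
  have "continuous_map (subtopology X Y) (boundary_top T) q"
    unfolding boundary_top_def continuous_map_in_subtopology continuous_map_componentwise_UNIV
  proof (intro conjI allI)
    show "q \<in> topspace (subtopology X Y) \<rightarrow> boundary T"
      unfolding top boundary_def using q_map v unfolding lev_def by auto
    fix i
    \<comment> \<open>Into a discrete space every preimage must be closed. Each is, on
      \<open>Y\<close>, a finite union of closed sets of points where a given vertex is
      deep.\<close>
    show "continuous_map (subtopology X Y) (discrete_topology UNIV) (\<lambda>y. q y i)"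
      unfolding continuous_map_closedin
    proof (intro conjI allI impI)
      fix C :: "'a set"
      have "{y\<in>topspace (subtopology X Y). q y i \<in> C} =
          Y \<inter> (\<Union>u\<in>{u\<in>lev (Suc i). u ! i \<in> C}. {y\<in>topspace X. deep u y})"
      proof (intro equalityI subsetI)
        fix y assume y: "y \<in> {y\<in>topspace (subtopology X Y). q y i \<in> C}"
        then have "y \<in> Y" "y \<in> topspace X" using Y unfolding top by auto
        then show "y \<in> Y \<inter> (\<Union>u\<in>{u\<in>lev (Suc i). u ! i \<in> C}. {y\<in>topspace X. deep u y})"
          using v[of y "Suc i"] y unfolding q_def by auto
      next
        fix y assume y: "y \<in> Y \<inter> (\<Union>u\<in>{u\<in>lev (Suc i). u ! i \<in> C}. {y\<in>topspace X. deep u y})"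
        then obtain u where u: "u \<in> lev (Suc i)" "u ! i \<in> C" "y \<in> topspace X" "deep u y" "y \<in> Y" by blast
        then show "y \<in> {y\<in>topspace (subtopology X Y). q y i \<in> C}"
          using vtx_eq[OF u(3,1,4)] unfolding top q_def by simp
      qed
      moreover have "closedin X (\<Union>u\<in>{u\<in>lev (Suc i). u ! i \<in> C}. {y\<in>topspace X. deep u y})"
        using lev_finite[of "Suc i"] deep_closed by (intro closedin_Union) (auto simp del: Collect_conj_eq)
      ultimately show "closedin (subtopology X Y) {y\<in>topspace (subtopology X Y). q y i \<in> C}"
        by (simp only: closedin_subtopology_Int_closed)
    qed auto
  qed
  moreover have "q (\<rho> g y) = bd_act g (q y)" if g: "g \<in> G" and y: "y \<in> Y" for g y
  proof
    fix i
    have "vtx (Suc i) (\<rho> g y) = g (vtx (Suc i) y)"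
    proof (rule vtx_eq)
      show "\<rho> g y \<in> topspace X" using in_space[OF g] y Y by blast
      show "g (vtx (Suc i) y) \<in> lev (Suc i)" using lev_G[OF g] v[OF y] by blast
      show "deep (g (vtx (Suc i) y)) (\<rho> g y)"
        using deep_equivariant[OF g] v[OF y, of "Suc i"] unfolding lev_def by blast
    qed
    then show "q (\<rho> g y) i = bd_act g (q y) i"
      unfolding bd_act_def q_map[OF y] by (simp add: q_def)
  qed
  ultimately show ?thesis by blast
qed

end

section \<open>Groups of strongly bounded type\<close>

lemma topspace_path_top: "topspace (path_top B) = path_space B"
  unfolding path_top_def by simp

lemma Hausdorff_path_top: "Hausdorff_space (path_top B)"
  unfolding path_top_def
  by (intro Hausdorff_space_subtopology) (simp add: Hausdorff_space_product_topology)

text \<open>The end vertex is read off as the origin of the next edge, which also makes sense for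
  the empty prefix.\<close>

lemma path_prefix_in_fin_paths:
  assumes B: "bratteli_diagram B" and p: "p \<in> path_space B"
  shows "map p [0..<n] \<in> fin_paths B n (Bo B (Suc n) (p n))" "Bo B (Suc n) (p n) \<in> BV B n"
proof -
  have pE: "p i \<in> BE B (Suc i)" "Bt B (Suc i) (p i) = Bo B (Suc (Suc i)) (p (Suc i))" for i
    using p unfolding path_space_def by auto
  have "Bo B (Suc n) ` BE B (Suc n) = BV B n"
    using B unfolding bratteli_diagram_def by (metis diff_Suc_1 le_add1 plus_1_eq_Suc)
  then show v: "Bo B (Suc n) (p n) \<in> BV B n" using pE(1)[of n] by blast
  have "Bt B n (p (n - 1)) = Bo B (Suc n) (p n)" if "n \<ge> 1" using pE(2)[of "n - 1"] that by simp
  then show "map p [0..<n] \<in> fin_paths B n (Bo B (Suc n) (p n))"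
    unfolding fin_paths_def using v pE by auto
qed

lemma path_in_cyl: "p \<in> path_space B \<Longrightarrow> p \<in> cyl B n (Bo B (Suc n) (p n)) (map p [0..<n])"
  unfolding cyl_def by auto

lemma finite_fin_paths:
  assumes "bratteli_diagram B" shows "finite (fin_paths B n v)"
proof (rule finite_subset)
  have "finite (BE B (Suc i))" for i using assms unfolding bratteli_diagram_def by simp
  then show "finite {xs. set xs \<subseteq> (\<Union>i<n. BE B (Suc i)) \<and> length xs = n}"
    by (intro finite_lists_length_eq) auto
  show "fin_paths B n v \<subseteq> {xs. set xs \<subseteq> (\<Union>i<n. BE B (Suc i)) \<and> length xs = n}"
  proof
    fix xs assume "xs \<in> fin_paths B n v"
    then have xs: "length xs = n" "\<And>i. i < n \<Longrightarrow> xs ! i \<in> BE B (Suc i)" unfolding fin_paths_def by auto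
    have "set xs \<subseteq> (\<Union>i<n. BE B (Suc i))"
    proof
      fix e assume "e \<in> set xs"
      then obtain i where "i < n" "e = xs ! i" using xs(1) by (metis in_set_conv_nth)
      then show "e \<in> (\<Union>i<n. BE B (Suc i))" using xs(2) by blast
    qed
    then show "xs \<in> {xs. set xs \<subseteq> (\<Union>i<n. BE B (Suc i)) \<and> length xs = n}" using xs(1) by blast
  qed
qed

text \<open>Injectivity holds on the whole type because elements of \<open>H\<close> are the
  identity outside the space.\<close>

lemma homeo_group_subgroup:
  assumes "subgroup H (homeo_group X)"
  shows "h \<in> H \<Longrightarrow> homeomorphic_map X X h" "h \<in> H \<Longrightarrow> x \<notin> topspace X \<Longrightarrow> h x = x"
    "h \<in> H \<Longrightarrow> h' \<in> H \<Longrightarrow> h \<circ> h' \<in> H" "h \<in> H \<Longrightarrow> inj h"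
proof -
  show h: "homeomorphic_map X X h" "x \<notin> topspace X \<Longrightarrow> h x = x" if "h \<in> H" for h x
    using subgroup.subset[OF assms] that unfolding homeo_group_def fun_group_def by auto
  show "h \<in> H \<Longrightarrow> h' \<in> H \<Longrightarrow> h \<circ> h' \<in> H"
    using subgroup.m_closed[OF assms, of h h'] by (simp add: homeo_group_def fun_group_def)
  show "inj h" if hH: "h \<in> H"
  proof (rule injI)
    fix x y assume e: "h x = h y"
    have "inj_on h (topspace X)" "h ` topspace X = topspace X"
      using h(1)[OF hH] homeomorphic_imp_injective_map homeomorphic_imp_surjective_map by blast+
    moreover from this have "h z \<in> topspace X \<longleftrightarrow> z \<in> topspace X" for z
      using h(2)[OF hH, of z] by (metis image_eqI)
    ultimately show "x = y" using e h(2)[OF hH] by (metis inj_onD)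
  qed
qed

lemma conj_map_comp:
  assumes "homeomorphic_maps X (path_top B) \<phi> \<psi>" "\<And>x. x \<in> topspace X \<Longrightarrow> h' x \<in> topspace X"
  shows "conj_map B \<phi> \<psi> (h \<circ> h') = conj_map B \<phi> \<psi> h \<circ> conj_map B \<phi> \<psi> h'"
proof
  fix p
  have "\<psi> p \<in> topspace X" if "p \<in> path_space B"
    using assms(1) that unfolding homeomorphic_maps_def continuous_map_def topspace_path_top by auto
  moreover have "\<phi> x \<in> path_space B" "\<psi> (\<phi> x) = x" if "x \<in> topspace X" for x
    using assms(1) that unfolding homeomorphic_maps_def continuous_map_def topspace_path_top by auto
  ultimately show "conj_map B \<phi> \<psi> (h \<circ> h') p = (conj_map B \<phi> \<psi> h \<circ> conj_map B \<phi> \<psi> h') p"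
    unfolding conj_map_def using assms(2) by auto
qed

text \<open>A finitely generated group of germs embeds into a locally finite group, so it is finite.\<close>
lemma finite_index_germ_stab:
  fixes P :: "'p topology" and \<tau> :: "('b \<Rightarrow> 'b) \<Rightarrow> 'p \<Rightarrow> 'p"
  assumes lf: "locally_finite_group (fun_group (stab P H p) Mod germ_stab P H p)"
    and H: "\<And>h h'. h \<in> H \<Longrightarrow> h' \<in> H \<Longrightarrow> h \<circ> h' \<in> H"
      "\<And>h. h \<in> H \<Longrightarrow> continuous_map P P h"
    and K: "perm_group K" "gens S K" and p: "p \<in> topspace P"
    and \<tau>: "\<And>k. k \<in> K \<Longrightarrow> \<tau> k \<in> H" "\<And>k. k \<in> K \<Longrightarrow> \<tau> k p = p" "\<tau> id = id"
      "\<And>k k'. k \<in> K \<Longrightarrow> k' \<in> K \<Longrightarrow> \<tau> (k \<circ> k') = \<tau> k \<circ> \<tau> k'"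
  shows "finite_index {k\<in>K. \<exists>U. openin P U \<and> p \<in> U \<and> (\<forall>z\<in>U. \<tau> k z = z)} K"
proof -
  let ?S = "stab P H p" and ?N = "germ_stab P H p"
  let ?M = "fun_group ?S Mod ?N"
  have idK: "id \<in> K" using perm_groupD(1)[OF K(1)] .
  have \<tau>S: "\<tau> k \<in> ?S" if "k \<in> K" for k using \<tau>(1,2)[OF that] unfolding stab_def by blast
  have cos: "?N #>\<^bsub>fun_group ?S\<^esub> f = (\<lambda>n. n \<circ> f) ` ?N" for f
    unfolding r_coset_def fun_group_def by auto
  have idN: "id \<in> ?N"
  proof -
    have "id \<in> H" using \<tau>(1)[OF idK] \<tau>(3) by simp
    then show ?thesis unfolding germ_stab_def using p openin_topspace[of P]
      by (intro CollectI conjI exI[of _ "topspace P"]) simp_all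
  qed
  define c where "c k = ?N #>\<^bsub>fun_group ?S\<^esub> \<tau> k" for k
  have c_iff: "f \<in> c k \<longleftrightarrow> (\<exists>n\<in>?N. f = n \<circ> \<tau> k)" for f k unfolding c_def cos by blast
  have step: "c s \<otimes>\<^bsub>?M\<^esub> c k = c (s \<circ> k)" if s: "s \<in> K" and k: "k \<in> K" for s k
  proof -
    have si: "finv s \<in> K" using perm_groupD(3)[OF K(1) s] .
    have si2: "\<tau> s \<circ> \<tau> (finv s) = id" "\<tau> (finv s) \<circ> \<tau> s = id"
      using \<tau>(3) \<tau>(4)[OF s si] \<tau>(4)[OF si s] perm_group_inv_simps(3,4)[OF K(1) s] by simp_all
    have "c s \<otimes>\<^bsub>?M\<^esub> c k = {f \<circ> f' | f f'. f \<in> c s \<and> f' \<in> c k}"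
      unfolding FactGroup_def set_mult_def fun_group_def by auto
    also have "\<dots> = c (s \<circ> k)"
    proof (intro equalityI subsetI)
      fix f assume "f \<in> {f \<circ> f' | f f'. f \<in> c s \<and> f' \<in> c k}"
      then obtain f1 f2 where f12: "f1 \<in> c s" "f2 \<in> c k" "f = f1 \<circ> f2" by blast
      obtain n n' where n': "n \<in> ?N" "n' \<in> ?N" "f1 = n \<circ> \<tau> s" "f2 = n' \<circ> \<tau> k"
        using f12(1,2) c_iff by blast
      then have n: "n \<in> ?N" "n' \<in> ?N" "f = n \<circ> \<tau> s \<circ> (n' \<circ> \<tau> k)" using f12(3) by (simp_all only:)
      \<comment> \<open>Moving \<open>n'\<close> past \<open>\<tau> s\<close> conjugates it. The
        result is still trivial near \<open>p\<close>, since \<open>\<tau> (finv s)\<close> fixes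
        \<open>p\<close> and is continuous.\<close>
      define n2 where "n2 = n \<circ> \<tau> s \<circ> (n' \<circ> \<tau> (finv s))"
      have "n2 \<circ> \<tau> (s \<circ> k) = n \<circ> \<tau> s \<circ> (n' \<circ> ((\<tau> (finv s) \<circ> \<tau> s) \<circ> \<tau> k))"
        unfolding n2_def \<tau>(4)[OF s k] by (simp only: comp_assoc)
      then have f: "f = n2 \<circ> \<tau> (s \<circ> k)" unfolding n(3) si2 by (simp only: id_comp)
      obtain U where U: "n \<in> H" "openin P U" "p \<in> U" "\<And>y. y \<in> U \<Longrightarrow> n y = y"
        using n(1) unfolding germ_stab_def by blast
      obtain U' where U': "n' \<in> H" "openin P U'" "p \<in> U'" "\<And>y. y \<in> U' \<Longrightarrow> n' y = y"
        using n(2) unfolding germ_stab_def by blast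
      have "n2 \<in> H" unfolding n2_def by (intro H(1) U(1) U'(1) \<tau>(1) s si)
      moreover have "openin P (U \<inter> {y\<in>topspace P. \<tau> (finv s) y \<in> U'})"
        using H(2)[OF \<tau>(1)[OF si]] U(2) U'(2) by (intro openin_Int openin_continuous_map_preimage[of P P])
      moreover have "p \<in> U \<inter> {y\<in>topspace P. \<tau> (finv s) y \<in> U'}" using U(3) U'(3) p \<tau>(2)[OF si] by simp
      moreover have "n2 y = y" if "y \<in> U \<inter> {y\<in>topspace P. \<tau> (finv s) y \<in> U'}" for y
      proof -
        have "n2 y = n ((\<tau> s \<circ> \<tau> (finv s)) y)" unfolding n2_def using U'(4) that by simp
        then show ?thesis unfolding si2 using U(4) that by simp
      qed
      ultimately have "n2 \<in> ?N" unfolding germ_stab_def by blast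
      then show "f \<in> c (s \<circ> k)" using f c_iff by blast
    next
      fix f assume "f \<in> c (s \<circ> k)"
      then obtain n where n: "n \<in> ?N" "f = n \<circ> \<tau> (s \<circ> k)" using c_iff by blast
      then have "f = (n \<circ> \<tau> s) \<circ> (id \<circ> \<tau> k)" unfolding \<tau>(4)[OF s k] by (simp only: comp_assoc id_comp)
      moreover have "n \<circ> \<tau> s \<in> c s" "id \<circ> \<tau> k \<in> c k" using n(1) idN c_iff by blast+
      ultimately show "f \<in> {f \<circ> f' | f f'. f \<in> c s \<and> f' \<in> c k}" by blast
    qed
    finally show ?thesis .
  qed
  have SK: "s \<in> K" if "s \<in> S" for s using gensD(2)[OF K(2)] that by blast
  have "c ` S \<subseteq> carrier ?M"
    unfolding FactGroup_def RCOSETS_def c_def using SK \<tau>S by (auto simp: fun_group_def)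
  moreover have "finite (c ` S)" using gensD(1)[OF K(2)] by blast
  ultimately have fin: "finite (generate ?M (c ` S))"
    using lf unfolding locally_finite_group_def by blast
  \<comment> \<open>\<open>S\<close> is closed under inverses, so products of the cosets
    \<open>c s\<close> suffice, and inverses in the quotient never have to be identified.\<close>
  have "c k \<in> generate ?M (c ` S)" if "k \<in> K" for k
    using K(2) that
  proof (induct rule: gens_induct)
    case id
    have "c id = \<one>\<^bsub>?M\<^esub>" unfolding c_def cos \<tau>(3) FactGroup_def by simp
    then show ?case using generate.one[of ?M "c ` S"] by (simp only:)
  next
    case (step s k)
    have "c s \<in> generate ?M (c ` S)" using step(1) by (intro generate.incl imageI)
    then have "c s \<otimes>\<^bsub>?M\<^esub> c k \<in> generate ?M (c ` S)" using step(3) by (rule generate.eng)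
    then show ?case unfolding \<open>\<And>s k. s \<in> K \<Longrightarrow> k \<in> K \<Longrightarrow> c s \<otimes>\<^bsub>?M\<^esub> c k = c (s \<circ> k)\<close>[OF SK[OF step(1)] step(2)] .
  qed (rule K(1))
  then have fin2: "finite (c ` K)" using fin by (meson finite_subset image_subsetI)
  show ?thesis
  proof (rule finite_indexI[OF fin2])
    fix k k' assume k: "k \<in> K" "k' \<in> K" "c k = c k'"
    have "\<tau> k' \<in> c k'" using idN c_iff by (metis id_comp)
    then obtain n where n: "n \<in> ?N" "\<tau> k' = n \<circ> \<tau> k" using k(3) c_iff by blast
    obtain U where U: "openin P U" "p \<in> U" "\<And>y. y \<in> U \<Longrightarrow> n y = y"
      using n(1) unfolding germ_stab_def by blast
    have ki: "finv k \<in> K" using perm_groupD(3)[OF K(1) k(1)] .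
    let ?V = "{y\<in>topspace P. \<tau> k y \<in> U}"
    have "openin P ?V" using H(2)[OF \<tau>(1)[OF k(1)]] U(1) by (rule openin_continuous_map_preimage)
    moreover have "p \<in> ?V" using p U(2) \<tau>(2)[OF k(1)] by simp
    moreover have "\<tau> (finv k \<circ> k') y = y" if "y \<in> ?V" for y
    proof -
      have "\<tau> k' y = \<tau> k y" unfolding n(2) using U(3) that by simp
      then have "\<tau> (finv k \<circ> k') y = \<tau> (finv k \<circ> k) y"
        unfolding \<tau>(4)[OF ki k(2)] \<tau>(4)[OF ki k(1)] by simp
      then show ?thesis unfolding perm_group_inv_simps(4)[OF K(1) k(1)] \<tau>(3) by simp
    qed
    ultimately show "finv k \<circ> k' \<in> {k\<in>K. \<exists>U. openin P U \<and> p \<in> U \<and> (\<forall>z\<in>U. \<tau> k z = z)}"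
      using perm_groupD(4)[OF K(1) ki k(2)] by blast
  qed
qed

text \<open>Prefix replacements leave tails alone. So with tail equivalence for \<open>E\<close>,
  finitely many singularities give \<open>sing\<close>, the bound on \<open>A_count\<close> gives
  \<open>bdd\<close>, and locally finite isotropy groups give \<open>iso\<close>.\<close>

lemma tame_action_if_strongly_bounded_type:
  fixes X :: "'x topology" and \<rho> :: "('b \<Rightarrow> 'b) \<Rightarrow> 'x \<Rightarrow> 'x"
  assumes G: "perm_group G" and sH: "subgroup H (homeo_group X)" and sbt: "strongly_bounded_type X H"
    and hom: "\<rho> \<in> hom (fun_group G) (fun_group H)"
  shows "\<exists>E. tame_action X G \<rho> E"
proof -
  obtain B \<phi> \<psi> where B: "bratteli_diagram B" and hm: "homeomorphic_maps X (path_top B) \<phi> \<psi>"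
    and sb: "strongly_bounded_type_B B (conj_map B \<phi> \<psi> ` H)"
    using sbt unfolding strongly_bounded_type_def by blast
  \<comment> \<open>Index \<open>i\<close> carries the edge of level \<open>Suc i\<close>, so
    exactly the first \<open>n\<close> edges are left free, as in
    \<open>prefix_repl n\<close>.\<close>
  define E where "E n x y \<longleftrightarrow> (\<forall>i\<ge>n. \<phi> x i = \<phi> y i)" for n x y
  note H = homeo_group_subgroup[OF sH]
  have \<rho>H: "\<rho> g \<in> H" if "g \<in> G" for g using hom that unfolding hom_def fun_group_def by auto
  have \<rho>c: "\<rho> (g \<circ> h) = \<rho> g \<circ> \<rho> h" if "g \<in> G" "h \<in> G" for g h
    using hom that unfolding hom_def fun_group_def by simp
  have \<rho>id: "\<rho> id = id"
  proof
    fix x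
    \<comment> \<open>An idempotent injective map is the identity.\<close>
    have "\<rho> id (\<rho> id x) = \<rho> id x"
      using \<rho>c[OF perm_groupD(1)[OF G] perm_groupD(1)[OF G]] by (metis comp_apply comp_id)
    then show "\<rho> id x = id x" using H(4)[OF \<rho>H[OF perm_groupD(1)[OF G]]] by (simp only: inj_eq id_apply)
  qed
  have act: "acts G \<rho>" unfolding acts_def using \<rho>id \<rho>c by (metis comp_apply id_apply)
  have cont: "continuous_map X X (\<rho> g)" if "g \<in> G" for g
    using homeomorphic_imp_continuous_map[OF H(1)[OF \<rho>H[OF that]]] .
  have \<rho>X: "\<rho> g x \<in> topspace X" if "g \<in> G" "x \<in> topspace X" for g x
    using cont[OF that(1)] that(2) unfolding continuous_map_def by auto
  have \<phi>P: "\<phi> x \<in> path_space B" and \<psi>\<phi>: "\<psi> (\<phi> x) = x" if "x \<in> topspace X" for x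
    using hm that unfolding homeomorphic_maps_def continuous_map_def topspace_path_top by auto
  have \<phi>inj: "x = y" if "x \<in> topspace X" "y \<in> topspace X" "\<phi> x = \<phi> y" for x y
    using \<psi>\<phi>[OF that(1)] \<psi>\<phi>[OF that(2)] that(3) by metis
  have \<phi>open: "openin X {z\<in>topspace X. \<phi> z \<in> U}" if "openin (path_top B) U" for U
    using hm that unfolding homeomorphic_maps_def continuous_map_def by blast
  define \<tau> where "\<tau> g = conj_map B \<phi> \<psi> (\<rho> g)" for g
  have \<tau>\<phi>: "\<tau> g (\<phi> x) = \<phi> (\<rho> g x)" if "x \<in> topspace X" for g x
    unfolding \<tau>_def conj_map_def using \<phi>P[OF that] \<psi>\<phi>[OF that] by simp
  have bt: "bounded_type B (\<tau> g)" if "g \<in> G" for g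
    using sb \<rho>H[OF that] unfolding strongly_bounded_type_B_def \<tau>_def by blast
  \<comment> \<open>With the tail prescribed, the first \<open>n\<close> edges determine the point,
    so counting points of a tail class becomes counting finite paths.\<close>
  have prefix_inj: "inj_on (\<lambda>p. map (\<phi> p) [0..<n]) {p\<in>topspace X. E n x p}" for n x
  proof (rule inj_onI)
    fix p p' assume p: "p \<in> {p\<in>topspace X. E n x p}" "p' \<in> {p\<in>topspace X. E n x p}"
      and e: "map (\<phi> p) [0..<n] = map (\<phi> p') [0..<n]"
    have "\<phi> p i = \<phi> p' i" for i
      using p e unfolding E_def by (cases "i < n") auto
    then show "p = p'" using \<phi>inj p by blast
  qed
  have E_cyl: "\<phi> p \<in> cyl B n (Bo B (Suc n) (\<phi> x n)) (map (\<phi> p) [0..<n])"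
    "map (\<phi> p) [0..<n] \<in> fin_paths B n (Bo B (Suc n) (\<phi> x n))"
    if "p \<in> topspace X" "E n x p" for n x p
  proof -
    have "\<phi> x n = \<phi> p n" using that(2) unfolding E_def by simp
    then show "\<phi> p \<in> cyl B n (Bo B (Suc n) (\<phi> x n)) (map (\<phi> p) [0..<n])"
      "map (\<phi> p) [0..<n] \<in> fin_paths B n (Bo B (Suc n) (\<phi> x n))"
      using path_in_cyl[OF \<phi>P[OF that(1)], of n] path_prefix_in_fin_paths(1)[OF B \<phi>P[OF that(1)], of n] by simp_all
  qed
  have "tame_action X G \<rho> E"
  proof
    show "Hausdorff_space X"
      using Hausdorff_path_top homeomorphic_Hausdorff_space hm homeomorphic_space_def by metis
    fix n
    show "\<exists>m. \<forall>x\<in>topspace X. finite {p\<in>topspace X. E n x p} \<and> card {p\<in>topspace X. E n x p} \<le> m"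
    proof (intro exI ballI)
      fix x assume x: "x \<in> topspace X"
      define W where "W = (\<Union>v\<in>BV B n. fin_paths B n v)"
      have "finite (BV B n)" using B unfolding bratteli_diagram_def by blast
      then have W: "finite W" unfolding W_def using finite_fin_paths[OF B] by blast
      have "(\<lambda>p. map (\<phi> p) [0..<n]) ` {p\<in>topspace X. E n x p} \<subseteq> W"
        unfolding W_def using E_cyl(2) path_prefix_in_fin_paths(2)[OF B \<phi>P[OF x]] by blast
      then show "finite {p\<in>topspace X. E n x p} \<and> card {p\<in>topspace X. E n x p} \<le> card (\<Union>v\<in>BV B n. fin_paths B n v)"
        using W prefix_inj[of n x] unfolding W_def[symmetric]
        by (meson card_inj_on_le finite_imageD finite_subset)
    qed
  next
    fix g assume g: "g \<in> G"
    have "{x\<in>topspace X. \<not> (\<exists>n U. openin X U \<and> x \<in> U \<and> (\<forall>z\<in>U. E n z (\<rho> g z)))}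
      \<subseteq> \<psi> ` {p. singularity B (\<tau> g) p}"
    proof (rule subsetI, rule ccontr)
      fix x assume x: "x \<in> {x\<in>topspace X. \<not> (\<exists>n U. openin X U \<and> x \<in> U \<and> (\<forall>z\<in>U. E n z (\<rho> g z)))}"
        and n: "x \<notin> \<psi> ` {p. singularity B (\<tau> g) p}"
      have xX: "x \<in> topspace X" using x by blast
      have "\<not> singularity B (\<tau> g) (\<phi> x)" using n \<psi>\<phi>[OF xX] by (metis imageI mem_Collect_eq)
      then obtain n \<eta> U where U: "openin (path_top B) U" "\<phi> x \<in> U"
        "\<And>y. y \<in> U \<Longrightarrow> \<tau> g y = prefix_repl n \<eta> y"
        unfolding singularity_def using \<phi>P[OF xX] by blast
      let ?V = "{z\<in>topspace X. \<phi> z \<in> U}"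
      have "E n z (\<rho> g z)" if "z \<in> ?V" for z
      proof -
        have "\<phi> (\<rho> g z) = prefix_repl n \<eta> (\<phi> z)" using U(3)[of "\<phi> z"] \<tau>\<phi>[of z g] that by simp
        then show ?thesis unfolding E_def prefix_repl_def by simp
      qed
      then show False using x \<phi>open[OF U(1)] U(2) by blast
    qed
    moreover have "finite {p. singularity B (\<tau> g) p}" using bt[OF g] unfolding bounded_type_def by blast
    ultimately show "finite {x\<in>topspace X. \<not> (\<exists>n U. openin X U \<and> x \<in> U \<and> (\<forall>z\<in>U. E n z (\<rho> g z)))}"
      by (meson finite_imageI finite_subset)
  next
    fix g assume g: "g \<in> G"
    obtain M where M: "\<And>n v. v \<in> BV B n \<Longrightarrow> A_count B (\<tau> g) n v \<le> M"
      using bt[OF g] unfolding bounded_type_def by blast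
    have "card {p\<in>topspace X. E n x p \<and> \<not> E n x (\<rho> g p)} \<le> M" if x: "x \<in> topspace X" for n x
    proof -
      \<comment> \<open>All points of the class of \<open>x\<close> share the edge with index
        \<open>n\<close>, so their prefixes end at the same vertex and a single
        \<open>A_count\<close> bounds the exits.\<close>
      define v where "v = Bo B (Suc n) (\<phi> x n)"
      define W where "W = {\<gamma>\<in>fin_paths B n v. \<not> (\<exists>\<eta>\<in>fin_paths B n v. \<forall>y\<in>cyl B n v \<gamma>. \<tau> g y = prefix_repl n \<eta> y)}"
      have finW: "finite W" unfolding W_def using finite_fin_paths[OF B] by simp
      have "(\<lambda>p. map (\<phi> p) [0..<n]) ` {p\<in>topspace X. E n x p \<and> \<not> E n x (\<rho> g p)} \<subseteq> W"
      proof (rule image_subsetI)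
        fix p assume p: "p \<in> {p\<in>topspace X. E n x p \<and> \<not> E n x (\<rho> g p)}"
        have "\<not> (\<exists>\<eta>\<in>fin_paths B n v. \<forall>y\<in>cyl B n v (map (\<phi> p) [0..<n]). \<tau> g y = prefix_repl n \<eta> y)"
        proof
          assume "\<exists>\<eta>\<in>fin_paths B n v. \<forall>y\<in>cyl B n v (map (\<phi> p) [0..<n]). \<tau> g y = prefix_repl n \<eta> y"
          then obtain \<eta> where "\<tau> g (\<phi> p) = prefix_repl n \<eta> (\<phi> p)"
            using E_cyl(1)[of p n x] p unfolding v_def by blast
          moreover have "\<tau> g (\<phi> p) = \<phi> (\<rho> g p)" using \<tau>\<phi>[of p g] p by blast
          ultimately have "\<phi> (\<rho> g p) i = \<phi> p i" if "n \<le> i" for i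
            using that unfolding prefix_repl_def by (metis linorder_not_less)
          then have "E n x (\<rho> g p)" using p unfolding E_def by simp
          then show False using p by blast
        qed
        then show "map (\<phi> p) [0..<n] \<in> W" unfolding W_def using E_cyl(2)[of p n x] p unfolding v_def by blast
      qed
      moreover have "inj_on (\<lambda>p. map (\<phi> p) [0..<n]) {p\<in>topspace X. E n x p \<and> \<not> E n x (\<rho> g p)}"
        by (rule inj_on_subset[OF prefix_inj[of n x]]) blast
      ultimately have "card {p\<in>topspace X. E n x p \<and> \<not> E n x (\<rho> g p)} \<le> card W"
        using finW card_inj_on_le by blast
      also have "\<dots> \<le> M"
        using M[OF path_prefix_in_fin_paths(2)[OF B \<phi>P[OF x], of n]] unfolding W_def A_count_def v_def .
      finally show ?thesis .
    qed
    then show "\<exists>M. \<forall>n. \<forall>x\<in>topspace X. card {p\<in>topspace X. E n x p \<and> \<not> E n x (\<rho> g p)} \<le> M" by blast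
  next
    fix K S x assume K: "K \<subseteq> G" "perm_group K" "gens S K" and x: "x \<in> topspace X"
      and fixx: "\<And>k. k \<in> K \<Longrightarrow> \<rho> k x = x"
    let ?H = "conj_map B \<phi> \<psi> ` H" and ?P = "path_top B"
    have HX: "h z \<in> topspace X" if "h \<in> H" "z \<in> topspace X" for h z
      using homeomorphic_imp_continuous_map[OF H(1)[OF that(1)]] that(2) unfolding continuous_map_def by auto
    have fi: "finite_index {k\<in>K. \<exists>U. openin ?P U \<and> \<phi> x \<in> U \<and> (\<forall>z\<in>U. \<tau> k z = z)} K"
    proof (rule finite_index_germ_stab[OF _ _ _ K(2,3)])
      show "locally_finite_group (fun_group (stab ?P ?H (\<phi> x)) Mod germ_stab ?P ?H (\<phi> x))"
        using sb \<phi>P[OF x] unfolding strongly_bounded_type_B_def by blast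
      fix h assume h: "h \<in> ?H"
      show "continuous_map ?P ?P h"
        using sb h homeomorphic_imp_continuous_map unfolding strongly_bounded_type_B_def bounded_type_def by blast
      fix h' assume "h' \<in> ?H"
      then obtain f f' where f: "f \<in> H" "h = conj_map B \<phi> \<psi> f" "f' \<in> H" "h' = conj_map B \<phi> \<psi> f'" using h by blast
      have "h \<circ> h' = conj_map B \<phi> \<psi> (f \<circ> f')"
        unfolding f(2,4) using conj_map_comp[OF hm, of f' f] HX[OF f(3)] by simp
      then show "h \<circ> h' \<in> ?H" using H(3)[OF f(1,3)] by blast
    next
      show "\<phi> x \<in> topspace ?P" unfolding topspace_path_top by (rule \<phi>P[OF x])
      show "\<tau> id = id"
      proof
        fix p
        have "\<phi> (\<psi> p) = p" if "p \<in> path_space B"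
          using hm that unfolding homeomorphic_maps_def topspace_path_top by blast
        then show "\<tau> id p = id p" unfolding \<tau>_def conj_map_def \<rho>id by simp
      qed
      fix k assume k: "k \<in> K"
      show "\<tau> k \<in> ?H" unfolding \<tau>_def using \<rho>H k K(1) by blast
      show "\<tau> k (\<phi> x) = \<phi> x" using \<tau>\<phi>[OF x] fixx[OF k] by simp
      fix k' assume k': "k' \<in> K"
      have kG: "k \<in> G" "k' \<in> G" using k k' K(1) by auto
      show "\<tau> (k \<circ> k') = \<tau> k \<circ> \<tau> k'"
        unfolding \<tau>_def \<rho>c[OF kG] using conj_map_comp[OF hm, of "\<rho> k'" "\<rho> k"] \<rho>X[OF kG(2)] by simp
    qed
    have "{k\<in>K. \<exists>U. openin ?P U \<and> \<phi> x \<in> U \<and> (\<forall>z\<in>U. \<tau> k z = z)} \<subseteq>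
        {k\<in>K. \<exists>U. openin X U \<and> x \<in> U \<and> (\<forall>z\<in>U. \<rho> k z = z)}"
    proof
      fix k assume k: "k \<in> {k\<in>K. \<exists>U. openin ?P U \<and> \<phi> x \<in> U \<and> (\<forall>z\<in>U. \<tau> k z = z)}"
      then obtain U where U: "openin ?P U" "\<phi> x \<in> U" "\<And>z. z \<in> U \<Longrightarrow> \<tau> k z = z" by blast
      have kG: "k \<in> G" using k K(1) by blast
      have "\<rho> k z = z" if "z \<in> {z\<in>topspace X. \<phi> z \<in> U}" for z
      proof -
        have zX: "z \<in> topspace X" and zU: "\<phi> z \<in> U" using that by auto
        have "\<phi> (\<rho> k z) = \<phi> z" using U(3)[OF zU] \<tau>\<phi>[OF zX] by simp
        then show ?thesis using \<phi>inj[OF \<rho>X[OF kG zX] zX] by blast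
      qed
      then show "k \<in> {k\<in>K. \<exists>U. openin X U \<and> x \<in> U \<and> (\<forall>z\<in>U. \<rho> k z = z)}"
        using k \<phi>open[OF U(1)] U(2) x by blast
    qed
    then show "finite_index {k\<in>K. \<exists>U. openin X U \<and> x \<in> U \<and> (\<forall>z\<in>U. \<rho> k z = z)} K"
      by (rule finite_index_mono[OF fi])
  qed (use G act cont in \<open>auto simp: E_def\<close>)
  then show ?thesis by blast
qed

theorem theorem6p32:
  fixes T :: "'a list set" and G :: "('a list \<Rightarrow> 'a list) set"
    and X :: "'x topology" and H :: "('x \<Rightarrow> 'x) set"
    and \<rho> :: "('a list \<Rightarrow> 'a list) \<Rightarrow> 'x \<Rightarrow> 'x"
  assumes "infinite_locally_finite_rooted_tree T"
    and "branch_group T G"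
    and "finitely_generated (fun_group G)"
    and "compact_space X" and "totally_disconnected_space X"
    and "subgroup H (homeo_group X)"
    and "strongly_bounded_type X H"
    and "\<rho> \<in> hom (fun_group G) (fun_group H)"
    and "inj_on \<rho> G"
  shows "\<exists>q. continuous_map (subtopology X (essential_support T G X \<rho>)) (boundary_top T) q \<and>
           (\<forall>g\<in>G. \<forall>y\<in>essential_support T G X \<rho>. q (\<rho> g y) = bd_act g (q y))"
proof -
  interpret branch_tree T G using assms(1-3) by unfold_locales
  obtain E where E: "tame_action X G \<rho> E"
    using tame_action_if_strongly_bounded_type[OF G assms(6-8)] by blast
  interpret tame_action X G \<rho> E by (rule E)
  define Y where "Y = essential_support T G X \<rho>"
  \<comment> \<open>The body of \<open>Z\<close> is repeated because the locale that defines it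
    assumes nontrivial rigid stabilizers, which are available only once \<open>Y\<close> has a
    point.\<close>
  let ?Z = "\<lambda>u. X closure_of {x\<in>topspace X. \<exists>g\<in>R u. \<exists>h\<in>R u. \<rho> (comm g h) x \<noteq> x}"
  have cover: "Y \<subseteq> (\<Union>u\<in>lev n. ?Z u)" if "n \<ge> 1" for n
  proof -
    let ?D = "derived (fun_group G) (rist_level T G n)"
    have "{x\<in>topspace X. \<exists>g\<in>?D. \<rho> g x \<noteq> x} \<subseteq> (\<Union>u\<in>lev n. ?Z u)"
    proof
      fix x assume x: "x \<in> {x\<in>topspace X. \<exists>g\<in>?D. \<rho> g x \<noteq> x}"
      then obtain u g h where u: "u \<in> lev n" "g \<in> R u" "h \<in> R u" "\<rho> (comm g h) x \<noteq> x"
        using derived_rist_level_fixes[OF act, of _ n x] by blast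
      have "{x\<in>topspace X. \<exists>g\<in>R u. \<exists>h\<in>R u. \<rho> (comm g h) x \<noteq> x} \<subseteq> ?Z u"
        by (rule closure_of_subset) blast
      then show "x \<in> (\<Union>u\<in>lev n. ?Z u)" using u x by blast
    qed
    moreover have "closedin X (\<Union>u\<in>lev n. ?Z u)"
      using lev_finite[of n] by (intro closedin_Union) auto
    ultimately have "supp_act X \<rho> ?D \<subseteq> (\<Union>u\<in>lev n. ?Z u)"
      unfolding supp_act_def by (rule closure_of_minimal)
    then show ?thesis unfolding Y_def essential_support_def using that by blast
  qed
  have "supp_act X \<rho> K \<subseteq> topspace X" for K
    unfolding supp_act_def by (rule closure_of_subset_topspace)
  then have YX: "Y \<subseteq> topspace X" unfolding Y_def essential_support_def by fastforce
  show ?thesis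
  proof (cases "Y = {}")
    \<comment> \<open>With \<open>Y\<close> empty there is nothing to map, so an arbitrary constant
      serves.\<close>
    case True
    then show ?thesis unfolding Y_def[symmetric]
      by (intro exI[of _ "\<lambda>_ _. undefined"]) (simp add: continuous_map_def)
  next
    case False
    then obtain y where y: "y \<in> Y" by blast
    \<comment> \<open>The closure of the empty set is empty, so a point of \<open>?Z u\<close>
      forces some commutator in \<open>R u\<close> to move a point.\<close>
    have "\<exists>u\<in>lev n. \<exists>k\<in>R u. k \<noteq> id" if n: "n \<ge> 1" for n
    proof -
      obtain u where u: "u \<in> lev n" "y \<in> ?Z u" using cover[OF n] y by blast
      have "{x\<in>topspace X. \<exists>g\<in>R u. \<exists>h\<in>R u. \<rho> (comm g h) x \<noteq> x} \<noteq> {}"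
        using u(2) by (metis closure_of_empty empty_iff)
      then obtain x g h where x: "g \<in> R u" "h \<in> R u" "\<rho> (comm g h) x \<noteq> x" by blast
      have "comm g h \<noteq> id" using x(3) actsD(1)[OF act] by metis
      then show ?thesis using u(1) comm_in[OF R_perm x(1,2)] by blast
    qed
    then interpret nontrivial_branch_tree T G
      by unfold_locales (rule R_nontrivial)
    interpret branch_action T G X \<rho> E ..
    show ?thesis
      using factor_map[OF YX] cover unfolding Z_def Y_def by blast
  qed
qed

end
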